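(* Let $d\ge 1$ be an integer, let $(X_i)_{i\in\mathbb{Z}^d}$ be a stationary real random field with marginal density $f$, let $(\Lambda_n)_{n\ge1}$ be a sequence of finite subsets of $\mathbb{Z}^d$ with $|\Lambda_n|\to\infty$, and let $(b_n)_{n\ge 1}$ be a sequence of positive real numbers. Assume that $f$ is differentiable with locally bounded derivative $f'$, and that $b_n\to0$ and $|\Lambda_n|b_n\to\infty$ as $n\to\infty$. Assume moreover that one of the following two conditions holds: (i) $$\sup_{j\in\mathbb{Z}^d,\,j\ne0}\mathbb{P}\left(X_0\in I_{n,s},\,X_j\in I_{n,t}\right)=O(b_n^2)\quad\text{for any } s \text{ and } t \text{ in } \mathbb{Z},$$ and $\sum_{m\ge1}m^{2d-1}\alpha_{1,\infty}(m)<\infty$; (ii) $$\mathbb{P}\left(X_0\in I_{n,s},\,X_j\in I_{n,t}\right)=o(b_n)\quad\text{for any } s \text{ and } t \text{ in } \mathbb{Z} \text{ and any } j \text{ in } \mathbb{Z}^d\setminus\{0\},$$ and $\sum_{m\ge1}m^{d-1}\rho_{1,\infty}(m)<\infty$. Then for every positive integer $r$ and all distinct points $x_1,\dots,x_r\in\mathbb{R}$ with $f(x_i)>0$ for $1\le i\le r$, the random vector $$(|\Lambda_n|b_n)^{1/2}\begin{pmatrix} f_n(x_1)-\mathbb{E}f_n(x_1)\\ \vdots\\ f_n(x_r)-\mathbb{E}f_n(x_r)\end{pmatrix}$$ converges in law, as $n\to\infty$, to the Gaussian distribution $\mathcal{N}(0,\mathrm{Id})$, where $\mathrm{Id}$ is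 the identity matrix of order $r$.
   Context: Notation. $|B|$ is the number of elements of a set $B\subset\mathbb{Z}^d$. For $i=(i_1,\dots,i_d)\in\mathbb{Z}^d$, $|i|=\max_{1\le k\le d}|i_k|$. For $B_1,B_2\subset\mathbb{Z}^d$, $\Xi(B_1,B_2)=\min\{|i-j| : i\in B_1,\ j\in B_2\}$. No condition is imposed on the boundary of the regions $\Lambda_n$. Mixing coefficients. For two $\sigma$-algebras $\mathcal{U},\mathcal{V}$ on the underlying probability space, $$\alpha(\mathcal{U},\mathcal{V})=\sup\{|\mathbb{P}(A\cap B)-\mathbb{P}(A)\mathbb{P}(B)| : A\in\mathcal{U},\ B\in\mathcal{V}\},$$ $$\rho(\mathcal{U},\mathcal{V})=\sup\left\{\frac{|\mathrm{Cov}(g,h)|}{\|g\|_2\|h\|_2} : g\in\mathbb{L}^2(\mathcal{U}),\ h\in\mathbb{L}^2(\mathcal{V})\right\}.$$ For $B\subset\mathbb{Z}^d$ let $\mathcal{F}_B=\sigma(X_i : i\in B)$. For $\tau\in\mathbb{N}^*\cup\{\infty\}$ ($\mathbb{N}^*$ is the set of positive integers) and a positive integer $m$, $$\alpha_{1,\tau}(m)=\sup\{\alpha(\sigma(X_k),\mathcal{F}_B) : k\in\mathbb{Z}^d,\ |B|\le\tau,\ \Xi(B,\{k\})\ge m\},$$ $$\rho_{1,\tau}(m)=\sup\{\rho(\sigma(X_k),\mathcal{F}_B) : k\in\mathbb{Z}^d,\ |B|\le\tau,\ \Xi(B,\{k\})\ge m\}$$ (for $\tau=\infty$ there is no restriction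 on the cardinality of $B$). Frequency polygon. For $n\ge1$ and $k\in\mathbb{Z}$ put $I_{n,k}=[(k-1)b_n,kb_n)$ and $J_{n,k}=\left[(k-\tfrac12)b_n,(k+\tfrac12)b_n\right)$, and let $\nu_{n,k}=|\{i\in\Lambda_n : X_i\in I_{n,k}\}|$ be the number of observations falling in $I_{n,k}$. For $x\in J_{n,k}$, $$f_{n,k}(x)=\left(\frac12+k-\frac{x}{b_n}\right)\frac{\nu_{n,k}}{|\Lambda_n|b_n}+\left(\frac12-k+\frac{x}{b_n}\right)\frac{\nu_{n,k+1}}{|\Lambda_n|b_n}.$$ The normalized frequency polygon estimator is defined, for $x\in\mathbb{R}$ with $f(x)>0$, by $$f_n(x)=\sum_{k\in\mathbb{Z}}\frac{f_{n,k}(x)}{\sigma_{n,k}(x)}\mathbf{1}_{J_{n,k}}(x),\qquad \sigma_{n,k}^2(x)=\left(\frac12+2\left(k-\frac{x}{b_n}\right)^2\right)f(x),\quad \sigma_{n,k}(x)>0.$$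
   Formalization: In (i) and (ii) the bounds O(b_n^2) and o(b_n) are required with s and t allowed to depend on n, i.e. uniformly in s and t in Z (j stays fixed in (ii)); with s, t fixed the bins shrink to 0 and the claim fails. *)

theory Defs
  imports "HOL-Probability.Probability" "HOL-Library.Landau_Symbols" "HOL-Library.Extended_Nat"
begin

definition lat_norm :: "int ^ 'd \<Rightarrow> nat" where
  "lat_norm i = Max (range (\<lambda>k. nat \<bar>i $ k\<bar>))"

text \<open>
  The infimum is taken in the naturals, so it is attained whenever both sets are nonempty;
  on an empty argument the value is immaterial, and only nonempty sets are used below.
\<close>

definition lat_dist :: "(int ^ 'd) set \<Rightarrow> (int ^ 'd) set \<Rightarrow> nat" where
  "lat_dist B\<^sub>1 B\<^sub>2 = Inf {lat_norm (i - j) | i j. i \<in> B\<^sub>1 \<and> j \<in> B\<^sub>2}"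

text \<open>Strict stationarity: the law of the whole field is invariant under translations.\<close>

definition stationary_field :: "'a measure \<Rightarrow> (int ^ 'd \<Rightarrow> 'a \<Rightarrow> real) \<Rightarrow> bool" where
  "stationary_field M X \<longleftrightarrow>
     (\<forall>i. X i \<in> borel_measurable M) \<and>
     (\<forall>k. distr M (PiM UNIV (\<lambda>_. borel)) (\<lambda>\<omega> i. X (i + k) \<omega>) =
          distr M (PiM UNIV (\<lambda>_. borel)) (\<lambda>\<omega> i. X i \<omega>))"

definition field_sigma :: "'a measure \<Rightarrow> (int ^ 'd \<Rightarrow> 'a \<Rightarrow> real) \<Rightarrow> (int ^ 'd) set \<Rightarrow> 'a measure" where
  "field_sigma M X B = sigma (space M) {X i -` A \<inter> space M | i A. i \<in> B \<and> A \<in> sets borel}"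

text \<open>
  In the next two definitions \<open>U\<close> and \<open>V\<close> stand for sub-sigma-algebras of \<open>M\<close>; only their
  measurable sets matter. Both suprema are over nonempty sets of reals in \<open>[0, 1]\<close>; a quotient
  with a vanishing denominator contributes \<open>0\<close>.
\<close>

definition alpha_coeff :: "'a measure \<Rightarrow> 'a measure \<Rightarrow> 'a measure \<Rightarrow> real" where
  "alpha_coeff M U V =
     Sup {\<bar>measure M (A \<inter> B) - measure M A * measure M B\<bar> | A B. A \<in> sets U \<and> B \<in> sets V}"

definition sq_integrable :: "'a measure \<Rightarrow> 'a measure \<Rightarrow> ('a \<Rightarrow> real) set" where
  "sq_integrable M U = {g \<in> borel_measurable U. integrable M (\<lambda>\<omega>. (g \<omega>)\<^sup>2)}"

definition norm2 :: "'a measure \<Rightarrow> ('a \<Rightarrow> real) \<Rightarrow> real" where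
  "norm2 M g = sqrt (\<integral>\<omega>. (g \<omega>)\<^sup>2 \<partial>M)"

definition covar :: "'a measure \<Rightarrow> ('a \<Rightarrow> real) \<Rightarrow> ('a \<Rightarrow> real) \<Rightarrow> real" where
  "covar M g h = (\<integral>\<omega>. (g \<omega> - (\<integral>\<omega>'. g \<omega>' \<partial>M)) * (h \<omega> - (\<integral>\<omega>'. h \<omega>' \<partial>M)) \<partial>M)"

definition rho_coeff :: "'a measure \<Rightarrow> 'a measure \<Rightarrow> 'a measure \<Rightarrow> real" where
  "rho_coeff M U V =
     Sup {\<bar>covar M g h\<bar> / (norm2 M g * norm2 M h) | g h.
            g \<in> sq_integrable M U \<and> h \<in> sq_integrable M V}"

definition mixing_pairs :: "enat \<Rightarrow> nat \<Rightarrow> ((int ^ 'd) \<times> (int ^ 'd) set) set" where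
  "mixing_pairs \<tau> m =
     {(k, B). B \<noteq> {} \<and> (\<tau> \<noteq> \<infinity> \<longrightarrow> finite B \<and> enat (card B) \<le> \<tau>) \<and> m \<le> lat_dist B {k}}"

definition alpha_1 :: "'a measure \<Rightarrow> (int ^ 'd \<Rightarrow> 'a \<Rightarrow> real) \<Rightarrow> enat \<Rightarrow> nat \<Rightarrow> real" where
  "alpha_1 M X \<tau> m =
     (SUP (k, B)\<in>mixing_pairs \<tau> m. alpha_coeff M (field_sigma M X {k}) (field_sigma M X B))"

definition rho_1 :: "'a measure \<Rightarrow> (int ^ 'd \<Rightarrow> 'a \<Rightarrow> real) \<Rightarrow> enat \<Rightarrow> nat \<Rightarrow> real" where
  "rho_1 M X \<tau> m =
     (SUP (k, B)\<in>mixing_pairs \<tau> m. rho_coeff M (field_sigma M X {k}) (field_sigma M X B))"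

text \<open>Below, \<open>b\<close> is the bin width and \<open>L\<close> the finite observation region.\<close>

definition bin :: "real \<Rightarrow> int \<Rightarrow> real set" where
  "bin b k = {(of_int k - 1) * b ..< of_int k * b}"

definition mid_bin :: "real \<Rightarrow> int \<Rightarrow> real set" where
  "mid_bin b k = {(of_int k - 1/2) * b ..< (of_int k + 1/2) * b}"

definition bin_count :: "(int ^ 'd \<Rightarrow> 'a \<Rightarrow> real) \<Rightarrow> (int ^ 'd) set \<Rightarrow> real \<Rightarrow> int \<Rightarrow> 'a \<Rightarrow> nat" where
  "bin_count X L b k \<omega> = card {i \<in> L. X i \<omega> \<in> bin b k}"

definition poly_piece ::
  "(int ^ 'd \<Rightarrow> 'a \<Rightarrow> real) \<Rightarrow> (int ^ 'd) set \<Rightarrow> real \<Rightarrow> int \<Rightarrow> real \<Rightarrow> 'a \<Rightarrow> real" where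
  "poly_piece X L b k x \<omega> =
     (1/2 + of_int k - x / b) * (real (bin_count X L b k \<omega>) / (real (card L) * b)) +
     (1/2 - of_int k + x / b) * (real (bin_count X L b (k + 1) \<omega>) / (real (card L) * b))"

definition poly_sigma :: "(real \<Rightarrow> real) \<Rightarrow> real \<Rightarrow> int \<Rightarrow> real \<Rightarrow> real" where
  "poly_sigma f b k x = sqrt ((1/2 + 2 * (of_int k - x / b)\<^sup>2) * f x)"

text \<open>
  The sets \<open>mid_bin b k\<close> partition the line when \<open>b > 0\<close>, so the sum has at most one nonzero term.
\<close>

definition freq_polygon ::
  "(int ^ 'd \<Rightarrow> 'a \<Rightarrow> real) \<Rightarrow> (real \<Rightarrow> real) \<Rightarrow> (int ^ 'd) set \<Rightarrow> real \<Rightarrow> real \<Rightarrow> 'a \<Rightarrow> real" where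
  "freq_polygon X f L b x \<omega> =
     (\<Sum>\<^sub>\<infinity>k\<in>UNIV. poly_piece X L b k x \<omega> / poly_sigma f b k x * indicator (mid_bin b k) x)"

definition conv_in_law ::
  "'a measure \<Rightarrow> (nat \<Rightarrow> 'a \<Rightarrow> 'b::topological_space) \<Rightarrow> 'b measure \<Rightarrow> bool" where
  "conv_in_law M Z N \<longleftrightarrow>
     (\<forall>\<phi> :: 'b \<Rightarrow> real. continuous_on UNIV \<phi> \<and> bounded (range \<phi>) \<longrightarrow>
        (\<lambda>n. \<integral>z. \<phi> z \<partial>(distr M borel (Z n))) \<longlonglongrightarrow> (\<integral>z. \<phi> z \<partial>N))"

text \<open>The law \<open>N(0, Id)\<close>, given by its density \<open>(2 pi)^(-r/2) exp(- |y|^2 / 2)\<close>.\<close>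

definition std_gaussian :: "(real ^ 'r) measure" where
  "std_gaussian = density lborel
     (\<lambda>y. ennreal (exp (- (norm y)\<^sup>2 / 2) / sqrt (2 * pi) ^ CARD('r)))"

end

theory Submission
  imports Defs
begin

text \<open>
  Let \<open>Z n\<close> be the random vector of the theorem. By Levy's continuity theorem on a Euclidean space
  (\<open>levy_continuity_euclidean\<close>) it suffices that the characteristic function of every linear form
  \<open>t \<bullet> Z n\<close> converges to that of the Gaussian law. Such a linear form is a centred sum over
  the sites \<open>i \<in> \<Lambda> n\<close> of \<open>g (X i)\<close>, where \<open>g\<close> is \<open>(card (\<Lambda> n) * b n) powr (- 1/2)\<close> times a bounded step
  function supported on two bins near each of the points \<open>x l\<close>.

  The sum behaves like a sum of independent variables. To see this, compare the
  expectation of the product of the \<open>V i = exp (\<i> g (X i))\<close> with the product of their expectations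
  (\<open>expectation_product_decoupling\<close>). Splitting off the factor \<open>V k\<close> costs the covariance of \<open>V k - 1\<close>
  with the product over the remaining sites. That product is expanded by removing the sites closest
  to \<open>k\<close> first: \<open>V_A = V_B + V_B (V_j - 1)\<close>. Every covariance that arises is between a
  function of \<open>X k\<close> and a function of sites at distance at least \<open>\<bar>j - k\<bar>\<close> from \<open>k\<close>, so mixing
  coefficients of one site against arbitrarily many are exactly what is needed, and it
  contains the two small factors \<open>V k - 1\<close> and \<open>V j - 1\<close>.

  Such a covariance is at most \<open>E \<bar>g (X k) g (X j)\<bar> + (E \<bar>g\<bar>)\<^sup>2\<close>, which by the hypothesis on pairs of
  bins is of order \<open>b n / card (\<Lambda> n)\<close> under (i) and \<open>o(1 / card (\<Lambda> n))\<close> under (ii); and it is at most a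
  constant times \<open>alpha(\<bar>j - k\<bar>) / (card (\<Lambda> n) * b n)\<close>, respectively \<open>rho(\<bar>j - k\<bar>) / card (\<Lambda> n)\<close>.
  After summation over \<open>k\<close> the factor \<open>card (\<Lambda> n)\<close> disappears. The first bound is used for \<open>\<bar>j - k\<bar>\<close> below
  a cutoff and the second above it. Under (ii) the cutoff may be a large constant; under
  (i) it is of order \<open>(\<delta> / b n) powr (1/d)\<close>, and the summability of \<open>m^(2d-1) alpha(m)\<close> is just
  sufficient (\<open>dependence_error_correlation_mixing\<close>, \<open>dependence_error_strong_mixing\<close>).

  What remains is the \<open>card (\<Lambda> n)\<close>-th power of one characteristic function, treated by a Taylor
  expansion (\<open>power_char_near_gaussian\<close>). The limiting variance is the squared norm of \<open>t\<close>: the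
  normalization gives every point variance 1 (\<open>polygon_kernel_variance\<close>), and distinct
  points use disjoint bins as soon as \<open>b n\<close> is small (\<open>polygon_kernels_orthogonal\<close>).
\<close>

section \<open>Trigonometric polynomials and weak convergence\<close>

text \<open>
  The coordinatewise map \<open>x \<mapsto> sin (w x)\<close> turns ordinary polynomials into trigonometric ones. The
  phase \<open>c\<close> makes sine waves and constants available, and lets a product of two waves be again a
  sum of waves, so the class is an algebra although it is only closed under sums by definition.
\<close>

inductive trig_poly :: "('a::real_inner \<Rightarrow> real) \<Rightarrow> bool" where
  wave: "trig_poly (\<lambda>x. a * cos (t \<bullet> x + c))"
| add: "trig_poly p \<Longrightarrow> trig_poly q \<Longrightarrow> trig_poly (\<lambda>x. p x + q x)"

lemma trig_poly_const: "trig_poly (\<lambda>x. c)"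
  using trig_poly.wave[of c 0 0] by simp

lemma trig_poly_sum:
  assumes "finite I" "\<And>i. i \<in> I \<Longrightarrow> trig_poly (p i)"
  shows "trig_poly (\<lambda>x. \<Sum>i\<in>I. p i x)"
  using assms
proof (induction I rule: finite_induct)
  case empty
  show ?case using trig_poly_const[of 0] by simp
next
  case (insert i I)
  then show ?case by (simp add: trig_poly.add)
qed

lemma trig_poly_wave_mult:
  assumes "trig_poly q"
  shows "trig_poly (\<lambda>x. a * cos (t \<bullet> x + c) * q x)"
  using assms
proof induction
  case (wave a' t' c')
  have "(\<lambda>x. a * cos (t \<bullet> x + c) * (a' * cos (t' \<bullet> x + c'))) =
     (\<lambda>x. (a * a' / 2) * cos ((t - t') \<bullet> x + (c - c')) + (a * a' / 2) * cos ((t + t') \<bullet> x + (c + c')))"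
  proof (rule ext)
    fix x
    have "(t - t') \<bullet> x + (c - c') = (t \<bullet> x + c) - (t' \<bullet> x + c')"
      "(t + t') \<bullet> x + (c + c') = (t \<bullet> x + c) + (t' \<bullet> x + c')"
      by (simp_all add: inner_diff_left inner_add_left)
    then show "a * cos (t \<bullet> x + c) * (a' * cos (t' \<bullet> x + c')) =
        (a * a' / 2) * cos ((t - t') \<bullet> x + (c - c')) + (a * a' / 2) * cos ((t + t') \<bullet> x + (c + c'))"
      by (simp only: cos_diff[of "t \<bullet> x + c"] cos_add[of "t \<bullet> x + c"]) (simp add: field_simps)
  qed
  then show ?case by (simp only:) (intro trig_poly.intros)
next
  case (add p q)
  then show ?case by (simp add: distrib_left trig_poly.add)
qed

lemma trig_poly_mult:
  assumes "trig_poly p" "trig_poly q"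
  shows "trig_poly (\<lambda>x. p x * q x)"
  using assms(1)
proof induction
  case (wave a t c)
  then show ?case by (rule trig_poly_wave_mult[OF assms(2)])
next
  case (add p q)
  then show ?case by (simp add: distrib_right trig_poly.add)
qed

lemma trig_poly_sin_coordinate: "trig_poly (\<lambda>x. a * sin (w * (x \<bullet> e)))"
proof -
  have "(\<lambda>x. a * sin (w * (x \<bullet> e))) = (\<lambda>x. a * cos ((w *\<^sub>R e) \<bullet> x + (- (pi/2))))"
    by (rule ext) (simp add: cos_diff inner_commute)
  then show ?thesis by (simp only:) (rule trig_poly.wave)
qed

lemma trig_poly_of_polynomial_of_sines:
  fixes p :: "'a::euclidean_space \<Rightarrow> real"
  assumes "real_polynomial_function p"
  shows "trig_poly (\<lambda>x. p (\<Sum>e\<in>Basis. sin (w * (x \<bullet> e)) *\<^sub>R e))"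
  using assms
proof induction
  case (linear f)
  then interpret f: bounded_linear f .
  have "f (\<Sum>e\<in>Basis. sin (w * (x \<bullet> e)) *\<^sub>R e) = (\<Sum>e\<in>Basis. f e * sin (w * (x \<bullet> e)))" for x :: 'a
    by (simp add: f.sum f.scaleR mult.commute)
  then show ?case by (simp only:) (intro trig_poly_sum trig_poly_sin_coordinate finite_Basis)
qed (simp_all add: trig_poly_const trig_poly.add trig_poly_mult)

text \<open>
  The function \<open>arcsin \<circ> sin\<close>, rescaled, is the identity on \<open>[-K, K]\<close> and bounded everywhere.
  So \<open>\<phi>\<close> can be replaced by a function of the sines of the coordinates, which agrees with \<open>\<phi>\<close> on
  the cube and lives on the compact cube \<open>[-1, 1]\<close>; Stone-Weierstrass there gives a polynomial in
  the sines. The approximation is uniform on the folded space, which is why \<open>p\<close> stays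
  bounded outside the cube as well.
\<close>

lemma trig_poly_approximation:
  fixes \<phi> :: "'a::euclidean_space \<Rightarrow> real"
  assumes cont: "continuous_on UNIV \<phi>" and bdd: "\<And>x. \<bar>\<phi> x\<bar> \<le> B" and "K > 0" "\<epsilon> > 0"
  obtains p where "trig_poly p" "\<And>x. \<bar>p x\<bar> \<le> B + \<epsilon>"
    "\<And>x. (\<forall>e\<in>Basis. \<bar>x \<bullet> e\<bar> \<le> K) \<Longrightarrow> \<bar>p x - \<phi> x\<bar> \<le> \<epsilon>"
proof -
  define w where "w = pi / (2 * K)"
  define cube where "cube = cbox (- One) (One :: 'a)"
  define \<psi> where "\<psi> u = \<phi> (\<Sum>e\<in>Basis. (arcsin (u \<bullet> e) / w) *\<^sub>R e)" for u :: 'a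
  have "w > 0" using \<open>K > 0\<close> by (simp add: w_def)
  have cube: "u \<in> cube \<longleftrightarrow> (\<forall>e\<in>Basis. -1 \<le> u \<bullet> e \<and> u \<bullet> e \<le> 1)" for u
    unfolding cube_def mem_box by (auto simp: inner_minus_left)
  have "continuous_on cube \<psi>"
  proof -
    have "continuous_on cube (\<lambda>u. (arcsin (u \<bullet> e) / w) *\<^sub>R e)" if "e \<in> Basis" for e
      using that cube \<open>w > 0\<close>
      by (intro continuous_on_scaleR continuous_on_divide continuous_on_arcsin continuous_on_inner
          continuous_on_id continuous_on_const) blast+
    then have "continuous_on cube (\<lambda>u. \<Sum>e\<in>Basis. (arcsin (u \<bullet> e) / w) *\<^sub>R e)"
      by (rule continuous_on_sum)
    then show ?thesis
      unfolding \<psi>_def by (rule continuous_on_compose2[OF cont]) simp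
  qed
  then obtain q where q: "real_polynomial_function q" "\<And>u. u \<in> cube \<Longrightarrow> \<bar>\<psi> u - q u\<bar> < \<epsilon>"
    using Stone_Weierstrass_real_polynomial_function[of cube \<psi> \<epsilon>] \<open>\<epsilon> > 0\<close>
    by (auto simp: cube_def)
  define S where "S x = (\<Sum>e\<in>Basis. sin (w * (x \<bullet> e)) *\<^sub>R e)" for x :: 'a
  have S_cube: "S x \<in> cube" for x by (auto simp: cube S_def inner_sum_left_Basis)
  show ?thesis
  proof (rule that[of "\<lambda>x. q (S x)"])
    show "trig_poly (\<lambda>x. q (S x))"
      unfolding S_def by (rule trig_poly_of_polynomial_of_sines[OF q(1)])
    show "\<bar>q (S x)\<bar> \<le> B + \<epsilon>" for x
    proof -
      have "\<bar>\<psi> (S x)\<bar> \<le> B" unfolding \<psi>_def by (rule bdd)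
      then show ?thesis using q(2)[OF S_cube[of x]] by linarith
    qed
    show "\<bar>q (S x) - \<phi> x\<bar> \<le> \<epsilon>" if x: "\<forall>e\<in>Basis. \<bar>x \<bullet> e\<bar> \<le> K" for x
    proof -
      have "arcsin (S x \<bullet> e) / w = x \<bullet> e" if e: "e \<in> Basis" for e
      proof -
        have "\<bar>w * (x \<bullet> e)\<bar> \<le> w * K"
          using x e \<open>w > 0\<close> by (simp add: abs_mult)
        moreover have "w * K = pi / 2" using \<open>K > 0\<close> by (simp add: w_def)
        ultimately have "arcsin (sin (w * (x \<bullet> e))) = w * (x \<bullet> e)"
          by (intro arcsin_sin) auto
        then show ?thesis using e \<open>w > 0\<close> by (simp add: S_def inner_sum_left_Basis)
      qed
      then have "(\<Sum>e\<in>Basis. (arcsin (S x \<bullet> e) / w) *\<^sub>R e) = (\<Sum>e\<in>Basis. (x \<bullet> e) *\<^sub>R e)"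
        by (intro sum.cong) auto
      also have "\<dots> = x" by (rule euclidean_representation)
      finally have "\<psi> (S x) = \<phi> x" unfolding \<psi>_def by simp
      then show ?thesis using q(2)[OF S_cube[of x]] by linarith
    qed
  qed
qed

lemma trig_poly_borel: "trig_poly (p :: 'a::euclidean_space \<Rightarrow> real) \<Longrightarrow> p \<in> borel_measurable borel"
  by (induction rule: trig_poly.induct) auto

lemma trig_poly_bounded: "trig_poly p \<Longrightarrow> \<exists>B. \<forall>x. \<bar>p x\<bar> \<le> B"
proof (induction rule: trig_poly.induct)
  case (wave a t c)
  have "\<bar>a * cos (t \<bullet> x + c)\<bar> \<le> \<bar>a\<bar>" for x
    using mult_left_mono[of "\<bar>cos (t \<bullet> x + c)\<bar>" 1 "\<bar>a\<bar>"] by (simp add: abs_mult)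
  then show ?case by blast
next
  case (add p q)
  then obtain A B where "\<And>x. \<bar>p x\<bar> \<le> A" "\<And>x. \<bar>q x\<bar> \<le> B" by blast
  then have "\<bar>p x + q x\<bar> \<le> A + B" for x by (meson abs_triangle_ineq add_mono order_trans)
  then show ?case by blast
qed

text \<open>
  A wave is the real part of a multiple of \<open>iexp (t \<bullet> x)\<close>.
\<close>

lemma trig_poly_integral_convergence:
  fixes \<mu> :: "nat \<Rightarrow> 'a::euclidean_space measure"
  assumes prob: "\<And>n. prob_space (\<mu> n)" "prob_space \<nu>"
    and sets: "\<And>n. sets (\<mu> n) = sets borel" "sets \<nu> = sets borel"
    and char: "\<And>t. (\<lambda>n. \<integral>x. iexp (t \<bullet> x) \<partial>\<mu> n) \<longlonglongrightarrow> (\<integral>x. iexp (t \<bullet> x) \<partial>\<nu>)"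
    and p: "trig_poly p"
  shows "(\<lambda>n. \<integral>x. p x \<partial>\<mu> n) \<longlonglongrightarrow> (\<integral>x. p x \<partial>\<nu>)"
  using p
proof induction
  case (wave a t c)
  have *: "(\<integral>x. a * cos (t \<bullet> x + c) \<partial>m) = Re (a * iexp c * (\<integral>x. iexp (t \<bullet> x) \<partial>m))"
    if "prob_space m" "sets m = sets borel" for m :: "'a measure"
  proof -
    interpret prob_space m by fact
    note [measurable_cong] = that(2)
    have int: "integrable m (\<lambda>x. iexp (t \<bullet> x))"
      by (rule integrable_const_bound[of _ 1]) auto
    have "Re (a * iexp c * (\<integral>x. iexp (t \<bullet> x) \<partial>m)) = Re (\<integral>x. a * iexp c * iexp (t \<bullet> x) \<partial>m)"
      by simp
    also have "\<dots> = (\<integral>x. Re (a * iexp c * iexp (t \<bullet> x)) \<partial>m)"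
      using int by (subst integral_Re) auto
    also have "\<dots> = (\<integral>x. a * cos (t \<bullet> x + c) \<partial>m)"
      by (intro Bochner_Integration.integral_cong) (auto simp: Re_exp Im_exp cos_add algebra_simps)
    finally show ?thesis by simp
  qed
  show ?case
    unfolding *[OF prob(1) sets(1)] *[OF prob(2) sets(2)]
    by (intro tendsto_intros char)
next
  case (add p q)
  have *: "(\<integral>x. p x + q x \<partial>m) = (\<integral>x. p x \<partial>m) + (\<integral>x. q x \<partial>m)"
    if "prob_space m" "sets m = sets borel" for m :: "'a measure"
  proof -
    interpret prob_space m by fact
    obtain A B where "\<And>x. \<bar>p x\<bar> \<le> A" "\<And>x. \<bar>q x\<bar> \<le> B"
      using add.hyps trig_poly_bounded by metis
    then show ?thesis
      using trig_poly_borel[OF add.hyps(1)] trig_poly_borel[OF add.hyps(2)]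
      by (intro Bochner_Integration.integral_add integrable_const_bound[of _ A] integrable_const_bound[of _ B])
         (auto simp: measurable_cong_sets[OF that(2) refl])
  qed
  show ?case
    unfolding *[OF prob(1) sets(1)] *[OF prob(2) sets(2)]
    by (intro tendsto_intros add.IH)
qed


text \<open>
  The characteristic functions of the marginals along \<open>e\<close> converge, so the one-dimensional
  continuity theorem applies to them. Testing with a continuous function that interpolates between
  the indicators of \<open>\<bar>y\<bar> > K + 1\<close> and \<open>\<bar>y\<bar> > K\<close> carries the tightness of the limit over to the
  sequence.
\<close>

lemma tight_marginal:
  fixes \<mu> :: "nat \<Rightarrow> 'a::euclidean_space measure"
  assumes prob: "\<And>n. prob_space (\<mu> n)" "prob_space \<nu>"
    and sets: "\<And>n. sets (\<mu> n) = sets borel" "sets \<nu> = sets borel"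
    and char: "\<And>t. (\<lambda>n. \<integral>x. iexp (t \<bullet> x) \<partial>\<mu> n) \<longlonglongrightarrow> (\<integral>x. iexp (t \<bullet> x) \<partial>\<nu>)"
    and "\<epsilon> > 0"
  obtains K where "K > 0" "\<forall>\<^sub>F n in sequentially. measure (\<mu> n) {x. K < \<bar>x \<bullet> e\<bar>} \<le> \<epsilon>"
    "measure \<nu> {x. K < \<bar>x \<bullet> e\<bar>} \<le> \<epsilon>"
proof -
  define marg where "marg m = distr m borel (\<lambda>x. x \<bullet> e)" for m :: "'a measure"
  have meas: "(\<lambda>x. x \<bullet> e) \<in> borel_measurable m" if "sets m = sets borel" for m :: "'a measure"
    unfolding measurable_cong_sets[OF that refl] by simp
  have real_distr: "real_distribution (marg m)" if "prob_space m" "sets m = sets borel" for m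
    unfolding marg_def using that meas by (intro prob_space.real_distribution_distr) auto
  have char_marg: "Characteristic_Functions.char (marg m) s = (\<integral>x. iexp ((s *\<^sub>R e) \<bullet> x) \<partial>m)"
    if "sets m = sets borel" for m s
    unfolding marg_def char_def using meas[OF that]
    by (subst integral_distr) (auto simp: inner_commute)
  have weak: "weak_conv_m (\<lambda>n. marg (\<mu> n)) (marg \<nu>)"
  proof (intro levy_continuity real_distr prob sets)
    show "(\<lambda>n. Characteristic_Functions.char (marg (\<mu> n)) s) \<longlonglongrightarrow> Characteristic_Functions.char (marg \<nu>) s" for s
      unfolding char_marg[OF sets(1)] char_marg[OF sets(2)] by (rule char)
  qed
  define h where "h K y = min 1 (max 0 (\<bar>y\<bar> - K))" for K y :: real
  have h_cont: "isCont (h K) y" for K y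
    unfolding h_def by (intro continuous_intros)
  have h_bdd: "norm (h K y) \<le> 1" for K y by (auto simp: h_def)
  have h_meas: "h K \<in> borel_measurable borel" for K unfolding h_def by measurable
  have h_conv: "(\<lambda>n. \<integral>y. h K y \<partial>marg (\<mu> n)) \<longlonglongrightarrow> (\<integral>y. h K y \<partial>marg \<nu>)" for K
    using real_distr prob sets weak h_cont h_bdd
    by (intro weak_conv_imp_integral_bdd_continuous_conv[where B = 1]) auto
  have h_integral: "(\<integral>y. h K y \<partial>marg m) = (\<integral>x. h K (x \<bullet> e) \<partial>m)" if "sets m = sets borel" for m K
    unfolding marg_def using meas[OF that] h_meas by (subst integral_distr) auto
  have out_meas: "{x. K < \<bar>x \<bullet> e\<bar>} \<in> sets borel" for K by measurable
  have h_lower: "measure m {x. K + 1 < \<bar>x \<bullet> e\<bar>} \<le> (\<integral>y. h K y \<partial>marg m)"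
    and h_upper: "(\<integral>y. h K y \<partial>marg m) \<le> measure m {x. K < \<bar>x \<bullet> e\<bar>}"
    if m: "prob_space m" "sets m = sets borel" for m K
  proof -
    interpret prob_space m by fact
    have h_int: "integrable m (\<lambda>x. h K (x \<bullet> e))"
      using measurable_compose[OF meas[OF m(2)] h_meas] h_bdd by (intro integrable_const_bound[of _ 1]) auto
    have ind_int: "integrable m (indicat_real {x. L < \<bar>x \<bullet> e\<bar>})" for L
      using out_meas m(2) by (intro integrable_real_indicator) (auto simp: emeasure_eq_measure)
    have "measure m {x. K + 1 < \<bar>x \<bullet> e\<bar>} = (\<integral>x. indicator {x. K + 1 < \<bar>x \<bullet> e\<bar>} x \<partial>m)"
      using out_meas m(2) sets_eq_imp_space_eq[OF m(2)] by simp
    also have "\<dots> \<le> (\<integral>x. h K (x \<bullet> e) \<partial>m)"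
      by (intro integral_mono h_int ind_int) (auto simp: h_def indicator_def)
    finally show "measure m {x. K + 1 < \<bar>x \<bullet> e\<bar>} \<le> (\<integral>y. h K y \<partial>marg m)"
      by (simp add: h_integral m)
    have "(\<integral>x. h K (x \<bullet> e) \<partial>m) \<le> (\<integral>x. indicator {x. K < \<bar>x \<bullet> e\<bar>} x \<partial>m)"
      by (intro integral_mono h_int ind_int) (auto simp: h_def indicator_def)
    also have "\<dots> = measure m {x. K < \<bar>x \<bullet> e\<bar>}"
      using out_meas m(2) sets_eq_imp_space_eq[OF m(2)] by simp
    finally show "(\<integral>y. h K y \<partial>marg m) \<le> measure m {x. K < \<bar>x \<bullet> e\<bar>}"
      by (simp add: h_integral m)
  qed
  interpret \<nu>: prob_space \<nu> by fact
  have "(\<lambda>k. measure \<nu> {x. real k < \<bar>x \<bullet> e\<bar>}) \<longlonglongrightarrow> measure \<nu> (\<Inter>k. {x. real k < \<bar>x \<bullet> e\<bar>})"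
  proof (rule \<nu>.finite_Lim_measure_decseq)
    show "range (\<lambda>k. {x. real k < \<bar>x \<bullet> e\<bar>}) \<subseteq> sets \<nu>" using out_meas sets(2) by blast
    show "decseq (\<lambda>k. {x. real k < \<bar>x \<bullet> e\<bar>})"
      unfolding decseq_def by (blast intro: order_le_less_trans[OF of_nat_mono])
  qed
  moreover have "(\<Inter>k. {x. real k < \<bar>x \<bullet> e\<bar>}) = {}"
  proof -
    have "\<exists>k. \<not> real k < \<bar>x \<bullet> e\<bar>" for x
      using reals_Archimedean2[of "\<bar>x \<bullet> e\<bar>"] by (meson less_asym)
    then show ?thesis by blast
  qed
  ultimately have "(\<lambda>k. measure \<nu> {x. real k < \<bar>x \<bullet> e\<bar>}) \<longlonglongrightarrow> 0" by simp
  then have "\<forall>\<^sub>F k in sequentially. measure \<nu> {x. real k < \<bar>x \<bullet> e\<bar>} < \<epsilon>"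
    using \<open>\<epsilon> > 0\<close> by (rule order_tendstoD(2))
  then obtain k where k: "measure \<nu> {x. real k < \<bar>x \<bullet> e\<bar>} < \<epsilon>"
    using eventually_happens'[OF sequentially_bot] by blast
  have "(\<integral>y. h k y \<partial>marg \<nu>) < \<epsilon>"
    using h_upper[OF prob(2) sets(2), of k] k by linarith
  then have "\<forall>\<^sub>F n in sequentially. (\<integral>y. h k y \<partial>marg (\<mu> n)) < \<epsilon>"
    using order_tendstoD(2)[OF h_conv] by blast
  then have 1: "\<forall>\<^sub>F n in sequentially. measure (\<mu> n) {x. real k + 1 < \<bar>x \<bullet> e\<bar>} \<le> \<epsilon>"
  proof eventually_elim
    case (elim n)
    show ?case using h_lower[OF prob(1) sets(1), of n "real k"] elim by linarith
  qed
  have "measure \<nu> {x. real k + 1 < \<bar>x \<bullet> e\<bar>} \<le> \<epsilon>"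
    using h_lower[OF prob(2) sets(2), of k] \<open>(\<integral>y. h k y \<partial>marg \<nu>) < \<epsilon>\<close> by linarith
  with 1 show ?thesis by (intro that[of "real k + 1"]) auto
qed

lemma tight_cube:
  fixes \<mu> :: "nat \<Rightarrow> 'a::euclidean_space measure"
  assumes prob: "\<And>n. prob_space (\<mu> n)" "prob_space \<nu>"
    and sets: "\<And>n. sets (\<mu> n) = sets borel" "sets \<nu> = sets borel"
    and char: "\<And>t. (\<lambda>n. \<integral>x. iexp (t \<bullet> x) \<partial>\<mu> n) \<longlonglongrightarrow> (\<integral>x. iexp (t \<bullet> x) \<partial>\<nu>)"
    and "\<epsilon> > 0"
  obtains K where "K > 0"
    "\<forall>\<^sub>F n in sequentially. measure (\<mu> n) {x. \<exists>e\<in>Basis. K < \<bar>x \<bullet> e\<bar>} \<le> \<epsilon>"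
    "measure \<nu> {x. \<exists>e\<in>Basis. K < \<bar>x \<bullet> e\<bar>} \<le> \<epsilon>"
proof -
  define \<delta> where "\<delta> = \<epsilon> / DIM('a)"
  have "\<delta> > 0" using \<open>\<epsilon> > 0\<close> by (simp add: \<delta>_def)
  have "\<exists>K>0. (\<forall>\<^sub>F n in sequentially. measure (\<mu> n) {x. K < \<bar>x \<bullet> e\<bar>} \<le> \<delta>) \<and>
      measure \<nu> {x. K < \<bar>x \<bullet> e\<bar>} \<le> \<delta>" for e
    using tight_marginal[OF prob sets char \<open>\<delta> > 0\<close>, of e] by metis
  then obtain k where k: "\<And>e. k e > 0"
    "\<And>e. \<forall>\<^sub>F n in sequentially. measure (\<mu> n) {x. k e < \<bar>x \<bullet> e\<bar>} \<le> \<delta>"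
    "\<And>e. measure \<nu> {x. k e < \<bar>x \<bullet> e\<bar>} \<le> \<delta>" by metis
  define K where "K = (\<Sum>e\<in>Basis. k e)"
  have K: "k e \<le> K" if "e \<in> Basis" for e
    unfolding K_def using that k(1) by (intro member_le_sum) (auto intro: less_imp_le)
  have "K > 0" unfolding K_def using k(1) by (intro sum_pos) auto
  have bound: "measure m {x. \<exists>e\<in>Basis. K < \<bar>x \<bullet> e\<bar>} \<le> \<epsilon>"
    if m: "prob_space m" "sets m = sets borel"
      and le: "\<And>e. e \<in> Basis \<Longrightarrow> measure m {x. k e < \<bar>x \<bullet> e\<bar>} \<le> \<delta>" for m
  proof -
    interpret prob_space m by fact
    have meas: "{x. c < \<bar>x \<bullet> e\<bar>} \<in> sets m" for c e unfolding m(2) by measurable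
    have "measure m {x. \<exists>e\<in>Basis. K < \<bar>x \<bullet> e\<bar>} \<le> measure m (\<Union>e\<in>Basis. {x. k e < \<bar>x \<bullet> e\<bar>})"
      using K meas by (intro finite_measure_mono) (force, auto intro!: sets.finite_UN)
    also have "\<dots> \<le> (\<Sum>e\<in>Basis. measure m {x. k e < \<bar>x \<bullet> e\<bar>})"
      using meas by (intro finite_measure_subadditive_finite) auto
    also have "\<dots> \<le> (\<Sum>e\<in>(Basis :: 'a set). \<delta>)" by (intro sum_mono le)
    also have "\<dots> = \<epsilon>" by (simp add: \<delta>_def)
    finally show ?thesis .
  qed
  have "\<forall>\<^sub>F n in sequentially. \<forall>e\<in>Basis. measure (\<mu> n) {x. k e < \<bar>x \<bullet> e\<bar>} \<le> \<delta>"
    using k(2) by (simp add: eventually_ball_finite_distrib)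
  then have "\<forall>\<^sub>F n in sequentially. measure (\<mu> n) {x. \<exists>e\<in>Basis. K < \<bar>x \<bullet> e\<bar>} \<le> \<epsilon>"
    by eventually_elim (use bound prob sets in auto)
  then show ?thesis
    using \<open>K > 0\<close> bound[OF prob(2) sets(2) k(3)] that by blast
qed

lemma integral_diff_le_off_event:
  assumes m: "prob_space m" and A: "A \<in> sets m"
    and p: "p \<in> borel_measurable m" "\<And>x. \<bar>p x\<bar> \<le> P" and q: "q \<in> borel_measurable m" "\<And>x. \<bar>q x\<bar> \<le> Q"
    and close: "\<And>x. x \<notin> A \<Longrightarrow> \<bar>p x - q x\<bar> \<le> (\<epsilon>::real)" and "0 \<le> \<epsilon>"
  shows "\<bar>(\<integral>x. p x \<partial>m) - (\<integral>x. q x \<partial>m)\<bar> \<le> \<epsilon> + (P + Q) * measure m A"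
proof -
  interpret prob_space m by fact
  have "integrable m p" by (rule integrable_const_bound[of _ P]) (simp_all add: p)
  moreover have "integrable m q" by (rule integrable_const_bound[of _ Q]) (simp_all add: q)
  ultimately have int: "integrable m p" "integrable m q" by blast+
  have "\<bar>(\<integral>x. p x \<partial>m) - (\<integral>x. q x \<partial>m)\<bar> = \<bar>\<integral>x. p x - q x \<partial>m\<bar>"
    using int by simp
  also have "\<dots> \<le> (\<integral>x. \<bar>p x - q x\<bar> \<partial>m)" by (rule integral_abs_bound)
  also have "\<dots> \<le> (\<integral>x. \<epsilon> + (P + Q) * indicator A x \<partial>m)"
  proof (rule integral_mono)
    show "integrable m (\<lambda>x. \<bar>p x - q x\<bar>)" using int by simp
    show "integrable m (\<lambda>x. \<epsilon> + (P + Q) * indicator A x)"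
      using A by (intro Bochner_Integration.integrable_add integrable_mult_right integrable_real_indicator)
        (auto simp: emeasure_eq_measure)
    show "\<bar>p x - q x\<bar> \<le> \<epsilon> + (P + Q) * indicator A x" for x
      using close[of x] p(2)[of x] q(2)[of x] \<open>0 \<le> \<epsilon>\<close> by (cases "x \<in> A") auto
  qed
  also have "\<dots> = \<epsilon> + (P + Q) * measure m A"
    using A by (simp add: prob_space emeasure_eq_measure Int_absorb2 sets.sets_into_space)
  finally show ?thesis .
qed

text \<open>
  Tightness confines almost all mass to a cube, where \<open>\<phi>\<close> is uniformly close to a trigonometric
  polynomial; outside the cube both functions are bounded.
\<close>

theorem levy_continuity_euclidean:
  fixes \<mu> :: "nat \<Rightarrow> 'a::euclidean_space measure" and \<phi> :: "'a \<Rightarrow> real"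
  assumes prob: "\<And>n. prob_space (\<mu> n)" "prob_space \<nu>"
    and sets: "\<And>n. sets (\<mu> n) = sets borel" "sets \<nu> = sets borel"
    and char: "\<And>t. (\<lambda>n. \<integral>x. iexp (t \<bullet> x) \<partial>\<mu> n) \<longlonglongrightarrow> (\<integral>x. iexp (t \<bullet> x) \<partial>\<nu>)"
    and cont: "continuous_on UNIV \<phi>" and "bounded (range \<phi>)"
  shows "(\<lambda>n. \<integral>x. \<phi> x \<partial>\<mu> n) \<longlonglongrightarrow> (\<integral>x. \<phi> x \<partial>\<nu>)"
proof (rule LIMSEQ_I)
  fix \<eta> :: real assume "0 < \<eta>"
  obtain B where "B > 0" and B: "\<And>x. \<bar>\<phi> x\<bar> \<le> B"
    using \<open>bounded (range \<phi>)\<close> by (auto simp: bounded_pos)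
  \<comment> \<open>With these choices, replacing \<open>\<phi>\<close> by its approximation changes each integral by at most \<open>\<eta> / 4\<close>.\<close>
  define \<epsilon> where "\<epsilon> = min 1 (\<eta> / 8)"
  define \<delta> where "\<delta> = \<eta> / (8 * (2 * B + 1))"
  have "\<epsilon> > 0" "\<epsilon> \<le> 1" "\<epsilon> \<le> \<eta> / 8" and "\<delta> > 0"
    using \<open>0 < \<eta>\<close> \<open>B > 0\<close> by (auto simp: \<epsilon>_def \<delta>_def)
  have \<delta>: "(2 * B + 1) * \<delta> = \<eta> / 8" using \<open>B > 0\<close> by (simp add: \<delta>_def divide_simps)
  obtain K where "K > 0"
    and K: "\<forall>\<^sub>F n in sequentially. measure (\<mu> n) {x. \<exists>e\<in>Basis. K < \<bar>x \<bullet> e\<bar>} \<le> \<delta>"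
      "measure \<nu> {x. \<exists>e\<in>Basis. K < \<bar>x \<bullet> e\<bar>} \<le> \<delta>"
    by (rule tight_cube[OF prob sets char \<open>\<delta> > 0\<close>])
  obtain p where p: "trig_poly p" "\<And>x. \<bar>p x\<bar> \<le> B + \<epsilon>"
      "\<And>x. (\<forall>e\<in>Basis. \<bar>x \<bullet> e\<bar> \<le> K) \<Longrightarrow> \<bar>p x - \<phi> x\<bar> \<le> \<epsilon>"
    by (rule trig_poly_approximation[OF cont B \<open>K > 0\<close> \<open>\<epsilon> > 0\<close>]) blast
  have close: "\<bar>(\<integral>x. p x \<partial>m) - (\<integral>x. \<phi> x \<partial>m)\<bar> \<le> \<eta> / 4"
    if m: "prob_space m" "sets m = sets borel"
      and small: "measure m {x. \<exists>e\<in>Basis. K < \<bar>x \<bullet> e\<bar>} \<le> \<delta>" for m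
  proof -
    have "{x::'a. \<exists>e\<in>Basis. K < \<bar>x \<bullet> e\<bar>} = (\<Union>e\<in>Basis. {x. K < \<bar>x \<bullet> e\<bar>})" by auto
    also have "\<dots> \<in> sets m" unfolding m(2) by (intro sets.finite_UN) (simp, measurable)
    finally have A: "{x::'a. \<exists>e\<in>Basis. K < \<bar>x \<bullet> e\<bar>} \<in> sets m" .
    have \<phi>_meas: "\<phi> \<in> borel_measurable m" and p_meas: "p \<in> borel_measurable m"
      using borel_measurable_continuous_onI[OF cont] trig_poly_borel[OF p(1)]
      by (simp_all add: measurable_cong_sets[OF m(2) refl])
    have "\<bar>(\<integral>x. p x \<partial>m) - (\<integral>x. \<phi> x \<partial>m)\<bar> \<le>
        \<epsilon> + ((B + \<epsilon>) + B) * measure m {x. \<exists>e\<in>Basis. K < \<bar>x \<bullet> e\<bar>}"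
      by (rule integral_diff_le_off_event[OF m(1) A p_meas p(2) \<phi>_meas B])
        (use p(3) \<open>\<epsilon> > 0\<close> in \<open>auto simp: not_less\<close>)
    also have "\<dots> \<le> \<epsilon> + (2 * B + 1) * \<delta>"
      using small \<open>B > 0\<close> \<open>\<epsilon> > 0\<close> \<open>\<epsilon> \<le> 1\<close> by (intro add_left_mono mult_mono) auto
    finally show ?thesis using \<delta> \<open>\<epsilon> \<le> \<eta> / 8\<close> by simp
  qed
  have "(\<lambda>n. \<integral>x. p x \<partial>\<mu> n) \<longlonglongrightarrow> (\<integral>x. p x \<partial>\<nu>)"
    by (rule trig_poly_integral_convergence[OF prob sets char p(1)])
  then have "\<forall>\<^sub>F n in sequentially. dist (\<integral>x. p x \<partial>\<mu> n) (\<integral>x. p x \<partial>\<nu>) < \<eta> / 4"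
    using \<open>0 < \<eta>\<close> by (intro tendstoD) auto
  with K(1) have "\<forall>\<^sub>F n in sequentially. norm ((\<integral>x. \<phi> x \<partial>\<mu> n) - (\<integral>x. \<phi> x \<partial>\<nu>)) < \<eta>"
  proof eventually_elim
    case (elim n)
    show ?case
      using close[OF prob(1) sets(1) elim(1)] close[OF prob(2) sets(2) K(2)] elim(2) \<open>0 < \<eta>\<close>
      unfolding dist_real_def real_norm_def by linarith
  qed
  then show "\<exists>no. \<forall>n\<ge>no. norm ((\<integral>x. \<phi> x \<partial>\<mu> n) - (\<integral>x. \<phi> x \<partial>\<nu>)) < \<eta>"
    by (simp add: eventually_sequentially)
qed

section \<open>The standard Gaussian law\<close>

lemma norm_square_coordinates: "(norm (y :: 'a::euclidean_space))\<^sup>2 = (\<Sum>e\<in>Basis. (y \<bullet> e)\<^sup>2)"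
  unfolding power2_norm_eq_inner by (subst euclidean_inner) (simp add: power2_eq_square)

text \<open>
  The product form of the density reduces total mass and characteristic function to those of the
  one-dimensional normal law.
\<close>

lemma std_gaussian_product_form:
  "(std_gaussian :: (real ^ 'r) measure) =
     density lborel (\<lambda>y. ennreal (\<Prod>e\<in>Basis. std_normal_density (y \<bullet> e)))"
proof -
  have "exp (- (norm y)\<^sup>2 / 2) / sqrt (2 * pi) ^ CARD('r) = (\<Prod>e\<in>Basis. std_normal_density (y \<bullet> e))"
    for y :: "real ^ 'r"
  proof -
    have "(\<Prod>e\<in>Basis. std_normal_density (y \<bullet> e)) =
        (1 / sqrt (2 * pi)) ^ CARD('r) * exp (\<Sum>e\<in>Basis. - (y \<bullet> e)\<^sup>2 / 2)"
      by (simp add: std_normal_density_def prod.distrib exp_sum prod_dividef power_divide)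
    also have "(\<Sum>e\<in>Basis. - (y \<bullet> e)\<^sup>2 / 2) = - (norm y)\<^sup>2 / 2"
      by (simp add: norm_square_coordinates sum_negf sum_divide_distrib)
    finally show ?thesis by (simp add: power_divide)
  qed
  then show ?thesis by (simp add: std_gaussian_def)
qed

lemma std_gaussian_prob_space: "prob_space (std_gaussian :: (real ^ 'r) measure)"
proof
  interpret N: real_distribution std_normal_distribution by (rule real_dist_normal_dist)
  have 1: "(\<integral>\<^sup>+x. std_normal_density x \<partial>lborel) = 1"
    using N.emeasure_space_1 by (simp add: emeasure_density)
  show "emeasure std_gaussian (space (std_gaussian :: (real ^ 'r) measure)) = 1"
    unfolding std_gaussian_product_form
    using nn_integral_lborel_prod[of "\<lambda>_::real ^ 'r. std_normal_density"] 1
    by (simp add: emeasure_density prod_ennreal[symmetric])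
qed

lemma sets_std_gaussian: "sets std_gaussian = sets borel"
  by (simp add: std_gaussian_def)

lemma char_std_gaussian:
  "(\<integral>y. iexp (t \<bullet> y) \<partial>(std_gaussian :: (real ^ 'r) measure)) = of_real (exp (- (norm t)\<^sup>2 / 2))"
proof -
  interpret N: real_distribution std_normal_distribution by (rule real_dist_normal_dist)
  interpret P: product_sigma_finite "\<lambda>_::real ^ 'r. lborel :: real measure" ..
  define g where "g e x = of_real (std_normal_density x) * iexp ((t \<bullet> e) * x)" for e x
  have g_meas [measurable]: "g e \<in> borel_measurable borel" for e unfolding g_def by measurable
  have "integrable std_normal_distribution (\<lambda>x. iexp ((t \<bullet> e) * x))" for e
    by (rule N.integrable_const_bound[of _ 1]) auto
  then have g_int: "integrable lborel (g e)" for e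
    by (simp add: integrable_density g_def[abs_def] scaleR_conv_of_real)
  have g_val: "(\<integral>x. g e x \<partial>lborel) = of_real (exp (- (t \<bullet> e)\<^sup>2 / 2))" for e
  proof -
    have "(\<integral>x. g e x \<partial>lborel) = Characteristic_Functions.char std_normal_distribution (t \<bullet> e)"
      unfolding char_def g_def by (subst integral_density) (auto simp: scaleR_conv_of_real)
    then show ?thesis by (simp add: char_std_normal_distribution)
  qed
  have integrand: "(\<Prod>e\<in>Basis. std_normal_density (y \<bullet> e)) *\<^sub>R iexp (t \<bullet> y) = (\<Prod>e\<in>Basis. g e (y \<bullet> e))" for y
  proof -
    have "iexp (t \<bullet> y) = (\<Prod>e\<in>Basis. iexp ((t \<bullet> e) * (y \<bullet> e)))"
      by (subst euclidean_inner) (simp add: sum_distrib_left exp_sum)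
    then show ?thesis by (simp add: g_def prod.distrib scaleR_conv_of_real)
  qed
  have "(\<integral>y. iexp (t \<bullet> y) \<partial>(std_gaussian :: (real ^ 'r) measure)) =
      (\<integral>y. (\<Prod>e\<in>Basis. std_normal_density (y \<bullet> e)) *\<^sub>R iexp (t \<bullet> y) \<partial>lborel)"
    unfolding std_gaussian_product_form
  proof (rule integral_density)
    show "AE y in lborel. 0 \<le> (\<Prod>e\<in>Basis. std_normal_density (y \<bullet> e))"
      by (intro AE_I2 prod_nonneg) simp
  qed measurable
  also have "\<dots> = (\<integral>y. (\<Prod>e\<in>Basis. g e (y \<bullet> e)) \<partial>lborel)"
    by (simp only: integrand)
  also have "\<dots> = (\<integral>y. (\<Prod>e\<in>Basis. g e (y e)) \<partial>(\<Pi>\<^sub>M e\<in>Basis. lborel))"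
    by (subst lborel_eq, subst integral_distr) (auto simp: inner_sum_left_Basis cong: prod.cong)
  also have "\<dots> = (\<Prod>e\<in>Basis. \<integral>x. g e x \<partial>lborel)"
    by (rule P.product_integral_prod) (auto simp: g_int)
  also have "\<dots> = of_real (exp (\<Sum>e\<in>Basis. - (t \<bullet> e)\<^sup>2 / 2))"
    by (simp add: g_val exp_sum)
  also have "(\<Sum>e\<in>Basis. - (t \<bullet> e)\<^sup>2 / 2) = - (norm t)\<^sup>2 / 2"
    by (simp add: norm_square_coordinates sum_negf sum_divide_distrib)
  finally show ?thesis .
qed


section \<open>Covariance inequalities\<close>

text \<open>
  For complex arguments this is the bilinear covariance, without a conjugate, so that it measures how
  far the expectation of a product is from the product of the expectations.
\<close>

definition cov :: "'a measure \<Rightarrow> ('a \<Rightarrow> 'b) \<Rightarrow> ('a \<Rightarrow> 'b) \<Rightarrow> 'b::{real_normed_field, banach, second_countable_topology}" where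
  "cov M g h = (\<integral>\<omega>. g \<omega> * h \<omega> \<partial>M) - (\<integral>\<omega>. g \<omega> \<partial>M) * (\<integral>\<omega>. h \<omega> \<partial>M)"

lemma cov_commute: "cov M g h = cov M h g"
  by (simp add: cov_def mult.commute)

context prob_space
begin

lemma integrable_bounded:
  fixes f :: "'a \<Rightarrow> 'b::{banach, second_countable_topology}"
  assumes "f \<in> borel_measurable M" "\<And>\<omega>. norm (f \<omega>) \<le> C"
  shows "integrable M f"
  using assms by (intro integrable_const_bound[of _ C]) auto

lemma cov_add_right:
  fixes f g h :: "'a \<Rightarrow> 'b::{real_normed_field, banach, second_countable_topology}"
  assumes [measurable]: "f \<in> borel_measurable M" "g \<in> borel_measurable M" "h \<in> borel_measurable M"
    and bdd: "\<And>\<omega>. norm (f \<omega>) \<le> F" "\<And>\<omega>. norm (g \<omega>) \<le> G" "\<And>\<omega>. norm (h \<omega>) \<le> H"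
  shows "cov M f (\<lambda>\<omega>. g \<omega> + h \<omega>) = cov M f g + cov M f h"
proof -
  have "0 \<le> F" using bdd(1) norm_ge_zero order_trans by blast
  have "integrable M g" "integrable M h"
    by (rule integrable_bounded[OF _ bdd(2)] integrable_bounded[OF _ bdd(3)]; simp)+
  moreover have "integrable M (\<lambda>\<omega>. f \<omega> * g \<omega>)" "integrable M (\<lambda>\<omega>. f \<omega> * h \<omega>)"
    by (rule integrable_bounded[of _ "F * G"] integrable_bounded[of _ "F * H"];
        use bdd \<open>0 \<le> F\<close> in \<open>auto simp: norm_mult intro!: mult_mono\<close>)+
  ultimately show ?thesis by (simp add: cov_def distrib_left)
qed

lemma cov_const_left: "cov M (\<lambda>_. c) h = 0"
  by (simp add: cov_def prob_space)

lemma cov_scale_right: "cov M f (\<lambda>\<omega>. c * g \<omega>) = c * cov M f g"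
  by (simp add: cov_def algebra_simps mult.left_commute[of _ c])

lemma cov_diff_right:
  fixes f g h :: "'a \<Rightarrow> 'b::{real_normed_field, banach, second_countable_topology}"
  assumes "f \<in> borel_measurable M" "g \<in> borel_measurable M" "h \<in> borel_measurable M"
    and "\<And>\<omega>. norm (f \<omega>) \<le> F" "\<And>\<omega>. norm (g \<omega>) \<le> G" "\<And>\<omega>. norm (h \<omega>) \<le> H"
  shows "cov M f (\<lambda>\<omega>. g \<omega> - h \<omega>) = cov M f g - cov M f h"
  using cov_add_right[of f g "\<lambda>\<omega>. - 1 * h \<omega>" F G H] assms cov_scale_right[of f "- 1" h]
  by simp

lemma cov_norm_le:
  fixes g h :: "'a \<Rightarrow> complex"
  assumes [measurable]: "g \<in> borel_measurable M" "h \<in> borel_measurable M"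
    and bdd: "\<And>\<omega>. norm (g \<omega>) \<le> G" "\<And>\<omega>. norm (h \<omega>) \<le> H"
    and K: "\<And>u v. u \<in> {Re, Im} \<Longrightarrow> v \<in> {Re, Im} \<Longrightarrow> \<bar>cov M (\<lambda>\<omega>. u (g \<omega>)) (\<lambda>\<omega>. v (h \<omega>))\<bar> \<le> K"
  shows "norm (cov M g h) \<le> 4 * K"
proof -
  have int: "integrable M g" "integrable M h"
    by (rule integrable_bounded[OF _ bdd(1)] integrable_bounded[OF _ bdd(2)]; simp)+
  have "0 \<le> G" using bdd(1) norm_ge_zero order_trans by blast
  then have int_mult: "integrable M (\<lambda>\<omega>. g \<omega> * h \<omega>)"
    by (intro integrable_bounded[of _ "G * H"]) (use bdd in \<open>auto simp: norm_mult intro!: mult_mono\<close>)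
  have split: "integrable M (\<lambda>\<omega>. u (g \<omega>) * v (h \<omega>))" if "u \<in> {Re, Im}" "v \<in> {Re, Im}" for u v
  proof (rule integrable_bounded[of _ "G * H"])
    show "(\<lambda>\<omega>. u (g \<omega>) * v (h \<omega>)) \<in> borel_measurable M" using that by auto
    have "\<bar>u z\<bar> \<le> norm z" "\<bar>v z\<bar> \<le> norm z" for z
      using that abs_Re_le_cmod abs_Im_le_cmod by auto
    then have "\<bar>u (g \<omega>)\<bar> \<le> G" "\<bar>v (h \<omega>)\<bar> \<le> H" for \<omega> using bdd order_trans by blast+
    then show "norm (u (g \<omega>) * v (h \<omega>)) \<le> G * H" for \<omega>
      using \<open>0 \<le> G\<close> by (auto simp: abs_mult intro!: mult_mono)
  qed
  have parts: "expectation (\<lambda>\<omega>. Re (g \<omega>)) = Re (expectation g)" "expectation (\<lambda>\<omega>. Im (g \<omega>)) = Im (expectation g)"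
    "expectation (\<lambda>\<omega>. Re (h \<omega>)) = Re (expectation h)" "expectation (\<lambda>\<omega>. Im (h \<omega>)) = Im (expectation h)"
    by (rule integral_Re[OF int(1)] integral_Im[OF int(1)] integral_Re[OF int(2)] integral_Im[OF int(2)])+
  have mult_parts:
    "Re (expectation (\<lambda>\<omega>. g \<omega> * h \<omega>)) =
      expectation (\<lambda>\<omega>. Re (g \<omega>) * Re (h \<omega>)) - expectation (\<lambda>\<omega>. Im (g \<omega>) * Im (h \<omega>))"
    "Im (expectation (\<lambda>\<omega>. g \<omega> * h \<omega>)) =
      expectation (\<lambda>\<omega>. Re (g \<omega>) * Im (h \<omega>)) + expectation (\<lambda>\<omega>. Im (g \<omega>) * Re (h \<omega>))"
    unfolding integral_Re[OF int_mult, symmetric] integral_Im[OF int_mult, symmetric]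
    using split by simp_all
  have "Re (cov M g h) = cov M (\<lambda>\<omega>. Re (g \<omega>)) (\<lambda>\<omega>. Re (h \<omega>)) - cov M (\<lambda>\<omega>. Im (g \<omega>)) (\<lambda>\<omega>. Im (h \<omega>))"
    using split by (simp add: cov_def parts mult_parts)
  moreover have "Im (cov M g h) = cov M (\<lambda>\<omega>. Re (g \<omega>)) (\<lambda>\<omega>. Im (h \<omega>)) + cov M (\<lambda>\<omega>. Im (g \<omega>)) (\<lambda>\<omega>. Re (h \<omega>))"
    using split by (simp add: cov_def parts mult_parts)
  ultimately show ?thesis
    using cmod_le[of "cov M g h"] K[of Re Re] K[of Im Im] K[of Re Im] K[of Im Re] by simp
qed

section \<open>Covariances under strong mixing\<close>

text \<open>
  Among all \<open>F\<close>-measurable \<open>h\<close> with \<open>\<bar>h\<bar> \<le> D\<close>, the covariance with \<open>g\<close> is extremal for \<open>D\<close> times the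
  sign of the conditional expectation of the centred \<open>g\<close>. Applied to both arguments in
  turn, this reduces bounded functions to signs, that is, to indicators of events.
\<close>

lemma cov_le_cov_sign:
  assumes F: "subalgebra M F"
    and g [measurable]: "g \<in> borel_measurable M" and "\<And>\<omega>. \<bar>g \<omega>\<bar> \<le> C"
    and h: "h \<in> borel_measurable F" and hD: "\<And>\<omega>. \<bar>h \<omega>\<bar> \<le> D"
  obtains s :: "'a \<Rightarrow> real" where "s \<in> borel_measurable F" "\<And>\<omega>. s \<omega> \<in> {- 1, 0, 1}" "\<bar>cov M g h\<bar> \<le> D * cov M g s"
proof -
  interpret finite_measure_subalgebra M F
    by unfold_locales (rule F)
  define g0 where "g0 \<omega> = g \<omega> - expectation g" for \<omega>
  define e where "e = real_cond_exp M F g0"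
  define s where "s \<omega> = sgn (e \<omega>)" for \<omega>
  have "0 \<le> D" using hD by (meson abs_ge_zero order_trans)
  have "integrable M g" using assms by (intro integrable_bounded[of _ C]) auto
  have g0 [measurable]: "g0 \<in> borel_measurable M" unfolding g0_def by measurable
  have g0_bdd: "\<bar>g0 \<omega>\<bar> \<le> C + \<bar>expectation g\<bar>" for \<omega>
    unfolding g0_def using assms(3)[of \<omega>] by linarith
  have e_meas: "e \<in> borel_measurable F" by (simp add: e_def)
  have s_meas: "s \<in> borel_measurable F" unfolding s_def using e_meas by measurable
  have sM: "s \<in> borel_measurable M" and hM: "h \<in> borel_measurable M"
    using s_meas h F by (auto intro: measurable_from_subalg)
  have center: "cov M g u = (\<integral>\<omega>. u \<omega> * e \<omega> \<partial>M)" and int_ue: "integrable M (\<lambda>\<omega>. u \<omega> * e \<omega>)"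
    if u: "u \<in> borel_measurable F" "\<And>\<omega>. \<bar>u \<omega>\<bar> \<le> U" for u U
  proof -
    have uM [measurable]: "u \<in> borel_measurable M" using u F by (auto intro: measurable_from_subalg)
    have "0 \<le> U" using u(2) by (meson abs_ge_zero order_trans)
    have "\<bar>u \<omega> * w\<bar> \<le> U * W" if "\<bar>w\<bar> \<le> W" for \<omega> w W
      using u(2) that \<open>0 \<le> U\<close> by (auto simp: abs_mult intro!: mult_mono)
    then have bdd: "norm (u \<omega> * g \<omega>) \<le> U * C" "norm (u \<omega> * g0 \<omega>) \<le> U * (C + \<bar>expectation g\<bar>)" for \<omega>
      using assms(3) g0_bdd by simp_all
    have int: "integrable M (\<lambda>\<omega>. u \<omega> * g \<omega>)" "integrable M (\<lambda>\<omega>. u \<omega> * g0 \<omega>)" "integrable M u"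
      by (rule integrable_bounded[OF _ bdd(1)] integrable_bounded[OF _ bdd(2)] integrable_bounded[of u U];
          use u(2) in simp)+
    have "cov M g u = (\<integral>\<omega>. u \<omega> * g0 \<omega> \<partial>M)"
      using int by (simp add: cov_def g0_def right_diff_distrib mult.commute)
    also have "\<dots> = (\<integral>\<omega>. u \<omega> * e \<omega> \<partial>M)"
      unfolding e_def using real_cond_exp_intg(2)[OF int(2) u(1) g0] by simp
    finally show "cov M g u = (\<integral>\<omega>. u \<omega> * e \<omega> \<partial>M)" .
    show "integrable M (\<lambda>\<omega>. u \<omega> * e \<omega>)"
      unfolding e_def using real_cond_exp_intg(1)[OF int(2) u(1) g0] by simp
  qed
  have s_bdd: "\<bar>s \<omega>\<bar> \<le> 1" for \<omega> by (simp add: s_def sgn_if)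
  have "\<bar>cov M g h\<bar> \<le> (\<integral>\<omega>. \<bar>h \<omega> * e \<omega>\<bar> \<partial>M)"
    unfolding center[OF h hD] by (rule integral_abs_bound)
  also have "\<dots> \<le> (\<integral>\<omega>. D * (s \<omega> * e \<omega>) \<partial>M)"
  proof (rule integral_mono)
    show "integrable M (\<lambda>\<omega>. \<bar>h \<omega> * e \<omega>\<bar>)" using int_ue[OF h hD] by simp
    show "integrable M (\<lambda>\<omega>. D * (s \<omega> * e \<omega>))" using int_ue[OF s_meas s_bdd] by simp
    show "\<bar>h \<omega> * e \<omega>\<bar> \<le> D * (s \<omega> * e \<omega>)" for \<omega>
    proof -
      have "s \<omega> * e \<omega> = \<bar>e \<omega>\<bar>" by (simp add: s_def sgn_if)
      then show ?thesis using mult_right_mono[OF hD[of \<omega>], of "\<bar>e \<omega>\<bar>"] by (simp add: abs_mult)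
    qed
  qed
  also have "\<dots> = D * cov M g s" by (simp add: center[OF s_meas s_bdd])
  finally have "\<bar>cov M g h\<bar> \<le> D * cov M g s" .
  moreover have "s \<omega> \<in> {- 1, 0, 1}" for \<omega> by (simp add: s_def sgn_if)
  ultimately show ?thesis using s_meas that by blast
qed

lemma alpha_term_le_1:
  assumes "A \<in> sets M" "B \<in> sets M"
  shows "\<bar>prob (A \<inter> B) - prob A * prob B\<bar> \<le> 1"
proof -
  have "0 \<le> prob A * prob B" "prob A * prob B \<le> 1"
    by (auto intro: mult_le_one)
  then show ?thesis
    using prob_le_1[of "A \<inter> B"] measure_nonneg[of M "A \<inter> B"] by linarith
qed

lemma alpha_coeff_upper:
  assumes "subalgebra M U" "subalgebra M V" "A \<in> sets U" "B \<in> sets V"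
  shows "\<bar>prob (A \<inter> B) - prob A * prob B\<bar> \<le> alpha_coeff M U V"
  unfolding alpha_coeff_def
  using assms alpha_term_le_1 unfolding subalgebra_def
  by (intro cSup_upper bdd_aboveI[of _ 1]) blast+

lemma alpha_coeff_le_1:
  assumes "subalgebra M U" "subalgebra M V"
  shows "alpha_coeff M U V \<le> 1"
  unfolding alpha_coeff_def
  using assms alpha_term_le_1 unfolding subalgebra_def
  by (intro cSup_least) blast+

lemma cov_signs_le_alpha:
  assumes UV: "subalgebra M U" "subalgebra M V"
    and s: "s \<in> borel_measurable U" "\<And>\<omega>. s \<omega> \<in> {- 1, 0, 1 :: real}"
    and t: "t \<in> borel_measurable V" "\<And>\<omega>. t \<omega> \<in> {- 1, 0, 1 :: real}"
  shows "cov M s t \<le> 4 * alpha_coeff M U V"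
proof -
  define S where "S c = s -` {c} \<inter> space M" for c
  define T where "T c = t -` {c} \<inter> space M" for c
  have space: "space U = space M" "space V = space M" using UV by (auto simp: subalgebra_def)
  have S: "S c \<in> sets U" and T: "T c \<in> sets V" for c
    using measurable_sets[OF s(1), of "{c}"] measurable_sets[OF t(1), of "{c}"]
    by (simp_all add: S_def T_def space)
  then have SM: "S c \<in> sets M" and TM: "T c \<in> sets M" for c
    using UV by (auto simp: subalgebra_def)
  have ind: "integrable M (indicat_real A)" "expectation (indicat_real A) = prob A" if "A \<in> sets M" for A
    using that by (auto simp: emeasure_eq_measure)
  have s_eq: "s \<omega> = indicator (S 1) \<omega> - indicator (S (- 1)) \<omega>"
    and t_eq: "t \<omega> = indicator (T 1) \<omega> - indicator (T (- 1)) \<omega>" if "\<omega> \<in> space M" for \<omega>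
    using s(2)[of \<omega>] t(2)[of \<omega>] that by (auto simp: S_def T_def)
  have Es: "expectation s = prob (S 1) - prob (S (- 1))"
  proof -
    have "expectation s = expectation (\<lambda>\<omega>. indicator (S 1) \<omega> - indicator (S (- 1)) \<omega>)"
      by (rule Bochner_Integration.integral_cong[OF refl s_eq])
    then show ?thesis using ind SM by simp
  qed
  have Et: "expectation t = prob (T 1) - prob (T (- 1))"
  proof -
    have "expectation t = expectation (\<lambda>\<omega>. indicator (T 1) \<omega> - indicator (T (- 1)) \<omega>)"
      by (rule Bochner_Integration.integral_cong[OF refl t_eq])
    then show ?thesis using ind TM by simp
  qed
  have "expectation (\<lambda>\<omega>. s \<omega> * t \<omega>) =
    expectation (\<lambda>\<omega>. indicator (S 1 \<inter> T 1) \<omega> - indicator (S 1 \<inter> T (- 1)) \<omega>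
       - indicator (S (- 1) \<inter> T 1) \<omega> + indicator (S (- 1) \<inter> T (- 1)) \<omega>)"
    by (rule Bochner_Integration.integral_cong)
       (auto simp: s_eq t_eq indicator_inter_arith algebra_simps)
  also have "\<dots> = prob (S 1 \<inter> T 1) - prob (S 1 \<inter> T (- 1)) - prob (S (- 1) \<inter> T 1) + prob (S (- 1) \<inter> T (- 1))"
    using ind SM TM by (simp add: sets.Int)
  finally have "cov M s t =
      (prob (S 1 \<inter> T 1) - prob (S 1) * prob (T 1)) - (prob (S 1 \<inter> T (- 1)) - prob (S 1) * prob (T (- 1)))
      - (prob (S (- 1) \<inter> T 1) - prob (S (- 1)) * prob (T 1))
      + (prob (S (- 1) \<inter> T (- 1)) - prob (S (- 1)) * prob (T (- 1)))"
    unfolding cov_def Es Et by (simp add: algebra_simps)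
  moreover have "\<bar>prob (S c \<inter> T c') - prob (S c) * prob (T c')\<bar> \<le> alpha_coeff M U V" for c c'
    by (rule alpha_coeff_upper[OF UV S T])
  note this[of 1 1] this[of 1 "- 1"] this[of "- 1" 1] this[of "- 1" "- 1"]
  ultimately show ?thesis by linarith
qed

text \<open>
  Davydov's inequality for bounded variables, with constant 4: two reductions to signs, and four
  pairs of events for two signs.
\<close>

lemma cov_le_alpha:
  assumes UV: "subalgebra M U" "subalgebra M V"
    and g: "g \<in> borel_measurable U" "\<And>\<omega>. \<bar>g \<omega> :: real\<bar> \<le> C"
    and h: "h \<in> borel_measurable V" "\<And>\<omega>. \<bar>h \<omega> :: real\<bar> \<le> D"
  shows "\<bar>cov M g h\<bar> \<le> 4 * alpha_coeff M U V * C * D"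
proof -
  have "0 \<le> C" "0 \<le> D" using g(2) h(2) by (meson abs_ge_zero order_trans)+
  obtain s where s: "s \<in> borel_measurable V" "\<And>\<omega>. s \<omega> \<in> {- 1, 0, 1}" "\<bar>cov M g h\<bar> \<le> D * cov M g s"
    using cov_le_cov_sign[OF UV(2) measurable_from_subalg[OF UV(1) g(1)] g(2) h] by blast
  have "\<bar>s \<omega>\<bar> \<le> 1" for \<omega> using s(2)[of \<omega>] by auto
  then obtain t where t: "t \<in> borel_measurable U" "\<And>\<omega>. t \<omega> \<in> {- 1, 0, 1}" "\<bar>cov M s g\<bar> \<le> C * cov M s t"
    using cov_le_cov_sign[OF UV(1) measurable_from_subalg[OF UV(2) s(1)] _ g] by blast
  have "\<bar>cov M g h\<bar> \<le> D * cov M s g" using s(3) by (simp add: cov_commute)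
  also have "\<dots> \<le> D * (C * cov M s t)" using t(3) \<open>0 \<le> D\<close> by (intro mult_left_mono) auto
  also have "\<dots> \<le> D * (C * (4 * alpha_coeff M U V))"
    using cov_signs_le_alpha[OF UV t(1,2) s(1,2)] \<open>0 \<le> C\<close> \<open>0 \<le> D\<close>
    by (intro mult_left_mono) (auto simp: cov_commute)
  finally show ?thesis by (simp add: mult_ac)
qed

lemma complex_cov_le_alpha:
  fixes g h :: "'a \<Rightarrow> complex"
  assumes UV: "subalgebra M U" "subalgebra M V"
    and g: "g \<in> borel_measurable U" "\<And>\<omega>. norm (g \<omega>) \<le> C"
    and h: "h \<in> borel_measurable V" "\<And>\<omega>. norm (h \<omega>) \<le> D"
  shows "norm (cov M g h) \<le> 16 * alpha_coeff M U V * C * D"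
proof -
  have "norm (cov M g h) \<le> 4 * (4 * alpha_coeff M U V * C * D)"
  proof (rule cov_norm_le[OF measurable_from_subalg[OF UV(1) g(1)] measurable_from_subalg[OF UV(2) h(1)] g(2) h(2)])
    fix u v :: "complex \<Rightarrow> real" assume uv: "u \<in> {Re, Im}" "v \<in> {Re, Im}"
    then have le: "\<bar>u z\<bar> \<le> norm z" "\<bar>v z\<bar> \<le> norm z" for z
      using abs_Re_le_cmod abs_Im_le_cmod by auto
    show "\<bar>cov M (\<lambda>\<omega>. u (g \<omega>)) (\<lambda>\<omega>. v (h \<omega>))\<bar> \<le> 4 * alpha_coeff M U V * C * D"
    proof (rule cov_le_alpha[OF UV])
      show "(\<lambda>\<omega>. u (g \<omega>)) \<in> borel_measurable U" "(\<lambda>\<omega>. v (h \<omega>)) \<in> borel_measurable V"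
        using uv g(1) h(1) by auto
    qed (use le g(2) h(2) order_trans in blast)+
  qed
  then show ?thesis by simp
qed

section \<open>Covariances and the maximal correlation\<close>

lemma cauchy_schwarz_norm2:
  fixes u v :: "'a \<Rightarrow> real"
  assumes [measurable]: "u \<in> borel_measurable M" "v \<in> borel_measurable M"
    and int: "integrable M (\<lambda>\<omega>. (u \<omega>)\<^sup>2)" "integrable M (\<lambda>\<omega>. (v \<omega>)\<^sup>2)"
  shows "integrable M (\<lambda>\<omega>. u \<omega> * v \<omega>)" "\<bar>\<integral>\<omega>. u \<omega> * v \<omega> \<partial>M\<bar> \<le> norm2 M u * norm2 M v"
proof -
  have am_gm: "\<bar>p * q\<bar> \<le> (p\<^sup>2 + q\<^sup>2) / 2" for p q :: real
    using sum_squares_bound[of "\<bar>p\<bar>" "\<bar>q\<bar>"] by (simp add: abs_mult)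
  show int_uv: "integrable M (\<lambda>\<omega>. u \<omega> * v \<omega>)"
  proof (rule Bochner_Integration.integrable_bound)
    show "integrable M (\<lambda>\<omega>. ((u \<omega>)\<^sup>2 + (v \<omega>)\<^sup>2) / 2)" using int by auto
    show "AE \<omega> in M. norm (u \<omega> * v \<omega>) \<le> norm (((u \<omega>)\<^sup>2 + (v \<omega>)\<^sup>2) / 2)"
      using am_gm by (simp add: abs_of_nonneg)
  qed measurable
  have zero: "AE \<omega> in M. w \<omega> = 0"
    if "norm2 M w = 0" "integrable M (\<lambda>\<omega>. (w \<omega>)\<^sup>2)" for w :: "'a \<Rightarrow> real"
  proof -
    have "(\<integral>\<omega>. (w \<omega>)\<^sup>2 \<partial>M) = 0" using that(1) by (simp add: norm2_def)
    then have "AE \<omega> in M. (w \<omega>)\<^sup>2 = 0"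
      using that(2) by (subst (asm) integral_nonneg_eq_0_iff_AE) auto
    then show ?thesis by simp
  qed
  show "\<bar>\<integral>\<omega>. u \<omega> * v \<omega> \<partial>M\<bar> \<le> norm2 M u * norm2 M v"
  proof (cases "norm2 M u = 0 \<or> norm2 M v = 0")
    case True
    then have "AE \<omega> in M. u \<omega> * v \<omega> = 0"
      using zero[of u] zero[of v] int by auto
    then have "(\<integral>\<omega>. u \<omega> * v \<omega> \<partial>M) = 0" by (simp add: integral_eq_zero_AE)
    then show ?thesis using True by auto
  next
    case False
    define p where "p = norm2 M u"
    define q where "q = norm2 M v"
    have "p > 0" "q > 0" using False by (auto simp: p_def q_def norm2_def order_less_le)
    have sq: "(\<integral>\<omega>. (u \<omega>)\<^sup>2 \<partial>M) = p\<^sup>2" "(\<integral>\<omega>. (v \<omega>)\<^sup>2 \<partial>M) = q\<^sup>2"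
      by (simp_all add: p_def q_def norm2_def)
    have "\<bar>\<integral>\<omega>. u \<omega> * v \<omega> \<partial>M\<bar> \<le> (\<integral>\<omega>. \<bar>u \<omega> * v \<omega>\<bar> \<partial>M)" by (rule integral_abs_bound)
    also have "\<dots> \<le> (\<integral>\<omega>. (q / p * (u \<omega>)\<^sup>2 + p / q * (v \<omega>)\<^sup>2) / 2 \<partial>M)"
    proof (rule integral_mono)
      show "integrable M (\<lambda>\<omega>. \<bar>u \<omega> * v \<omega>\<bar>)" using int_uv by simp
      show "integrable M (\<lambda>\<omega>. (q / p * (u \<omega>)\<^sup>2 + p / q * (v \<omega>)\<^sup>2) / 2)" using int by auto
      show "\<bar>u \<omega> * v \<omega>\<bar> \<le> (q / p * (u \<omega>)\<^sup>2 + p / q * (v \<omega>)\<^sup>2) / 2" for \<omega>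
      proof -
        have "\<bar>(q * u \<omega>) * (p * v \<omega>)\<bar> \<le> ((q * u \<omega>)\<^sup>2 + (p * v \<omega>)\<^sup>2) / 2" by (rule am_gm)
        moreover have "\<bar>(q * u \<omega>) * (p * v \<omega>)\<bar> = (p * q) * \<bar>u \<omega> * v \<omega>\<bar>"
          using \<open>p > 0\<close> \<open>q > 0\<close> by (simp add: abs_mult)
        moreover have "((q * u \<omega>)\<^sup>2 + (p * v \<omega>)\<^sup>2) / 2 = (p * q) * ((q / p * (u \<omega>)\<^sup>2 + p / q * (v \<omega>)\<^sup>2) / 2)"
          using \<open>p > 0\<close> \<open>q > 0\<close> by (simp add: field_simps power2_eq_square)
        ultimately have "(p * q) * \<bar>u \<omega> * v \<omega>\<bar> \<le> (p * q) * ((q / p * (u \<omega>)\<^sup>2 + p / q * (v \<omega>)\<^sup>2) / 2)"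
          by simp
        then show ?thesis using \<open>p > 0\<close> \<open>q > 0\<close> by (simp only: mult_le_cancel_left_pos mult_pos_pos)
      qed
    qed
    also have "\<dots> = p * q"
    proof -
      have "(\<integral>\<omega>. (q / p * (u \<omega>)\<^sup>2 + p / q * (v \<omega>)\<^sup>2) / 2 \<partial>M) = (q / p * p\<^sup>2 + p / q * q\<^sup>2) / 2"
        using int by (simp add: sq)
      also have "\<dots> = p * q" using \<open>p > 0\<close> \<open>q > 0\<close> by (simp add: field_simps power2_eq_square)
      finally show ?thesis .
    qed
    finally show ?thesis by (simp add: p_def q_def)
  qed
qed

lemma covar_le_norm2:
  assumes "g \<in> borel_measurable M" "h \<in> borel_measurable M"
    and "integrable M (\<lambda>\<omega>. (g \<omega>)\<^sup>2)" "integrable M (\<lambda>\<omega>. (h \<omega>)\<^sup>2)"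
  shows "\<bar>covar M g h\<bar> \<le> norm2 M g * norm2 M h"
proof -
  have center: "integrable M (\<lambda>\<omega>. (w \<omega> - expectation w)\<^sup>2)" "norm2 M (\<lambda>\<omega>. w \<omega> - expectation w) \<le> norm2 M w"
    if [measurable]: "w \<in> borel_measurable M" and w: "integrable M (\<lambda>\<omega>. (w \<omega>)\<^sup>2)" for w :: "'a \<Rightarrow> real"
  proof -
    have "integrable M w" using square_integrable_imp_integrable[OF that] .
    then show "integrable M (\<lambda>\<omega>. (w \<omega> - expectation w)\<^sup>2)"
      using w by (simp add: power2_diff)
    show "norm2 M (\<lambda>\<omega>. w \<omega> - expectation w) \<le> norm2 M w"
      unfolding norm2_def using variance_eq[OF \<open>integrable M w\<close> w] by simp
  qed
  have "\<bar>covar M g h\<bar> \<le> norm2 M (\<lambda>\<omega>. g \<omega> - expectation g) * norm2 M (\<lambda>\<omega>. h \<omega> - expectation h)"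
    unfolding covar_def using assms center by (intro cauchy_schwarz_norm2) auto
  also have "\<dots> \<le> norm2 M g * norm2 M h"
    using assms center by (intro mult_mono) (auto simp: norm2_def)
  finally show ?thesis .
qed

text \<open>
  The quotients that define \<open>rho_coeff\<close> are bounded, so the supremum is a genuine one.
\<close>

lemma rho_term_le_1:
  assumes "subalgebra M U" "subalgebra M V" "g \<in> sq_integrable M U" "h \<in> sq_integrable M V"
  shows "\<bar>covar M g h\<bar> / (norm2 M g * norm2 M h) \<le> 1"
proof -
  have "\<bar>covar M g h\<bar> \<le> norm2 M g * norm2 M h"
    using assms by (intro covar_le_norm2) (auto simp: sq_integrable_def intro: measurable_from_subalg)
  moreover have "0 \<le> norm2 M g * norm2 M h" by (simp add: norm2_def)
  ultimately show ?thesis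
    by (cases "norm2 M g * norm2 M h = 0") (simp_all add: divide_le_eq_1 order_less_le del: mult_eq_0_iff)
qed

lemma rho_coeff_le_1:
  assumes "subalgebra M U" "subalgebra M V"
  shows "rho_coeff M U V \<le> 1"
  unfolding rho_coeff_def
proof (rule cSup_least)
  have "(\<lambda>_. 0) \<in> sq_integrable M U" "(\<lambda>_. 0) \<in> sq_integrable M V" by (auto simp: sq_integrable_def)
  then show "{\<bar>covar M g h\<bar> / (norm2 M g * norm2 M h) |g h. g \<in> sq_integrable M U \<and> h \<in> sq_integrable M V} \<noteq> {}"
    by blast
qed (use rho_term_le_1[OF assms] in blast)

lemma covar_le_rho:
  assumes UV: "subalgebra M U" "subalgebra M V" and gh: "g \<in> sq_integrable M U" "h \<in> sq_integrable M V"
  shows "\<bar>covar M g h\<bar> \<le> rho_coeff M U V * norm2 M g * norm2 M h"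
proof -
  have le: "\<bar>covar M g h\<bar> \<le> norm2 M g * norm2 M h"
    using assms by (intro covar_le_norm2) (auto simp: sq_integrable_def intro: measurable_from_subalg)
  have "\<bar>covar M g h\<bar> / (norm2 M g * norm2 M h) \<le> rho_coeff M U V"
    unfolding rho_coeff_def using gh rho_term_le_1[OF UV]
    by (intro cSup_upper bdd_aboveI[of _ 1]) blast+
  moreover have "0 \<le> norm2 M g * norm2 M h" by (simp add: norm2_def)
  ultimately show ?thesis
  proof (cases "norm2 M g * norm2 M h = 0")
    case True
    then show ?thesis using le by auto
  next
    case False
    then show ?thesis
      using \<open>0 \<le> norm2 M g * norm2 M h\<close> \<open>\<bar>covar M g h\<bar> / (norm2 M g * norm2 M h) \<le> rho_coeff M U V\<close>
      by (simp add: divide_le_eq mult.assoc order_less_le del: mult_eq_0_iff)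
  qed
qed

lemma complex_cov_le_rho:
  fixes g h :: "'a \<Rightarrow> complex"
  assumes UV: "subalgebra M U" "subalgebra M V"
    and g: "g \<in> borel_measurable U" "\<And>\<omega>. norm (g \<omega>) \<le> C"
    and h: "h \<in> borel_measurable V" "\<And>\<omega>. norm (h \<omega>) \<le> D"
    and "0 \<le> rho_coeff M U V"
  shows "norm (cov M g h) \<le> 4 * rho_coeff M U V * norm2 M (\<lambda>\<omega>. norm (g \<omega>)) * norm2 M (\<lambda>\<omega>. norm (h \<omega>))"
proof -
  have gM [measurable]: "g \<in> borel_measurable M" and hM [measurable]: "h \<in> borel_measurable M"
    using UV g(1) h(1) by (auto intro: measurable_from_subalg)
  have part: "integrable M (\<lambda>\<omega>. u (w \<omega>))" "integrable M (\<lambda>\<omega>. (u (w \<omega>))\<^sup>2)" "norm2 M (\<lambda>\<omega>. u (w \<omega>)) \<le> norm2 M (\<lambda>\<omega>. norm (w \<omega>))"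
    if [measurable]: "w \<in> borel_measurable M" and W: "\<And>\<omega>. norm (w \<omega>) \<le> W" and u: "u \<in> {Re, Im}"
    for w :: "'a \<Rightarrow> complex" and u W
  proof -
    have le: "\<bar>u z\<bar> \<le> norm z" for z using u abs_Re_le_cmod abs_Im_le_cmod by auto
    have [measurable]: "(\<lambda>\<omega>. u (w \<omega>)) \<in> borel_measurable M" using u by auto
    have sq: "(u z)\<^sup>2 \<le> (norm z)\<^sup>2" for z
      using le[of z] by (simp add: abs_le_square_iff[symmetric])
    show "integrable M (\<lambda>\<omega>. u (w \<omega>))"
    proof (rule integrable_bounded)
      show "norm (u (w \<omega>)) \<le> W" for \<omega> using order_trans[OF le W] by simp
    qed simp
    have "(norm (w \<omega>))\<^sup>2 \<le> W\<^sup>2" for \<omega> using W[of \<omega>] by (intro power_mono) auto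
    then have n: "integrable M (\<lambda>\<omega>. (norm (w \<omega>))\<^sup>2)"
      by (intro integrable_bounded[of _ "W\<^sup>2"]) auto
    show s: "integrable M (\<lambda>\<omega>. (u (w \<omega>))\<^sup>2)"
      by (rule Bochner_Integration.integrable_bound[OF n]) (use sq in auto)
    show "norm2 M (\<lambda>\<omega>. u (w \<omega>)) \<le> norm2 M (\<lambda>\<omega>. norm (w \<omega>))"
      unfolding norm2_def using sq by (intro real_sqrt_le_mono integral_mono s n) auto
  qed
  have "norm (cov M g h) \<le> 4 * (rho_coeff M U V * norm2 M (\<lambda>\<omega>. norm (g \<omega>)) * norm2 M (\<lambda>\<omega>. norm (h \<omega>)))"
  proof (rule cov_norm_le[OF gM hM g(2) h(2)])
    fix u v :: "complex \<Rightarrow> real" assume uv: "u \<in> {Re, Im}" "v \<in> {Re, Im}"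
    let ?g = "\<lambda>\<omega>. u (g \<omega>)" and ?h = "\<lambda>\<omega>. v (h \<omega>)"
    note pg = part[OF gM g(2) uv(1)] and ph = part[OF hM h(2) uv(2)]
    have meas: "?g \<in> borel_measurable U" "?h \<in> borel_measurable V" using uv g(1) h(1) by auto
    have "integrable M (\<lambda>\<omega>. ?g \<omega> * ?h \<omega>)"
      using pg ph meas UV by (intro cauchy_schwarz_norm2) (auto intro: measurable_from_subalg)
    then have "covar M ?g ?h = cov M ?g ?h"
      using pg ph by (simp add: covar_def cov_def algebra_simps prob_space)
    then have "\<bar>cov M ?g ?h\<bar> \<le> rho_coeff M U V * norm2 M ?g * norm2 M ?h"
      using covar_le_rho[OF UV, of ?g ?h] meas pg ph by (simp add: sq_integrable_def)
    also have "\<dots> \<le> rho_coeff M U V * norm2 M (\<lambda>\<omega>. norm (g \<omega>)) * norm2 M (\<lambda>\<omega>. norm (h \<omega>))"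
      using pg(3) ph(3) assms(7) by (intro mult_mono) (auto simp: norm2_def)
    finally show "\<bar>cov M ?g ?h\<bar> \<le> \<dots>" .
  qed
  then show ?thesis by simp
qed

end


section \<open>Decoupling a product of random variables\<close>

context prob_space
begin

lemma norm_prod_le_1:
  fixes V :: "'i \<Rightarrow> complex"
  assumes "\<And>i. norm (V i) \<le> 1"
  shows "norm (\<Prod>i\<in>B. V i) \<le> 1"
  unfolding prod_norm[symmetric] using assms by (intro prod_le_1) auto

text \<open>
  The product over \<open>A\<close> is taken apart by removing the smallest value of \<open>d\<close> first:
  \<open>V_A = V_B + V_B (V_j - 1)\<close> with \<open>A = insert j B\<close>. In applications \<open>d\<close> is the distance to the
  site of \<open>W\<close>, hence in each covariance that appears the second argument depends on sites at
  distance at least \<open>d j\<close> only.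
\<close>

lemma cov_with_product_le:
  fixes V :: "'i \<Rightarrow> 'a \<Rightarrow> complex" and d :: "'i \<Rightarrow> nat"
  assumes V: "\<And>i. V i \<in> borel_measurable M" "\<And>i \<omega>. norm (V i \<omega>) \<le> 1"
    and W: "W \<in> borel_measurable M" "\<And>\<omega>. norm (W \<omega>) \<le> K"
    and "finite A"
    and step: "\<And>j B. finite B \<Longrightarrow> insert j B \<subseteq> A \<Longrightarrow> j \<notin> B \<Longrightarrow> (\<And>i. i \<in> B \<Longrightarrow> d j \<le> d i) \<Longrightarrow>
      norm (cov M W (\<lambda>\<omega>. (\<Prod>i\<in>B. V i \<omega>) * (V j \<omega> - 1))) \<le> c j"
  shows "norm (cov M W (\<lambda>\<omega>. \<Prod>i\<in>A. V i \<omega>)) \<le> (\<Sum>j\<in>A. c j)"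
  using \<open>finite A\<close> step
proof (induction A rule: finite_ranking_induct[where f = "\<lambda>i. - int (d i)"])
  case empty
  show ?case by (simp add: cov_def prob_space)
next
  case (insert j B)
  have IH: "norm (cov M W (\<lambda>\<omega>. \<Prod>i\<in>B. V i \<omega>)) \<le> (\<Sum>j\<in>B. c j)"
    by (rule insert.IH) (rule insert.prems; blast)
  show ?case
  proof (cases "j \<in> B")
    case True
    then show ?thesis using IH by (simp add: insert_absorb)
  next
    case False
    have P: "(\<lambda>\<omega>. \<Prod>i\<in>B. V i \<omega>) \<in> borel_measurable M" using V(1) by (intro borel_measurable_prod)
    have P1: "norm (\<Prod>i\<in>B. V i \<omega>) \<le> 1" for \<omega> using V(2) by (rule norm_prod_le_1)
    have Q: "(\<lambda>\<omega>. (\<Prod>i\<in>B. V i \<omega>) * (V j \<omega> - 1)) \<in> borel_measurable M" using P V(1) by simp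
    have Q2: "norm ((\<Prod>i\<in>B. V i \<omega>) * (V j \<omega> - 1)) \<le> 1 * 2" for \<omega>
    proof -
      have "norm (V j \<omega> - 1) \<le> norm (V j \<omega>) + norm (1 :: complex)" by (rule norm_triangle_ineq4)
      also have "\<dots> \<le> 2" using V(2)[of j \<omega>] by simp
      finally show ?thesis unfolding norm_mult using P1 by (intro mult_mono) auto
    qed
    have "(\<lambda>\<omega>. \<Prod>i\<in>insert j B. V i \<omega>) =
        (\<lambda>\<omega>. (\<Prod>i\<in>B. V i \<omega>) + (\<Prod>i\<in>B. V i \<omega>) * (V j \<omega> - 1))"
      using False insert.hyps(1) by (simp add: algebra_simps)
    then have "cov M W (\<lambda>\<omega>. \<Prod>i\<in>insert j B. V i \<omega>) =
        cov M W (\<lambda>\<omega>. \<Prod>i\<in>B. V i \<omega>) + cov M W (\<lambda>\<omega>. (\<Prod>i\<in>B. V i \<omega>) * (V j \<omega> - 1))"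
      using cov_add_right[OF W(1) P Q W(2) P1 Q2] by simp
    moreover have "norm (cov M W (\<lambda>\<omega>. (\<Prod>i\<in>B. V i \<omega>) * (V j \<omega> - 1))) \<le> c j"
      using insert.hyps False by (intro insert.prems) auto
    ultimately show ?thesis
      using IH False insert.hyps(1) by (auto intro: norm_triangle_le)
  qed
qed

text \<open>
  Factors are split off one at a time. Splitting off \<open>V k\<close> costs its covariance with the
  remaining product, and by bilinearity \<open>V k\<close> may be replaced there by \<open>V k - 1\<close>; each
  covariance bounded by \<open>c k j\<close> thus contains the two small factors \<open>V k - 1\<close> and \<open>V j - 1\<close>.
\<close>

theorem expectation_product_decoupling:
  fixes V :: "'i \<Rightarrow> 'a \<Rightarrow> complex" and d :: "'i \<Rightarrow> 'i \<Rightarrow> nat"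
  assumes V: "\<And>i. V i \<in> borel_measurable M" "\<And>i \<omega>. norm (V i \<omega>) \<le> 1"
    and "finite A"
    and c_nonneg: "\<And>k j. 0 \<le> c k j"
    and step: "\<And>k j B. finite B \<Longrightarrow> insert j B \<subseteq> A \<Longrightarrow> k \<notin> insert j B \<Longrightarrow> (\<And>i. i \<in> B \<Longrightarrow> d k j \<le> d k i) \<Longrightarrow>
      norm (cov M (\<lambda>\<omega>. V k \<omega> - 1) (\<lambda>\<omega>. (\<Prod>i\<in>B. V i \<omega>) * (V j \<omega> - 1))) \<le> c k j"
  shows "norm (expectation (\<lambda>\<omega>. \<Prod>i\<in>A. V i \<omega>) - (\<Prod>i\<in>A. expectation (V i)))
    \<le> (\<Sum>k\<in>A. \<Sum>j\<in>A - {k}. c k j)"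
  using \<open>finite A\<close> step
proof (induction A rule: finite_induct)
  case empty
  show ?case by (simp add: prob_space)
next
  case (insert k A)
  define P where "P \<omega> = (\<Prod>i\<in>A. V i \<omega>)" for \<omega>
  define E where "E = (\<Prod>i\<in>A. expectation (V i))"
  have P: "P \<in> borel_measurable M" unfolding P_def using V(1) by (intro borel_measurable_prod)
  have P1: "norm (P \<omega>) \<le> 1" for \<omega> unfolding P_def using V(2) by (rule norm_prod_le_1)
  have IH: "norm (expectation P - E) \<le> (\<Sum>k\<in>A. \<Sum>j\<in>A - {k}. c k j)"
    unfolding P_def E_def by (rule insert.IH) (rule insert.prems; blast)
  have 2: "norm (V k \<omega> - 1) \<le> 2" for \<omega>
    using norm_triangle_ineq4[of "V k \<omega>" 1] V(2)[of k \<omega>] by simp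
  have "cov M P (\<lambda>\<omega>. V k \<omega> - 1) = cov M P (V k) - cov M P (\<lambda>_. 1)"
    using V P P1 by (intro cov_diff_right[where F = 1 and G = 1 and H = 1]) auto
  then have "cov M P (V k) = cov M (\<lambda>\<omega>. V k \<omega> - 1) P"
    by (simp add: cov_commute[of M P] cov_const_left)
  moreover have "norm (cov M (\<lambda>\<omega>. V k \<omega> - 1) P) \<le> (\<Sum>j\<in>A. c k j)"
    unfolding P_def
  proof (rule cov_with_product_le[where d = "d k", OF V _ 2 insert.hyps(1)])
    show "(\<lambda>\<omega>. V k \<omega> - 1) \<in> borel_measurable M" using V(1) by simp
    show "norm (cov M (\<lambda>\<omega>. V k \<omega> - 1) (\<lambda>\<omega>. (\<Prod>i\<in>B. V i \<omega>) * (V j \<omega> - 1))) \<le> c k j"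
      if "finite B" "insert j B \<subseteq> A" "\<And>i. i \<in> B \<Longrightarrow> d k j \<le> d k i" for j B
      using that insert.hyps by (intro insert.prems) auto
  qed
  ultimately have cov_le: "norm (cov M P (V k)) \<le> (\<Sum>j\<in>A. c k j)" by simp
  have Vk: "norm (expectation (V k)) \<le> 1"
  proof -
    have "norm (expectation (V k)) \<le> expectation (\<lambda>\<omega>. norm (V k \<omega>))" by (rule integral_norm_bound)
    also have "\<dots> \<le> expectation (\<lambda>_. 1)"
      using V integrable_bounded[of "V k" 1] by (intro integral_mono) auto
    finally show ?thesis by (simp add: prob_space)
  qed
  have "expectation (\<lambda>\<omega>. \<Prod>i\<in>insert k A. V i \<omega>) - (\<Prod>i\<in>insert k A. expectation (V i)) =
      cov M P (V k) + expectation (V k) * (expectation P - E)"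
    using insert.hyps by (simp add: cov_def P_def[abs_def] E_def algebra_simps)
  then have "norm (expectation (\<lambda>\<omega>. \<Prod>i\<in>insert k A. V i \<omega>) - (\<Prod>i\<in>insert k A. expectation (V i))) \<le>
      norm (cov M P (V k)) + norm (expectation (V k)) * norm (expectation P - E)"
    by (metis norm_triangle_ineq norm_mult)
  also have "norm (expectation (V k)) * norm (expectation P - E) \<le> norm (expectation P - E)"
    using Vk by (simp add: mult_left_le_one_le)
  also have "norm (cov M P (V k)) + norm (expectation P - E) \<le>
      (\<Sum>j\<in>A. c k j) + (\<Sum>k\<in>A. \<Sum>j\<in>A - {k}. c k j)"
    using cov_le IH by (rule add_mono)
  also have "(\<Sum>k\<in>A. \<Sum>j\<in>A - {k}. c k j) \<le> (\<Sum>k'\<in>A. \<Sum>j\<in>insert k A - {k'}. c k' j)"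
    using insert.hyps(1) c_nonneg by (intro sum_mono sum_mono2) auto
  also have "(\<Sum>j\<in>A. c k j) + (\<Sum>k'\<in>A. \<Sum>j\<in>insert k A - {k'}. c k' j) =
      (\<Sum>k'\<in>insert k A. \<Sum>j\<in>insert k A - {k'}. c k' j)"
    using insert.hyps by simp
  finally show ?case by simp
qed

end

section \<open>Mixing random fields\<close>

lemma lat_norm_ge: "nat \<bar>i $ k\<bar> \<le> lat_norm i"
  unfolding lat_norm_def by (intro Max_ge) auto

lemma lat_norm_le_iff: "lat_norm i \<le> m \<longleftrightarrow> (\<forall>k. \<bar>i $ k\<bar> \<le> int m)"
  unfolding lat_norm_def by (subst Max_le_iff) (auto simp: nat_le_iff)

lemma mixing_pairs_inftyI:
  assumes "B \<noteq> {}" "\<And>i. i \<in> B \<Longrightarrow> m \<le> lat_norm (i - k)"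
  shows "(k, B) \<in> mixing_pairs \<infinity> m"
  unfolding mixing_pairs_def lat_dist_def using assms by (auto intro!: cInf_greatest)

text \<open>
  Without pairs at distance \<open>m\<close> the coefficient would be the supremum of the empty set, an
  arbitrary number; its nonnegativity rests on this lemma.
\<close>

lemma mixing_pairs_infty_nonempty: "(mixing_pairs \<infinity> m :: ((int ^ 'd) \<times> (int ^ 'd) set) set) \<noteq> {}"
proof -
  have "m \<le> lat_norm ((\<chi> k. int m) - 0 :: int ^ 'd)"
    using lat_norm_ge[of "\<chi> k. int m :: int ^ 'd"] by simp
  then have "(0, {\<chi> k. int m}) \<in> (mixing_pairs \<infinity> m :: ((int ^ 'd) \<times> (int ^ 'd) set) set)"
    by (intro mixing_pairs_inftyI) auto
  then show ?thesis by blast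
qed

locale stationary_random_field = prob_space M for M :: "'a measure" +
  fixes X :: "int ^ 'd \<Rightarrow> 'a \<Rightarrow> real"
  assumes stationary: "stationary_field M X"
begin

lemma X_measurable [measurable]: "X i \<in> borel_measurable M"
  using stationary by (simp add: stationary_field_def)

text \<open>
  Translation invariance in the form in which it enters the moment estimates, where at most two
  sites occur at a time.
\<close>

lemma pair_translation:
  fixes \<phi> :: "real \<times> real \<Rightarrow> 'b::{banach, second_countable_topology}"
  assumes [measurable]: "\<phi> \<in> borel_measurable (borel \<Otimes>\<^sub>M borel)"
  shows "expectation (\<lambda>\<omega>. \<phi> (X k \<omega>, X j \<omega>)) = expectation (\<lambda>\<omega>. \<phi> (X 0 \<omega>, X (j - k) \<omega>))"
proof -
  let ?P = "PiM UNIV (\<lambda>_::int ^ 'd. borel :: real measure)"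
  define \<psi> where "\<psi> v = \<phi> (v 0, v (j - k))" for v :: "int ^ 'd \<Rightarrow> real"
  have \<psi>: "\<psi> \<in> borel_measurable ?P" unfolding \<psi>_def by measurable
  have X: "(\<lambda>\<omega> i. X (i + l) \<omega>) \<in> measurable M ?P" for l
    by (rule measurable_PiM_single') auto
  have "expectation (\<lambda>\<omega>. \<phi> (X k \<omega>, X j \<omega>)) = (\<integral>v. \<psi> v \<partial>distr M ?P (\<lambda>\<omega> i. X (i + k) \<omega>))"
    by (subst integral_distr[OF X \<psi>]) (simp add: \<psi>_def)
  also have "distr M ?P (\<lambda>\<omega> i. X (i + k) \<omega>) = distr M ?P (\<lambda>\<omega> i. X i \<omega>)"
    using stationary by (simp add: stationary_field_def)
  also have "(\<integral>v. \<psi> v \<partial>\<dots>) = expectation (\<lambda>\<omega>. \<phi> (X 0 \<omega>, X (j - k) \<omega>))"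
    using X[of 0] by (subst integral_distr[OF _ \<psi>]) (simp_all add: \<psi>_def)
  finally show ?thesis .
qed

lemma single_translation:
  fixes \<phi> :: "real \<Rightarrow> 'b::{banach, second_countable_topology}"
  assumes [measurable]: "\<phi> \<in> borel_measurable borel"
  shows "expectation (\<lambda>\<omega>. \<phi> (X k \<omega>)) = expectation (\<lambda>\<omega>. \<phi> (X 0 \<omega>))"
  using pair_translation[of "\<lambda>(x, y). \<phi> x" k k] by simp

lemma space_field_sigma: "space (field_sigma M X B) = space M"
  unfolding field_sigma_def by (rule space_measure_of) blast

lemma sets_field_sigma:
  "sets (field_sigma M X B) = sigma_sets (space M) {X i -` A \<inter> space M | i A. i \<in> B \<and> A \<in> sets borel}"
  unfolding field_sigma_def by (rule sets_measure_of) blast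

lemma subalgebra_field_sigma: "subalgebra M (field_sigma M X B)"
proof -
  have "{X i -` A \<inter> space M | i A. i \<in> B \<and> A \<in> sets borel} \<subseteq> sets M"
    using measurable_sets[OF X_measurable] by blast
  then have "sigma_sets (space M) {X i -` A \<inter> space M | i A. i \<in> B \<and> A \<in> sets borel} \<subseteq> sets M"
    by (rule sets.sigma_sets_subset)
  then show ?thesis
    unfolding subalgebra_def by (simp add: space_field_sigma sets_field_sigma)
qed

lemma measurable_field_sigma: "i \<in> B \<Longrightarrow> X i \<in> borel_measurable (field_sigma M X B)"
  by (rule measurableI) (auto intro!: sigma_sets.Basic simp: space_field_sigma sets_field_sigma)

lemma alpha_coeff_nonneg: "0 \<le> alpha_coeff M (field_sigma M X A) (field_sigma M X B)"
  using alpha_coeff_upper[OF subalgebra_field_sigma[of A] subalgebra_field_sigma[of B] sets.empty_sets sets.empty_sets]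
  by simp

lemma rho_coeff_nonneg: "0 \<le> rho_coeff M (field_sigma M X A) (field_sigma M X B)"
proof -
  have "(\<lambda>_. 0) \<in> sq_integrable M (field_sigma M X C)" for C by (auto simp: sq_integrable_def)
  then have "\<bar>covar M (\<lambda>_. 0) (\<lambda>_. 0)\<bar> / (norm2 M (\<lambda>_. 0) * norm2 M (\<lambda>_. 0))
      \<le> rho_coeff M (field_sigma M X A) (field_sigma M X B)"
    unfolding rho_coeff_def
    using rho_term_le_1[OF subalgebra_field_sigma[of A] subalgebra_field_sigma[of B]]
    by (intro cSup_upper bdd_aboveI[of _ 1]) blast+
  then show ?thesis by (simp add: norm2_def)
qed

lemma alpha_coeff_le_alpha_1:
  assumes "(k, B) \<in> mixing_pairs \<infinity> m"
  shows "alpha_coeff M (field_sigma M X {k}) (field_sigma M X B) \<le> alpha_1 M X \<infinity> m"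
  unfolding alpha_1_def
  using alpha_coeff_le_1[OF subalgebra_field_sigma subalgebra_field_sigma]
  by (intro cSUP_upper2[OF _ assms] bdd_aboveI[of _ 1]) auto

lemma rho_coeff_le_rho_1:
  assumes "(k, B) \<in> mixing_pairs \<infinity> m"
  shows "rho_coeff M (field_sigma M X {k}) (field_sigma M X B) \<le> rho_1 M X \<infinity> m"
  unfolding rho_1_def
  using rho_coeff_le_1[OF subalgebra_field_sigma subalgebra_field_sigma]
  by (intro cSUP_upper2[OF _ assms] bdd_aboveI[of _ 1]) auto

lemma alpha_1_nonneg: "0 \<le> alpha_1 M X \<infinity> m"
  using mixing_pairs_infty_nonempty alpha_coeff_le_alpha_1 alpha_coeff_nonneg
  by (metis all_not_in_conv order_trans surj_pair)

lemma rho_1_nonneg: "0 \<le> rho_1 M X \<infinity> m"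
  using mixing_pairs_infty_nonempty rho_coeff_le_rho_1 rho_coeff_nonneg
  by (metis all_not_in_conv order_trans surj_pair)

end


section \<open>Counting lattice points by distance\<close>

lemma card_lat_box: "card {j :: int ^ 'd. lat_norm j \<le> m} = (2 * m + 1) ^ CARD('d)"
  and finite_lat_box: "finite {j :: int ^ 'd. lat_norm j \<le> m}"
proof -
  let ?F = "PiE (UNIV :: 'd set) (\<lambda>_. {- int m .. int m})"
  have eq: "{j :: int ^ 'd. lat_norm j \<le> m} = vec_lambda ` ?F"
  proof (intro equalityI subsetI)
    fix j :: "int ^ 'd" assume "j \<in> {j. lat_norm j \<le> m}"
    then have "vec_nth j \<in> ?F" by (auto simp: lat_norm_le_iff abs_le_iff minus_le_iff)
    then show "j \<in> vec_lambda ` ?F" by (intro image_eqI[of _ _ "vec_nth j"]) auto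
  next
    fix j :: "int ^ 'd" assume "j \<in> vec_lambda ` ?F"
    then show "j \<in> {j. lat_norm j \<le> m}"
      by (auto simp: lat_norm_le_iff abs_le_iff minus_le_iff PiE_iff)
  qed
  have "inj_on vec_lambda ?F"
    by (intro inj_onI) (metis vec_lambda_inverse UNIV_I)
  then have "card (vec_lambda ` ?F) = (2 * m + 1) ^ CARD('d)"
    by (simp add: card_image card_PiE nat_add_distrib nat_mult_distrib)
  then show "card {j :: int ^ 'd. lat_norm j \<le> m} = (2 * m + 1) ^ CARD('d)" by (simp add: eq)
  show "finite {j :: int ^ 'd. lat_norm j \<le> m}" unfolding eq by (intro finite_imageI finite_PiE) auto
qed

lemma power_diff_le:
  fixes x y :: real
  assumes "0 \<le> y" "y \<le> x"
  shows "x ^ Suc n - y ^ Suc n \<le> real (Suc n) * x ^ n * (x - y)"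
proof (induction n)
  case 0
  show ?case by simp
next
  case (Suc n)
  have "x ^ Suc (Suc n) - y ^ Suc (Suc n) = x * (x ^ Suc n - y ^ Suc n) + y ^ Suc n * (x - y)"
    by (simp add: algebra_simps)
  also have "\<dots> \<le> x * (real (Suc n) * x ^ n * (x - y)) + x ^ Suc n * (x - y)"
    using assms Suc by (intro add_mono mult_left_mono mult_right_mono power_mono) auto
  also have "\<dots> = real (Suc (Suc n)) * x ^ Suc n * (x - y)" by (simp add: algebra_simps)
  finally show ?case .
qed

lemma card_lat_shell_le:
  assumes "1 \<le> m"
  shows "real (card {j :: int ^ 'd. lat_norm j = m}) \<le>
    2 * real CARD('d) * 3 ^ (CARD('d) - 1) * real m ^ (CARD('d) - 1)"
proof -
  define p where "p = CARD('d) - 1"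
  have d: "CARD('d) = Suc p" by (simp add: p_def)
  let ?B = "\<lambda>m. {j :: int ^ 'd. lat_norm j \<le> m}"
  have sub: "?B (m - 1) \<subseteq> ?B m" by auto
  have "{j :: int ^ 'd. lat_norm j = m} = ?B m - ?B (m - 1)" using assms by auto
  then have "card {j :: int ^ 'd. lat_norm j = m} = card (?B m) - card (?B (m - 1))"
    using card_Diff_subset[OF finite_lat_box sub] by simp
  then have "real (card {j :: int ^ 'd. lat_norm j = m}) = real (card (?B m)) - real (card (?B (m - 1)))"
    using card_mono[OF finite_lat_box sub] by (simp add: of_nat_diff)
  also have "\<dots> = real (2 * m + 1) ^ Suc p - real (2 * m - 1) ^ Suc p"
  proof -
    have "2 * (m - 1) + 1 = 2 * m - 1" using assms by simp
    then show ?thesis unfolding card_lat_box d by (simp only: of_nat_power)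
  qed
  also have "\<dots> \<le> real (Suc p) * real (2 * m + 1) ^ p * (real (2 * m + 1) - real (2 * m - 1))"
    by (rule power_diff_le) auto
  also have "\<dots> = 2 * real (Suc p) * real (2 * m + 1) ^ p" using assms by (simp add: of_nat_diff)
  also have "\<dots> \<le> 2 * real (Suc p) * (3 * real m) ^ p"
    using assms by (intro mult_left_mono power_mono) auto
  finally show ?thesis by (simp add: d power_mult_distrib mult.assoc)
qed

text \<open>
  Near sites are counted by the volume of a box, far sites shell by shell; the weight \<open>m^(d-1)\<close> in
  the tail hypothesis is the order of the size of a shell of radius \<open>m\<close>.
\<close>

lemma lattice_sum_le:
  fixes c :: "int ^ 'd \<Rightarrow> real" and h :: "nat \<Rightarrow> real"
  assumes "finite D" "1 \<le> M" "0 \<le> u" and h: "\<And>m. 0 \<le> h m"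
    and near: "\<And>j. j \<in> D \<Longrightarrow> lat_norm j < M \<Longrightarrow> c j \<le> u"
    and far: "\<And>j. j \<in> D \<Longrightarrow> M \<le> lat_norm j \<Longrightarrow> c j \<le> h (lat_norm j)"
    and tail: "\<And>R. (\<Sum>m=M..<R. real m ^ (CARD('d) - 1) * h m) \<le> T"
  shows "(\<Sum>j\<in>D. c j) \<le> (2 * real M) ^ CARD('d) * u + 2 * real CARD('d) * 3 ^ (CARD('d) - 1) * T"
proof -
  define S where "S = 2 * real CARD('d) * 3 ^ (CARD('d) - 1)"
  define N where "N = {j \<in> D. lat_norm j < M}"
  define F where "F = {j \<in> D. M \<le> lat_norm j}"
  define R where "R = Suc (Max (insert 0 (lat_norm ` D)))"
  have fin: "finite N" "finite F" using \<open>finite D\<close> by (auto simp: N_def F_def)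
  have "card N \<le> card {j :: int ^ 'd. lat_norm j \<le> M - 1}"
    using finite_lat_box by (intro card_mono) (auto simp: N_def)
  also have "\<dots> = (2 * (M - 1) + 1) ^ CARD('d)" by (rule card_lat_box)
  also have "\<dots> \<le> (2 * M) ^ CARD('d)" using \<open>1 \<le> M\<close> by (intro power_mono) auto
  finally have cardN: "real (card N) \<le> (2 * real M) ^ CARD('d)"
    by (metis of_nat_le_iff of_nat_mult of_nat_numeral of_nat_power)
  have "(\<Sum>j\<in>N. c j) \<le> real (card N) * u"
    using near by (intro sum_bounded_above) (auto simp: N_def)
  also have "\<dots> \<le> (2 * real M) ^ CARD('d) * u"
    using cardN \<open>0 \<le> u\<close> by (rule mult_right_mono)
  finally have N_le: "(\<Sum>j\<in>N. c j) \<le> (2 * real M) ^ CARD('d) * u" .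
  have range: "lat_norm ` F \<subseteq> {M..<R}"
    using \<open>finite D\<close> by (auto simp: F_def R_def less_Suc_eq_le intro!: Max_ge)
  have "(\<Sum>j\<in>F. c j) \<le> (\<Sum>j\<in>F. h (lat_norm j))"
    using far by (intro sum_mono) (auto simp: F_def)
  also have "\<dots> = (\<Sum>m=M..<R. \<Sum>j\<in>{j \<in> F. lat_norm j = m}. h (lat_norm j))"
    by (rule sum.group[symmetric, OF fin(2) _ range]) simp
  also have "\<dots> \<le> (\<Sum>m=M..<R. S * (real m ^ (CARD('d) - 1) * h m))"
  proof (rule sum_mono)
    fix m assume m: "m \<in> {M..<R}"
    have "(\<Sum>j\<in>{j \<in> F. lat_norm j = m}. h (lat_norm j)) = real (card {j \<in> F. lat_norm j = m}) * h m"
      by simp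
    also have "card {j \<in> F. lat_norm j = m} \<le> card {j :: int ^ 'd. lat_norm j = m}"
      by (intro card_mono finite_subset[OF _ finite_lat_box[of m]]) auto
    then have "real (card {j \<in> F. lat_norm j = m}) * h m \<le> real (card {j :: int ^ 'd. lat_norm j = m}) * h m"
      using h by (intro mult_right_mono) auto
    also have "\<dots> \<le> S * real m ^ (CARD('d) - 1) * h m"
      unfolding S_def using m \<open>1 \<le> M\<close> h by (intro mult_right_mono card_lat_shell_le) auto
    finally show "(\<Sum>j\<in>{j \<in> F. lat_norm j = m}. h (lat_norm j)) \<le> S * (real m ^ (CARD('d) - 1) * h m)"
      by (simp add: mult.assoc)
  qed
  also have "\<dots> \<le> S * T"
    unfolding sum_distrib_left[symmetric] using tail by (intro mult_left_mono) (auto simp: S_def)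
  finally have F_le: "(\<Sum>j\<in>F. c j) \<le> S * T" .
  have "D = N \<union> F" "N \<inter> F = {}" by (auto simp: N_def F_def)
  then have "(\<Sum>j\<in>D. c j) = (\<Sum>j\<in>N. c j) + (\<Sum>j\<in>F. c j)"
    using fin by (simp add: sum.union_disjoint)
  then show ?thesis using N_le F_le by (simp add: S_def)
qed

section \<open>The error made by treating the field as independent\<close>

lemma norm_iexp_minus_1_le: "norm (iexp x - 1) \<le> \<bar>x\<bar>"
  using iexp_approx1[of x 0] by simp

context stationary_random_field
begin

text \<open>
  Every covariance produced by the decoupling has two bounds. The pointwise bound
  \<open>\<bar>iexp y - 1\<bar> \<le> \<bar>y\<bar>\<close> gives moments of pairs, good for near sites; mixing gives decay in the distance,
  good for far sites. The cutoff \<open>L\<close> between the two is left free.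
\<close>

lemma dependence_error_le:
  fixes g :: "real \<Rightarrow> real" and h :: "nat \<Rightarrow> real"
  assumes g [measurable]: "g \<in> borel_measurable borel" and gK: "\<And>y. \<bar>g y\<bar> \<le> K"
    and "finite \<Lambda>" "1 \<le> L" "0 \<le> u" and h: "\<And>m. 0 \<le> h m"
    and near: "\<And>j. j \<noteq> 0 \<Longrightarrow> lat_norm j < L \<Longrightarrow>
      real (card \<Lambda>) * (expectation (\<lambda>\<omega>. \<bar>g (X 0 \<omega>)\<bar> * \<bar>g (X j \<omega>)\<bar>) + (expectation (\<lambda>\<omega>. \<bar>g (X 0 \<omega>)\<bar>))\<^sup>2) \<le> u"
    and far: "\<And>m. L \<le> m \<Longrightarrow> real (card \<Lambda>) * (16 * alpha_1 M X \<infinity> m * K\<^sup>2) \<le> h m \<or>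
      real (card \<Lambda>) * (4 * rho_1 M X \<infinity> m * expectation (\<lambda>\<omega>. (g (X 0 \<omega>))\<^sup>2)) \<le> h m"
    and tail: "\<And>R. (\<Sum>m=L..<R. real m ^ (CARD('d) - 1) * h m) \<le> T"
  shows "norm (expectation (\<lambda>\<omega>. \<Prod>i\<in>\<Lambda>. iexp (g (X i \<omega>))) - (\<Prod>i\<in>\<Lambda>. expectation (\<lambda>\<omega>. iexp (g (X i \<omega>)))))
    \<le> (2 * real L) ^ CARD('d) * u + 2 * real CARD('d) * 3 ^ (CARD('d) - 1) * T"
proof (cases "\<Lambda> = {}")
  case True
  have "0 \<le> T" using tail[of L] by simp
  then show ?thesis using True \<open>0 \<le> u\<close> by (simp add: prob_space)
next
  case False
  define N where "N = real (card \<Lambda>)"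
  have "N > 0" using False \<open>finite \<Lambda>\<close> by (simp add: N_def card_gt_0_iff)
  define V where "V i \<omega> = iexp (g (X i \<omega>))" for i \<omega>
  define c where "c l = (if lat_norm l < L then u else h (lat_norm l)) / N" for l :: "int ^ 'd"
  have "0 \<le> K" using gK[of 0] by linarith
  have V [measurable]: "V i \<in> borel_measurable M" for i unfolding V_def by measurable
  have V1: "norm (V i \<omega>) \<le> 1" for i \<omega> by (simp add: V_def)
  have V_le: "norm (V i \<omega> - 1) \<le> \<bar>g (X i \<omega>)\<bar>" for i \<omega>
    unfolding V_def by (rule norm_iexp_minus_1_le)
  have V_K: "norm (V i \<omega> - 1) \<le> K" for i \<omega> using V_le gK order_trans by blast
  have c_nonneg: "0 \<le> c l" for l using \<open>0 \<le> u\<close> h \<open>N > 0\<close> by (simp add: c_def)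
  have g_int: "integrable M (\<lambda>\<omega>. \<bar>g (X i \<omega>)\<bar>)" for i
    using gK by (intro integrable_bounded[of _ K]) auto
  have gg_int: "integrable M (\<lambda>\<omega>. \<bar>g (X k \<omega>)\<bar> * \<bar>g (X j \<omega>)\<bar>)" for k j
    using gK \<open>0 \<le> K\<close> by (intro integrable_bounded[of _ "K * K"]) (auto simp: abs_mult intro!: mult_mono)
  have step: "norm (cov M (\<lambda>\<omega>. V k \<omega> - 1) (\<lambda>\<omega>. (\<Prod>i\<in>B. V i \<omega>) * (V j \<omega> - 1))) \<le> c (j - k)"
    if "finite B" "k \<notin> insert j B" and closest: "\<And>i. i \<in> B \<Longrightarrow> lat_norm (j - k) \<le> lat_norm (i - k)" for k j B
  proof -
    define P where "P \<omega> = (\<Prod>i\<in>B. V i \<omega>) * (V j \<omega> - 1)" for \<omega>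
    define W where "W \<omega> = V k \<omega> - 1" for \<omega>
    define m where "m = lat_norm (j - k)"
    have "j - k \<noteq> 0" using that by auto
    have P1: "norm (\<Prod>i\<in>B. V i \<omega>) \<le> 1" for \<omega> using V1 by (rule norm_prod_le_1)
    have P_le: "norm (P \<omega>) \<le> \<bar>g (X j \<omega>)\<bar>" for \<omega>
      unfolding P_def norm_mult using mult_mono[OF P1[of \<omega>] V_le[of j \<omega>]] by simp
    have W_le: "norm (W \<omega>) \<le> \<bar>g (X k \<omega>)\<bar>" for \<omega> unfolding W_def by (rule V_le)
    have P_K: "norm (P \<omega>) \<le> K" and W_K: "norm (W \<omega>) \<le> K" for \<omega>
      using P_le W_le gK order_trans by blast+
    have V_meas: "V i \<in> borel_measurable (field_sigma M X C)" if "i \<in> C" for i C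
      using measurable_field_sigma[OF that] unfolding V_def by measurable
    have W_meas: "W \<in> borel_measurable (field_sigma M X {k})"
      unfolding W_def using V_meas[of k "{k}"] by simp
    have P_meas: "P \<in> borel_measurable (field_sigma M X (insert j B))"
      unfolding P_def using V_meas[of _ "insert j B"]
      by (intro borel_measurable_times borel_measurable_prod borel_measurable_diff) auto
    have [measurable]: "W \<in> borel_measurable M" "P \<in> borel_measurable M"
      using W_meas P_meas subalgebra_field_sigma by (auto intro: measurable_from_subalg)
    have pair: "(k, insert j B) \<in> mixing_pairs \<infinity> m"
      using closest by (intro mixing_pairs_inftyI) (auto simp: m_def)
    show ?thesis
    proof (cases "m < L")
      case True
      have "norm (expectation (\<lambda>\<omega>. W \<omega> * P \<omega>)) \<le> expectation (\<lambda>\<omega>. norm (W \<omega> * P \<omega>))"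
        by (rule integral_norm_bound)
      also have "\<dots> \<le> expectation (\<lambda>\<omega>. \<bar>g (X k \<omega>)\<bar> * \<bar>g (X j \<omega>)\<bar>)"
      proof (rule integral_mono)
        show "integrable M (\<lambda>\<omega>. norm (W \<omega> * P \<omega>))"
          using P_K W_K \<open>0 \<le> K\<close> by (intro integrable_bounded[of _ "K * K"]) (auto simp: norm_mult intro!: mult_mono)
        show "norm (W \<omega> * P \<omega>) \<le> \<bar>g (X k \<omega>)\<bar> * \<bar>g (X j \<omega>)\<bar>" for \<omega>
          unfolding norm_mult using W_le P_le by (intro mult_mono) auto
      qed (rule gg_int)
      also have "\<dots> = expectation (\<lambda>\<omega>. \<bar>g (X 0 \<omega>)\<bar> * \<bar>g (X (j - k) \<omega>)\<bar>)"
        using pair_translation[of "\<lambda>(x, y). \<bar>g x\<bar> * \<bar>g y\<bar>" k j] by simp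
      finally have 1: "norm (expectation (\<lambda>\<omega>. W \<omega> * P \<omega>)) \<le> \<dots>" .
      have E: "norm (expectation Q) \<le> expectation (\<lambda>\<omega>. \<bar>g (X 0 \<omega>)\<bar>)"
        if [measurable]: "Q \<in> borel_measurable M" and Q: "\<And>\<omega>. norm (Q \<omega>) \<le> \<bar>g (X i \<omega>)\<bar>"
        for Q :: "'a \<Rightarrow> complex" and i
      proof -
        have "norm (expectation Q) \<le> expectation (\<lambda>\<omega>. norm (Q \<omega>))" by (rule integral_norm_bound)
        also have "\<dots> \<le> expectation (\<lambda>\<omega>. \<bar>g (X i \<omega>)\<bar>)"
        proof (rule integral_mono)
          have "norm (Q \<omega>) \<le> K" for \<omega> using Q gK order_trans by blast
          then show "integrable M (\<lambda>\<omega>. norm (Q \<omega>))" by (intro integrable_bounded[of _ K]) auto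
        qed (use Q g_int in auto)
        also have "\<dots> = expectation (\<lambda>\<omega>. \<bar>g (X 0 \<omega>)\<bar>)"
          using single_translation[of "\<lambda>y. \<bar>g y\<bar>" i] by simp
        finally show ?thesis .
      qed
      have "norm (cov M W P) \<le> norm (expectation (\<lambda>\<omega>. W \<omega> * P \<omega>)) + norm (expectation W) * norm (expectation P)"
        unfolding cov_def by (metis norm_triangle_ineq4 norm_mult)
      also have "\<dots> \<le> expectation (\<lambda>\<omega>. \<bar>g (X 0 \<omega>)\<bar> * \<bar>g (X (j - k) \<omega>)\<bar>) + (expectation (\<lambda>\<omega>. \<bar>g (X 0 \<omega>)\<bar>))\<^sup>2"
        unfolding power2_eq_square using 1 E[of W k] E[of P j] W_le P_le
        by (intro add_mono mult_mono) auto
      also have "\<dots> \<le> u / N"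
        using near[OF \<open>j - k \<noteq> 0\<close>] True \<open>N > 0\<close> by (simp add: m_def N_def field_simps)
      finally show ?thesis using True by (simp add: c_def m_def W_def[abs_def] P_def[abs_def])
    next
      case False
      then have "L \<le> m" by simp
      have "norm (cov M W P) \<le> h m / N"
        using far[OF \<open>L \<le> m\<close>]
      proof
        assume small: "real (card \<Lambda>) * (16 * alpha_1 M X \<infinity> m * K\<^sup>2) \<le> h m"
        have "norm (cov M W P) \<le>
            16 * alpha_coeff M (field_sigma M X {k}) (field_sigma M X (insert j B)) * K * K"
          by (rule complex_cov_le_alpha[OF subalgebra_field_sigma subalgebra_field_sigma W_meas W_K P_meas P_K])
        also have "\<dots> \<le> 16 * alpha_1 M X \<infinity> m * K * K"
          using alpha_coeff_le_alpha_1[OF pair] \<open>0 \<le> K\<close> by (intro mult_right_mono mult_left_mono) auto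
        also have "\<dots> \<le> h m / N"
          using small \<open>N > 0\<close> by (simp add: N_def field_simps power2_eq_square)
        finally show ?thesis .
      next
        assume small: "real (card \<Lambda>) * (4 * rho_1 M X \<infinity> m * expectation (\<lambda>\<omega>. (g (X 0 \<omega>))\<^sup>2)) \<le> h m"
        define r where "r = norm2 M (\<lambda>\<omega>. g (X 0 \<omega>))"
        have r2: "r * r = expectation (\<lambda>\<omega>. (g (X 0 \<omega>))\<^sup>2)"
          by (simp add: r_def norm2_def)
        have n2: "norm2 M (\<lambda>\<omega>. norm (Q \<omega>)) \<le> r"
          if [measurable]: "Q \<in> borel_measurable M" and Q: "\<And>\<omega>. norm (Q \<omega>) \<le> \<bar>g (X i \<omega>)\<bar>"
          for Q :: "'a \<Rightarrow> complex" and i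
        proof -
          have sq: "\<bar>g y\<bar>\<^sup>2 \<le> K\<^sup>2" for y using gK by (intro power_mono) auto
          have Qsq: "(norm (Q \<omega>))\<^sup>2 \<le> (g (X i \<omega>))\<^sup>2" for \<omega>
            using Q[of \<omega>] by (metis abs_norm_cancel abs_le_square_iff)
          have "expectation (\<lambda>\<omega>. (norm (Q \<omega>))\<^sup>2) \<le> expectation (\<lambda>\<omega>. (g (X i \<omega>))\<^sup>2)"
          proof (rule integral_mono)
            show "integrable M (\<lambda>\<omega>. (g (X i \<omega>))\<^sup>2)"
              using sq by (intro integrable_bounded[of _ "K\<^sup>2"]) auto
            show "integrable M (\<lambda>\<omega>. (norm (Q \<omega>))\<^sup>2)"
              using order_trans[OF Qsq] sq by (intro integrable_bounded[of _ "K\<^sup>2"]) auto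
          qed (rule Qsq)
          also have "\<dots> = expectation (\<lambda>\<omega>. (g (X 0 \<omega>))\<^sup>2)"
            using single_translation[of "\<lambda>y. (g y)\<^sup>2" i] by simp
          finally show ?thesis by (simp add: r_def norm2_def)
        qed
        have "norm (cov M W P) \<le> 4 * rho_coeff M (field_sigma M X {k}) (field_sigma M X (insert j B)) *
            norm2 M (\<lambda>\<omega>. norm (W \<omega>)) * norm2 M (\<lambda>\<omega>. norm (P \<omega>))"
          by (rule complex_cov_le_rho[OF subalgebra_field_sigma subalgebra_field_sigma W_meas W_K P_meas P_K rho_coeff_nonneg])
        also have "\<dots> \<le> 4 * rho_1 M X \<infinity> m * r * r"
          using rho_coeff_le_rho_1[OF pair] rho_coeff_nonneg n2[of W k] n2[of P j] W_le P_le rho_1_nonneg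
          by (intro mult_mono mult_nonneg_nonneg) (auto simp: norm2_def r_def)
        also have "4 * rho_1 M X \<infinity> m * r * r = 4 * rho_1 M X \<infinity> m * expectation (\<lambda>\<omega>. (g (X 0 \<omega>))\<^sup>2)"
          by (simp add: r2[symmetric])
        also have "\<dots> \<le> h m / N"
          using small \<open>N > 0\<close> by (simp add: N_def field_simps)
        finally show ?thesis .
      qed
      then show ?thesis using False by (simp add: c_def m_def W_def[abs_def] P_def[abs_def])
    qed
  qed
  \<comment> \<open>Since \<open>c\<close> depends on the difference of the two sites only, the double sum is bounded by a sum over differences; the factor \<open>N\<close> for the choice of \<open>k\<close> cancels the one in \<open>c\<close>.\<close>
  define D where "D = (\<lambda>(k, j). j - k) ` (\<Lambda> \<times> \<Lambda>) - {0}"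
  have "finite D" unfolding D_def using \<open>finite \<Lambda>\<close> by auto
  have "norm (expectation (\<lambda>\<omega>. \<Prod>i\<in>\<Lambda>. V i \<omega>) - (\<Prod>i\<in>\<Lambda>. expectation (V i)))
      \<le> (\<Sum>k\<in>\<Lambda>. \<Sum>j\<in>\<Lambda> - {k}. c (j - k))"
    by (rule expectation_product_decoupling[where d = "\<lambda>k i. lat_norm (i - k)"])
      (use V V1 \<open>finite \<Lambda>\<close> c_nonneg step in auto)
  also have "\<dots> \<le> (\<Sum>k\<in>\<Lambda>. \<Sum>l\<in>D. c l)"
  proof (rule sum_mono)
    fix k assume "k \<in> \<Lambda>"
    have "(\<Sum>j\<in>\<Lambda> - {k}. c (j - k)) = (\<Sum>l\<in>(\<lambda>j. j - k) ` (\<Lambda> - {k}). c l)"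
      by (simp add: sum.reindex inj_on_def)
    also have "\<dots> \<le> (\<Sum>l\<in>D. c l)"
      using \<open>k \<in> \<Lambda>\<close> \<open>finite D\<close> c_nonneg by (intro sum_mono2) (auto simp: D_def)
    finally show "(\<Sum>j\<in>\<Lambda> - {k}. c (j - k)) \<le> (\<Sum>l\<in>D. c l)" .
  qed
  also have "\<dots> = (\<Sum>l\<in>D. N * c l)" by (simp add: N_def sum_distrib_left)
  also have "\<dots> \<le> (2 * real L) ^ CARD('d) * u + 2 * real CARD('d) * 3 ^ (CARD('d) - 1) * T"
    using \<open>N > 0\<close> by (intro lattice_sum_le[OF \<open>finite D\<close> \<open>1 \<le> L\<close> \<open>0 \<le> u\<close> h _ _ tail]) (auto simp: c_def)
  finally show ?thesis unfolding V_def .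
qed

end


section \<open>Central limit theorem for rescaled functionals of a mixing field\<close>

lemma small_tail_sums:
  fixes a :: "nat \<Rightarrow> real"
  assumes "summable (\<lambda>m. a (Suc m))" "\<epsilon> > 0"
  obtains L where "1 \<le> L" "\<And>m R. L \<le> m \<Longrightarrow> (\<Sum>i=m..<R. a i) \<le> \<epsilon>"
proof -
  have "summable a" using assms(1) by (simp add: summable_Suc_iff)
  then obtain L where L: "\<And>m R. L \<le> m \<Longrightarrow> norm (\<Sum>i=m..<R. a i) < \<epsilon>"
    unfolding summable_Cauchy using \<open>\<epsilon> > 0\<close> by blast
  have "(\<Sum>i=m..<R. a i) \<le> \<epsilon>" if "Suc L \<le> m" for m R
    using L[of m R] that by simp
  then show ?thesis by (intro that[of "Suc L"]) auto
qed

lemma exp_minus_bounds: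
  fixes x :: real
  assumes "0 \<le> x"
  shows "\<bar>exp (- x) - (1 - x)\<bar> \<le> x\<^sup>2"
proof -
  have "1 - x \<le> exp (- x)" using exp_ge_add_one_self[of "- x"] by simp
  moreover have "exp (- x) \<le> 1 - x + x\<^sup>2"
  proof -
    have "exp (- x) * (1 + x) \<le> exp (- x) * exp x"
      by (intro mult_left_mono exp_ge_add_one_self_aux) (use assms in auto)
    also have "\<dots> = 1" by (simp add: exp_minus)
    also have "1 \<le> (1 - x + x\<^sup>2) * (1 + x)"
      using assms by (simp add: algebra_simps power2_eq_square)
    finally show ?thesis using assms by (simp add: mult_le_cancel_right)
  qed
  ultimately show ?thesis by (simp add: abs_if)
qed

text \<open>
  The classical argument for independent summands: a second order Taylor expansion shows that
  the characteristic function and \<open>exp (- w / (2 n))\<close> differ by a small multiple of \<open>1 / n\<close> when \<open>K\<close> is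
  small, and both have modulus at most 1, so their \<open>n\<close>-th powers stay close. The crude constants suffice.
\<close>

lemma (in prob_space) power_char_near_gaussian:
  fixes Y :: "'a \<Rightarrow> real"
  assumes [measurable]: "Y \<in> borel_measurable M" and Y: "\<And>\<omega>. \<bar>Y \<omega>\<bar> \<le> K"
    and "expectation Y = 0" and var: "expectation (\<lambda>\<omega>. (Y \<omega>)\<^sup>2) = w / real n" and "0 < n"
  shows "norm ((expectation (\<lambda>\<omega>. iexp (Y \<omega>))) ^ n - of_real (exp (- w / 2))) \<le> K * w + w\<^sup>2 / real n"
proof -
  define \<psi> where "\<psi> = expectation (\<lambda>\<omega>. iexp (Y \<omega>))"
  define z where "z = w / (2 * real n)"
  have "0 \<le> K" using Y order_trans abs_ge_zero by blast
  have int: "integrable M (\<lambda>\<omega>. iexp (Y \<omega>))" "integrable M Y"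
    by (rule integrable_bounded[of _ 1] integrable_bounded[of _ K]; use Y in simp)+
  have "\<bar>Y \<omega>\<bar>\<^sup>2 \<le> K\<^sup>2" for \<omega> using Y by (intro power_mono) auto
  then have int2: "integrable M (\<lambda>\<omega>. (Y \<omega>)\<^sup>2)" by (intro integrable_bounded[of _ "K\<^sup>2"]) auto
  have int_complex: "integrable M (\<lambda>\<omega>. complex_of_real ((Y \<omega>)\<^sup>2 / 2))" "integrable M (\<lambda>\<omega>. \<i> * complex_of_real (Y \<omega>))"
    by (rule integrable_of_real, use int2 in simp) (use int(2) in simp)
  have "0 \<le> w"
  proof -
    have "0 \<le> expectation (\<lambda>\<omega>. (Y \<omega>)\<^sup>2)" by simp
    then show ?thesis using var \<open>0 < n\<close> by (simp add: zero_le_divide_iff)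
  qed
  have taylor: "norm (iexp y - (1 + \<i> * of_real y - of_real (y\<^sup>2 / 2))) \<le> K * y\<^sup>2" if "\<bar>y\<bar> \<le> K" for y
  proof -
    have "norm (iexp y - (1 + \<i> * of_real y - of_real (y\<^sup>2 / 2))) \<le> \<bar>y\<bar> ^ 3 / 6"
      using iexp_approx1[of y 2] by (simp add: numeral_eq_Suc power2_eq_square algebra_simps)
    also have "\<dots> \<le> \<bar>y\<bar> ^ 3" by simp
    also have "\<dots> = \<bar>y\<bar> * y\<^sup>2" by (simp add: power3_eq_cube power2_eq_square)
    also have "\<dots> \<le> K * y\<^sup>2" using that by (intro mult_right_mono) auto
    finally show ?thesis .
  qed
  have "\<psi> - of_real (1 - z) = expectation (\<lambda>\<omega>. iexp (Y \<omega>) - (1 + \<i> * of_real (Y \<omega>) - of_real ((Y \<omega>)\<^sup>2 / 2)))"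
  proof -
    have "expectation (\<lambda>\<omega>. complex_of_real ((Y \<omega>)\<^sup>2 / 2)) = of_real z"
      unfolding integral_complex_of_real using var \<open>0 < n\<close> by (simp add: z_def)
    moreover have "expectation (\<lambda>\<omega>. \<i> * complex_of_real (Y \<omega>)) = 0"
      using assms(3) by (simp add: integral_complex_of_real)
    ultimately show ?thesis
      using int(1) int_complex by (simp add: \<psi>_def prob_space del: of_real_power of_real_divide)
  qed
  then have "norm (\<psi> - of_real (1 - z)) \<le>
      expectation (\<lambda>\<omega>. norm (iexp (Y \<omega>) - (1 + \<i> * of_real (Y \<omega>) - of_real ((Y \<omega>)\<^sup>2 / 2))))"
    by (simp only: integral_norm_bound)
  also have "\<dots> \<le> expectation (\<lambda>\<omega>. K * (Y \<omega>)\<^sup>2)"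
  proof (rule integral_mono)
    show "integrable M (\<lambda>\<omega>. norm (iexp (Y \<omega>) - (1 + \<i> * of_real (Y \<omega>) - of_real ((Y \<omega>)\<^sup>2 / 2))))"
      by (intro integrable_norm Bochner_Integration.integrable_diff Bochner_Integration.integrable_add
          int(1) int_complex integrable_const)
  qed (use int2 taylor Y in auto)
  also have "\<dots> = K * w / real n" using var by simp
  finally have 1: "norm (\<psi> - of_real (1 - z)) \<le> K * w / real n" .
  have 2: "norm (of_real (exp (- z)) - (of_real (1 - z) :: complex)) \<le> z\<^sup>2"
    using exp_minus_bounds[of z] \<open>0 \<le> w\<close>
    by (simp only: of_real_diff[symmetric] norm_of_real z_def) simp
  have "norm (\<psi> - of_real (exp (- z))) \<le> norm (\<psi> - of_real (1 - z)) + norm (of_real (exp (- z)) - (of_real (1 - z) :: complex))"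
    using norm_triangle_ineq4[of "\<psi> - of_real (1 - z)" "of_real (exp (- z)) - of_real (1 - z)"] by simp
  then have diff: "norm (\<psi> - of_real (exp (- z))) \<le> K * w / real n + z\<^sup>2"
    using 1 2 by linarith
  have \<psi>1: "norm \<psi> \<le> 1"
  proof -
    have "norm \<psi> \<le> expectation (\<lambda>\<omega>. norm (iexp (Y \<omega>)))" unfolding \<psi>_def by (rule integral_norm_bound)
    then show ?thesis by (simp add: prob_space)
  qed
  have "of_real (exp (- w / 2)) = (of_real (exp (- z)) :: complex) ^ n"
    using \<open>0 < n\<close> by (simp add: z_def exp_of_nat_mult[symmetric] flip: of_real_power)
  then have "norm (\<psi> ^ n - of_real (exp (- w / 2))) = norm (\<psi> ^ n - (of_real (exp (- z))) ^ n)" by simp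
  also have "\<dots> \<le> real n * norm (\<psi> - of_real (exp (- z)))"
    using \<psi>1 \<open>0 \<le> w\<close> by (intro norm_power_diff) (auto simp: z_def)
  also have "\<dots> \<le> real n * (K * w / real n + z\<^sup>2)" using diff by (intro mult_left_mono) auto
  also have "\<dots> = K * w + w\<^sup>2 / (4 * real n)"
    using \<open>0 < n\<close> by (simp add: z_def field_simps power2_eq_square)
  also have "\<dots> \<le> K * w + w\<^sup>2 / real n"
    using \<open>0 < n\<close> by (intro add_left_mono divide_left_mono) auto
  finally show ?thesis unfolding \<psi>_def .
qed


text \<open>
  A triangular array \<open>G n (X i)\<close>, \<open>i \<in> \<Lambda> n\<close>, with the size of an indicator of a set of probability
  of order \<open>b n\<close>: values of order 1, first and second moments of order \<open>b n\<close>. The sum over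
  \<open>\<Lambda> n\<close> then has to be divided by the square root of \<open>card (\<Lambda> n) * b n\<close>.
\<close>

locale rescaled_array = stationary_random_field M X
  for M :: "'a measure" and X :: "int ^ 'd \<Rightarrow> 'a \<Rightarrow> real" +
  fixes G :: "nat \<Rightarrow> real \<Rightarrow> real" and \<Lambda> :: "nat \<Rightarrow> (int ^ 'd) set" and b :: "nat \<Rightarrow> real"
    and C v :: real
  assumes G_measurable [measurable]: "G n \<in> borel_measurable borel"
    and C_nonneg: "0 \<le> C"
    and \<Lambda>_finite: "\<forall>\<^sub>F n in sequentially. finite (\<Lambda> n)"
    and b_pos: "\<forall>\<^sub>F n in sequentially. 0 < b n"
    and card_lim: "filterlim (\<lambda>n. real (card (\<Lambda> n))) at_top sequentially"
    and b_lim: "b \<longlonglongrightarrow> 0"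
    and card_b_lim: "filterlim (\<lambda>n. real (card (\<Lambda> n)) * b n) at_top sequentially"
    and G_bounded: "\<forall>\<^sub>F n in sequentially. \<forall>y. \<bar>G n y\<bar> \<le> C"
    and G_L1: "\<forall>\<^sub>F n in sequentially. expectation (\<lambda>\<omega>. \<bar>G n (X 0 \<omega>)\<bar>) \<le> C * b n"
    and G_L2: "(\<lambda>n. expectation (\<lambda>\<omega>. (G n (X 0 \<omega>))\<^sup>2) / b n) \<longlonglongrightarrow> v"
begin

abbreviation pair_moment :: "nat \<Rightarrow> int ^ 'd \<Rightarrow> real" where
  "pair_moment n j \<equiv> expectation (\<lambda>\<omega>. \<bar>G n (X 0 \<omega>)\<bar> * \<bar>G n (X j \<omega>)\<bar>)"

abbreviation abs_moment :: "nat \<Rightarrow> real" where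
  "abs_moment n \<equiv> expectation (\<lambda>\<omega>. \<bar>G n (X 0 \<omega>)\<bar>)"

abbreviation square_moment :: "nat \<Rightarrow> real" where
  "square_moment n \<equiv> expectation (\<lambda>\<omega>. (G n (X 0 \<omega>))\<^sup>2)"

definition scaled :: "nat \<Rightarrow> real \<Rightarrow> real" where
  "scaled n y = G n y / sqrt (real (card (\<Lambda> n)) * b n)"

definition dependence_error :: "nat \<Rightarrow> complex" where
  "dependence_error n = expectation (\<lambda>\<omega>. \<Prod>i\<in>\<Lambda> n. iexp (scaled n (X i \<omega>))) -
     (\<Prod>i\<in>\<Lambda> n. expectation (\<lambda>\<omega>. iexp (scaled n (X i \<omega>))))"

lemma scaled_measurable [measurable]: "scaled n \<in> borel_measurable borel"
  unfolding scaled_def by measurable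

lemma card_pos: "\<forall>\<^sub>F n in sequentially. 0 < real (card (\<Lambda> n))"
  using card_lim unfolding filterlim_at_top_dense by (rule spec)

lemma scaled_moments:
  assumes "0 < real (card (\<Lambda> n))" "0 < b n"
  shows "real (card (\<Lambda> n)) * (expectation (\<lambda>\<omega>. \<bar>scaled n (X 0 \<omega>)\<bar> * \<bar>scaled n (X j \<omega>)\<bar>)
       + (expectation (\<lambda>\<omega>. \<bar>scaled n (X 0 \<omega>)\<bar>))\<^sup>2) =
     (pair_moment n j + (abs_moment n)\<^sup>2) / b n"
    and "real (card (\<Lambda> n)) * expectation (\<lambda>\<omega>. (scaled n (X 0 \<omega>))\<^sup>2) = square_moment n / b n"
proof -
  define N where "N = real (card (\<Lambda> n))"
  define s where "s = sqrt (N * b n)"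
  have "0 < N * b n" using assms by (simp add: N_def)
  then have s: "0 < s" "s * s = N * b n" by (simp_all add: s_def)
  have sc: "scaled n y = G n y / s" for y by (simp add: scaled_def s_def N_def)
  have "expectation (\<lambda>\<omega>. \<bar>scaled n (X 0 \<omega>)\<bar> * \<bar>scaled n (X j \<omega>)\<bar>) =
      pair_moment n j / (s * s)"
    using s(1) by (simp add: sc abs_divide)
  moreover have "(expectation (\<lambda>\<omega>. \<bar>scaled n (X 0 \<omega>)\<bar>))\<^sup>2 = (abs_moment n)\<^sup>2 / (s * s)"
    using s(1) by (simp add: sc abs_divide power2_eq_square)
  moreover have "expectation (\<lambda>\<omega>. (scaled n (X 0 \<omega>))\<^sup>2) = square_moment n / (s * s)"
    by (simp add: sc power_divide power2_eq_square)
  ultimately show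
    "real (card (\<Lambda> n)) * (expectation (\<lambda>\<omega>. \<bar>scaled n (X 0 \<omega>)\<bar> * \<bar>scaled n (X j \<omega>)\<bar>)
       + (expectation (\<lambda>\<omega>. \<bar>scaled n (X 0 \<omega>)\<bar>))\<^sup>2) =
     (pair_moment n j + (abs_moment n)\<^sup>2) / b n"
    "real (card (\<Lambda> n)) * expectation (\<lambda>\<omega>. (scaled n (X 0 \<omega>))\<^sup>2) = square_moment n / b n"
    using assms unfolding s(2) N_def[symmetric] by (simp_all add: field_simps)
qed

lemma square_L1_le:
  assumes "0 < b n" "abs_moment n \<le> C * b n"
  shows "(abs_moment n)\<^sup>2 \<le> C\<^sup>2 * (b n)\<^sup>2"
  unfolding power_mult_distrib[symmetric] using assms(2) by (intro power_mono) auto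

lemma scaled_bounded:
  assumes "\<forall>y. \<bar>G n y\<bar> \<le> C" "0 < real (card (\<Lambda> n))" "0 < b n"
  shows "\<bar>scaled n y\<bar> \<le> C / sqrt (real (card (\<Lambda> n)) * b n)"
  using assms by (auto simp: scaled_def abs_divide intro!: divide_right_mono)

text \<open>
  Up to constants, the error is the sum over \<open>j\<close> of the minimum of \<open>b n\<close> and \<open>alpha(\<bar>j\<bar>) / b n\<close>. Cutting at
  a radius \<open>m\<close> with \<open>m^d * b n\<close> comparable to a small constant \<open>\<delta>\<close>, the near sites contribute
  a multiple of \<open>\<delta>\<close>. For the far sites \<open>1 / b n \<le> k^d / \<delta>\<close> turns the weight \<open>k^(d-1)\<close> of a
  shell into \<open>k^(2d-1) / \<delta>\<close>, and since \<open>m \<longlonglongrightarrow> \<infinity>\<close> only a tail of the summable series remains. This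
  is where the exponent \<open>2d - 1\<close> comes from.
\<close>

lemma dependence_error_strong_mixing:
  assumes joint: "\<forall>\<^sub>F n in sequentially. \<forall>j. j \<noteq> 0 \<longrightarrow>
      pair_moment n j \<le> B * (b n)\<^sup>2"
    and "0 \<le> B"
    and summable: "summable (\<lambda>m. real (Suc m) ^ (2 * CARD('d) - 1) * alpha_1 M X \<infinity> (Suc m))"
  shows "dependence_error \<longlonglongrightarrow> 0"
proof (rule tendsto_norm_zero_cancel, rule tendstoI)
  fix \<epsilon> :: real assume "0 < \<epsilon>"
  define d where "d = CARD('d)"
  have "0 < d" by (simp add: d_def)
  define S where "S = 2 * real d * 3 ^ (d - 1)"
  define A where "A = B + C\<^sup>2 + 1"
  \<comment> \<open>The near part will be at most \<open>4^d * A * \<delta>\<close> and the far part \<open>16 * S * C\<^sup>2 * \<tau> / \<delta>\<close>; the constants give each the share \<open>\<epsilon> / 4\<close>.\<close>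
  define \<delta> where "\<delta> = \<epsilon> / (4 * 4 ^ d * A)"
  define Q where "Q = C\<^sup>2 + 1"
  define \<tau> where "\<tau> = \<epsilon> * \<delta> / (64 * S * Q)"
  have "0 < A" using \<open>0 \<le> B\<close> by (auto simp: A_def intro!: add_nonneg_pos)
  have "0 < S" using \<open>0 < d\<close> by (simp add: S_def)
  have "0 < \<delta>" using \<open>0 < \<epsilon>\<close> \<open>0 < A\<close> by (simp add: \<delta>_def)
  have "0 < Q" "C\<^sup>2 \<le> Q" by (auto simp: Q_def intro!: add_nonneg_pos)
  have "0 < \<tau>" using \<open>0 < \<epsilon>\<close> \<open>0 < \<delta>\<close> \<open>0 < S\<close> \<open>0 < Q\<close> by (simp add: \<tau>_def)
  obtain L where "1 \<le> L"
    and L: "\<And>m R. L \<le> m \<Longrightarrow> (\<Sum>i=m..<R. real i ^ (2 * d - 1) * alpha_1 M X \<infinity> i) \<le> \<tau>"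
    using small_tail_sums[of "\<lambda>m. real m ^ (2 * d - 1) * alpha_1 M X \<infinity> m" \<tau>] summable \<open>0 < \<tau>\<close>
    unfolding d_def by metis
  have "0 < \<delta> / real L ^ d" using \<open>0 < \<delta>\<close> \<open>1 \<le> L\<close> by simp
  then have "\<forall>\<^sub>F n in sequentially. b n < \<delta> / real L ^ d"
    by (rule order_tendstoD(2)[OF b_lim])
  with joint \<Lambda>_finite b_pos card_pos G_bounded G_L1
  show "\<forall>\<^sub>F n in sequentially. dist (norm (dependence_error n)) 0 < \<epsilon>"
  proof eventually_elim
    case (elim n)
    define \<beta> where "\<beta> = b n"
    define N where "N = real (card (\<Lambda> n))"
    have \<beta>: "0 < \<beta>" "\<beta> < \<delta> / real L ^ d" and "0 < N" using elim by (auto simp: \<beta>_def N_def)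
    \<comment> \<open>Minimality gives the reverse bound \<open>m^d * b n \<le> 2^d * \<delta>\<close>, because \<open>m \<le> 2 (m - 1)\<close> once \<open>m > 1\<close>.\<close>
    define m where "m = (LEAST m. \<delta> \<le> real m ^ d * \<beta>)"
    have "\<exists>m. \<delta> \<le> real m ^ d * \<beta>"
    proof -
      obtain m :: nat where m: "\<delta> / \<beta> + 1 < real m" using reals_Archimedean2 by blast
      then have "1 \<le> real m" using \<beta>(1) \<open>0 < \<delta>\<close> by (smt (verit) divide_pos_pos)
      then have "\<delta> / \<beta> \<le> real m ^ d"
        using m self_le_power[of "real m" d] \<open>0 < d\<close> by linarith
      then show ?thesis using \<beta>(1) by (auto simp: field_simps)
    qed
    then have m_ge: "\<delta> \<le> real m ^ d * \<beta>" unfolding m_def by (rule LeastI_ex)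
    have m_min: "real k ^ d * \<beta> < \<delta>" if "k < m" for k
      using not_less_Least[of k "\<lambda>m. \<delta> \<le> real m ^ d * \<beta>"] that unfolding m_def by (simp add: not_le)
    have "L < m"
    proof (rule ccontr)
      assume "\<not> L < m"
      then have "real m ^ d * \<beta> \<le> real L ^ d * \<beta>"
        using \<beta>(1) by (intro mult_right_mono power_mono) auto
      also have "\<dots> < \<delta>" using \<beta>(2) \<open>1 \<le> L\<close> by (simp add: field_simps)
      finally show False using m_ge by simp
    qed
    have "real m ^ d * \<beta> \<le> (2 * real (m - 1)) ^ d * \<beta>"
      using \<beta>(1) \<open>L < m\<close> \<open>1 \<le> L\<close> by (intro mult_right_mono power_mono) auto
    also have "\<dots> = 2 ^ d * (real (m - 1) ^ d * \<beta>)"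
      by (simp only: power_mult_distrib mult.assoc)
    also have "\<dots> \<le> 2 ^ d * \<delta>"
      using m_min[of "m - 1"] \<open>L < m\<close> by (intro mult_left_mono less_imp_le) auto
    finally have m_le: "real m ^ d * \<beta> \<le> 2 ^ d * \<delta>" .
    define h where "h k = 16 * alpha_1 M X \<infinity> k * C\<^sup>2 / \<beta>" for k
    have h_nonneg: "0 \<le> h k" for k using alpha_1_nonneg \<beta>(1) by (simp add: h_def)
    have tail: "(\<Sum>k=m..<R. real k ^ (d - 1) * h k) \<le> 16 * C\<^sup>2 * \<tau> / \<delta>" for R
    proof -
      have "real k ^ (d - 1) * h k \<le> (16 * C\<^sup>2 / \<delta>) * (real k ^ (2 * d - 1) * alpha_1 M X \<infinity> k)" if "m \<le> k" for k
      proof -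
        have "real m ^ d * \<beta> \<le> real k ^ d * \<beta>"
          using that \<beta>(1) by (intro mult_right_mono power_mono) auto
        with m_ge have "\<delta> \<le> real k ^ d * \<beta>" by (rule order_trans)
        then have "1 / \<beta> \<le> real k ^ d / \<delta>" using \<beta>(1) \<open>0 < \<delta>\<close> by (simp add: field_simps)
        then have "(real k ^ (d - 1) * (16 * alpha_1 M X \<infinity> k * C\<^sup>2)) * (1 / \<beta>) \<le>
            (real k ^ (d - 1) * (16 * alpha_1 M X \<infinity> k * C\<^sup>2)) * (real k ^ d / \<delta>)"
          using alpha_1_nonneg by (intro mult_left_mono) auto
        also have "real k ^ (2 * d - 1) = real k ^ (d - 1) * real k ^ d"
          using \<open>0 < d\<close> by (simp add: power_add[symmetric] mult_2)
        ultimately show ?thesis by (simp add: h_def mult_ac)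
      qed
      then have "(\<Sum>k=m..<R. real k ^ (d - 1) * h k) \<le>
          (\<Sum>k=m..<R. (16 * C\<^sup>2 / \<delta>) * (real k ^ (2 * d - 1) * alpha_1 M X \<infinity> k))"
        by (intro sum_mono) auto
      also have "\<dots> = (16 * C\<^sup>2 / \<delta>) * (\<Sum>k=m..<R. real k ^ (2 * d - 1) * alpha_1 M X \<infinity> k)"
        by (rule sum_distrib_left[symmetric])
      also have "\<dots> \<le> (16 * C\<^sup>2 / \<delta>) * \<tau>"
        using L[of m R] \<open>L < m\<close> \<open>0 < \<delta>\<close> by (intro mult_left_mono) auto
      finally show ?thesis by simp
    qed
    have "norm (dependence_error n) \<le> (2 * real m) ^ d * (A * \<beta>) + S * (16 * C\<^sup>2 * \<tau> / \<delta>)"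
      unfolding dependence_error_def S_def d_def
    proof (rule dependence_error_le[where K = "C / sqrt (N * \<beta>)" and h = h])
      show "\<bar>scaled n y\<bar> \<le> C / sqrt (N * \<beta>)" for y
        unfolding N_def \<beta>_def using elim by (intro scaled_bounded) auto
      show "real (card (\<Lambda> n)) * (expectation (\<lambda>\<omega>. \<bar>scaled n (X 0 \<omega>)\<bar> * \<bar>scaled n (X j \<omega>)\<bar>)
          + (expectation (\<lambda>\<omega>. \<bar>scaled n (X 0 \<omega>)\<bar>))\<^sup>2) \<le> A * \<beta>" if "j \<noteq> 0" for j
      proof -
        have "pair_moment n j + (abs_moment n)\<^sup>2
            \<le> B * \<beta>\<^sup>2 + C\<^sup>2 * \<beta>\<^sup>2"
          unfolding \<beta>_def using elim that square_L1_le by (intro add_mono) auto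
        also have "\<dots> \<le> (A * \<beta>) * \<beta>" by (simp add: A_def algebra_simps power2_eq_square)
        finally show ?thesis
          using elim \<beta>(1) by (subst scaled_moments) (auto simp: \<beta>_def divide_le_eq)
      qed
      show "real (card (\<Lambda> n)) * (16 * alpha_1 M X \<infinity> k * (C / sqrt (N * \<beta>))\<^sup>2) \<le> h k \<or>
          real (card (\<Lambda> n)) * (4 * rho_1 M X \<infinity> k * expectation (\<lambda>\<omega>. (scaled n (X 0 \<omega>))\<^sup>2)) \<le> h k" for k
      proof (rule disjI1)
        have "N * (16 * alpha_1 M X \<infinity> k * (C / sqrt (N * \<beta>))\<^sup>2) = h k"
          using \<open>0 < N\<close> \<beta>(1) by (simp add: h_def power_divide field_simps)
        then show "real (card (\<Lambda> n)) * (16 * alpha_1 M X \<infinity> k * (C / sqrt (N * \<beta>))\<^sup>2) \<le> h k"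
          by (simp add: N_def)
      qed
    qed (use elim \<open>0 < A\<close> \<beta>(1) \<open>L < m\<close> h_nonneg tail in \<open>auto simp: d_def\<close>)
    also have "(2 * real m) ^ d * (A * \<beta>) \<le> \<epsilon> / 4"
    proof -
      have "(2 * real m) ^ d * (A * \<beta>) = (2 ^ d * A) * (real m ^ d * \<beta>)"
        by (simp add: power_mult_distrib mult_ac)
      also have "\<dots> \<le> (2 ^ d * A) * (2 ^ d * \<delta>)"
        using m_le \<open>0 < A\<close> by (intro mult_left_mono) auto
      also have "\<dots> = 4 ^ d * A * \<delta>"
        by (simp add: power_mult_distrib[symmetric] mult_ac flip: mult.assoc)
      also have "\<dots> = \<epsilon> / 4" using \<open>0 < A\<close> by (simp add: \<delta>_def)
      finally show ?thesis .
    qed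
    also have "S * (16 * C\<^sup>2 * \<tau> / \<delta>) \<le> \<epsilon> / 4"
    proof -
      have "S * (16 * C\<^sup>2 * \<tau> / \<delta>) \<le> S * (16 * Q * \<tau> / \<delta>)"
        using \<open>0 < S\<close> \<open>0 < \<tau>\<close> \<open>0 < \<delta>\<close> \<open>C\<^sup>2 \<le> Q\<close> by (intro mult_left_mono divide_right_mono mult_right_mono) auto
      also have "\<dots> = \<epsilon> / 4"
        using \<open>0 < S\<close> \<open>0 < \<delta>\<close> \<open>0 < Q\<close> by (simp add: \<tau>_def)
      finally show ?thesis .
    qed
    finally show ?case using \<open>0 < \<epsilon>\<close> by simp
  qed
qed

text \<open>
  The bound by the maximal correlation involves second moments instead of suprema, so it is
  \<open>rho(\<bar>j\<bar>)\<close> up to constants, without the factor \<open>1 / b n\<close>. A cutoff that does not depend on \<open>n\<close>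
  is then enough: finitely many near sites, each with a contribution that tends to 0.
\<close>

lemma dependence_error_correlation_mixing:
  assumes joint: "\<And>j. j \<noteq> 0 \<Longrightarrow> (\<lambda>n. pair_moment n j / b n) \<longlonglongrightarrow> 0"
    and summable: "summable (\<lambda>m. real (Suc m) ^ (CARD('d) - 1) * rho_1 M X \<infinity> (Suc m))"
  shows "dependence_error \<longlonglongrightarrow> 0"
proof (rule tendsto_norm_zero_cancel, rule tendstoI)
  fix \<epsilon> :: real assume "0 < \<epsilon>"
  define d where "d = CARD('d)"
  have "0 < d" by (simp add: d_def)
  define S where "S = 2 * real d * 3 ^ (d - 1)"
  have "0 < S" using \<open>0 < d\<close> by (simp add: S_def)
  define W where "W = \<bar>v\<bar> + 1"
  have "0 < W" by (simp add: W_def)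
  \<comment> \<open>The far sites contribute at most \<open>4 * S * W * \<tau>\<close>, and \<open>W\<close> eventually bounds the second moments divided by \<open>b n\<close>.\<close>
  define \<tau> where "\<tau> = \<epsilon> / (16 * S * W)"
  have "0 < \<tau>" using \<open>0 < \<epsilon>\<close> \<open>0 < S\<close> \<open>0 < W\<close> by (simp add: \<tau>_def)
  obtain L where "1 \<le> L"
    and L: "\<And>m R. L \<le> m \<Longrightarrow> (\<Sum>i=m..<R. real i ^ (d - 1) * rho_1 M X \<infinity> i) \<le> \<tau>"
    using small_tail_sums[of "\<lambda>m. real m ^ (d - 1) * rho_1 M X \<infinity> m" \<tau>] summable \<open>0 < \<tau>\<close>
    unfolding d_def by metis
  define u where "u = \<epsilon> / (8 * (2 * real L) ^ d)"
  have "0 < u" using \<open>0 < \<epsilon>\<close> \<open>1 \<le> L\<close> by (simp add: u_def)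
  define Box where "Box = {j :: int ^ 'd. lat_norm j \<le> L} - {0}"
  have "finite Box" unfolding Box_def using finite_lat_box by simp
  have "\<forall>\<^sub>F n in sequentially. \<forall>j\<in>Box. pair_moment n j / b n < u"
    using joint \<open>0 < u\<close> by (intro eventually_ball_finite[OF \<open>finite Box\<close>] ballI order_tendstoD(2)) (auto simp: Box_def)
  moreover have "(\<lambda>n. C\<^sup>2 * b n) \<longlonglongrightarrow> 0" using tendsto_mult_right_zero[OF b_lim] .
  then have "\<forall>\<^sub>F n in sequentially. C\<^sup>2 * b n < u" using \<open>0 < u\<close> by (rule order_tendstoD(2))
  moreover have "\<forall>\<^sub>F n in sequentially. square_moment n / b n < W"
    by (rule order_tendstoD(2)[OF G_L2]) (simp add: W_def)
  ultimately show "\<forall>\<^sub>F n in sequentially. dist (norm (dependence_error n)) 0 < \<epsilon>"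
    using \<Lambda>_finite b_pos card_pos G_bounded G_L1
  proof eventually_elim
    case (elim n)
    define h where "h k = 4 * rho_1 M X \<infinity> k * W" for k
    have h_nonneg: "0 \<le> h k" for k using rho_1_nonneg \<open>0 < W\<close> by (simp add: h_def)
    have tail: "(\<Sum>k=L..<R. real k ^ (d - 1) * h k) \<le> 4 * W * \<tau>" for R
    proof -
      have "(\<Sum>k=L..<R. real k ^ (d - 1) * h k) = 4 * W * (\<Sum>k=L..<R. real k ^ (d - 1) * rho_1 M X \<infinity> k)"
        by (simp add: h_def sum_distrib_left mult_ac)
      also have "\<dots> \<le> 4 * W * \<tau>" using L[of L R] \<open>0 < W\<close> by (intro mult_left_mono) auto
      finally show ?thesis .
    qed
    have "norm (dependence_error n) \<le> (2 * real L) ^ d * (2 * u) + S * (4 * W * \<tau>)"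
      unfolding dependence_error_def S_def d_def
    proof (rule dependence_error_le[where K = "C / sqrt (real (card (\<Lambda> n)) * b n)" and h = h])
      show "\<bar>scaled n y\<bar> \<le> C / sqrt (real (card (\<Lambda> n)) * b n)" for y
        using elim by (intro scaled_bounded) auto
      show "real (card (\<Lambda> n)) * (expectation (\<lambda>\<omega>. \<bar>scaled n (X 0 \<omega>)\<bar> * \<bar>scaled n (X j \<omega>)\<bar>)
          + (expectation (\<lambda>\<omega>. \<bar>scaled n (X 0 \<omega>)\<bar>))\<^sup>2) \<le> 2 * u" if "j \<noteq> 0" "lat_norm j < L" for j
      proof -
        have "pair_moment n j / b n \<le> u"
          using elim that by (auto simp: Box_def intro: less_imp_le)
        moreover have "(abs_moment n)\<^sup>2 / b n \<le> u"
        proof -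
          have "(abs_moment n)\<^sup>2 / b n \<le> C\<^sup>2 * (b n)\<^sup>2 / b n"
            using elim square_L1_le by (intro divide_right_mono) auto
          also have "\<dots> = C\<^sup>2 * b n" by (simp add: power2_eq_square)
          finally show ?thesis using elim by simp
        qed
        ultimately show ?thesis
          using elim by (subst scaled_moments) (auto simp: add_divide_distrib)
      qed
      show "real (card (\<Lambda> n)) * (16 * alpha_1 M X \<infinity> k * (C / sqrt (real (card (\<Lambda> n)) * b n))\<^sup>2) \<le> h k \<or>
          real (card (\<Lambda> n)) * (4 * rho_1 M X \<infinity> k * expectation (\<lambda>\<omega>. (scaled n (X 0 \<omega>))\<^sup>2)) \<le> h k" for k
      proof (rule disjI2)
        have "real (card (\<Lambda> n)) * (4 * rho_1 M X \<infinity> k * expectation (\<lambda>\<omega>. (scaled n (X 0 \<omega>))\<^sup>2)) =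
            4 * rho_1 M X \<infinity> k * (square_moment n / b n)"
          by (subst scaled_moments(2)[symmetric]) (use elim in auto)
        also have "\<dots> \<le> h k"
          unfolding h_def using elim rho_1_nonneg by (intro mult_left_mono) auto
        finally show "real (card (\<Lambda> n)) * (4 * rho_1 M X \<infinity> k * expectation (\<lambda>\<omega>. (scaled n (X 0 \<omega>))\<^sup>2)) \<le> h k" .
      qed
    qed (use elim \<open>0 < u\<close> \<open>1 \<le> L\<close> h_nonneg tail in \<open>auto simp: d_def\<close>)
    also have "(2 * real L) ^ d * (2 * u) = \<epsilon> / 4" using \<open>1 \<le> L\<close> by (simp add: u_def)
    also have "S * (4 * W * \<tau>) = \<epsilon> / 4" using \<open>0 < S\<close> \<open>0 < W\<close> by (simp add: \<tau>_def)
    finally show ?case using \<open>0 < \<epsilon>\<close> by simp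
  qed
qed

end


context rescaled_array
begin

definition centered_sum :: "nat \<Rightarrow> 'a \<Rightarrow> real" where
  "centered_sum n \<omega> = (\<Sum>i\<in>\<Lambda> n. scaled n (X i \<omega>) - expectation (\<lambda>\<omega>. scaled n (X i \<omega>)))"

text \<open>
  If the dependence error vanishes, the characteristic function of the sum is asymptotically the
  power of a single one. Centring only multiplies \<open>dependence_error\<close> by a number of
  modulus 1. The squared mean is of order \<open>(b n)\<^sup>2\<close>, hence negligible against the second moment.
\<close>

theorem char_centered_sum_converges:
  assumes dep: "dependence_error \<longlonglongrightarrow> 0"
  shows "(\<lambda>n. expectation (\<lambda>\<omega>. iexp (centered_sum n \<omega>))) \<longlonglongrightarrow> of_real (exp (- v / 2))"
proof -
  define \<mu> where "\<mu> n = expectation (\<lambda>\<omega>. scaled n (X 0 \<omega>))" for n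
  define \<psi> where "\<psi> n = expectation (\<lambda>\<omega>. iexp (scaled n (X 0 \<omega>) - \<mu> n))" for n
  define N where "N n = real (card (\<Lambda> n))" for n
  define K where "K n = 2 * (C / sqrt (N n * b n))" for n
  define w where "w n = square_moment n / b n - (expectation (\<lambda>\<omega>. G n (X 0 \<omega>)))\<^sup>2 / b n" for n
  have mean: "expectation (\<lambda>\<omega>. scaled n (X i \<omega>)) = \<mu> n" for n i
    unfolding \<mu>_def by (rule single_translation) measurable
  have factor: "iexp (x - m) = iexp (- m) * iexp x" for x m :: real
    by (simp add: exp_add[symmetric] algebra_simps)
  have diff: "expectation (\<lambda>\<omega>. iexp (centered_sum n \<omega>)) - (\<psi> n) ^ card (\<Lambda> n) = (iexp (- \<mu> n)) ^ card (\<Lambda> n) * dependence_error n"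
    if "finite (\<Lambda> n)" for n
  proof -
    have "iexp (centered_sum n \<omega>) = (iexp (- \<mu> n)) ^ card (\<Lambda> n) * (\<Prod>i\<in>\<Lambda> n. iexp (scaled n (X i \<omega>)))" for \<omega>
    proof -
      have "iexp (centered_sum n \<omega>) = (\<Prod>i\<in>\<Lambda> n. iexp (scaled n (X i \<omega>) - \<mu> n))"
        unfolding centered_sum_def mean using that by (simp add: sum_distrib_left exp_sum)
      also have "\<dots> = (\<Prod>i\<in>\<Lambda> n. iexp (- \<mu> n) * iexp (scaled n (X i \<omega>)))" by (simp only: factor)
      finally show ?thesis by (simp only: prod.distrib prod_constant)
    qed
    then have 1: "expectation (\<lambda>\<omega>. iexp (centered_sum n \<omega>)) =
        (iexp (- \<mu> n)) ^ card (\<Lambda> n) * expectation (\<lambda>\<omega>. \<Prod>i\<in>\<Lambda> n. iexp (scaled n (X i \<omega>)))"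
      by (simp only: integral_mult_right_zero)
    have "\<psi> n = iexp (- \<mu> n) * expectation (\<lambda>\<omega>. iexp (scaled n (X 0 \<omega>)))"
      unfolding \<psi>_def by (simp only: factor integral_mult_right_zero)
    moreover have "(\<Prod>i\<in>\<Lambda> n. expectation (\<lambda>\<omega>. iexp (scaled n (X i \<omega>)))) =
        (expectation (\<lambda>\<omega>. iexp (scaled n (X 0 \<omega>)))) ^ card (\<Lambda> n)"
    proof -
      have "(\<Prod>i\<in>\<Lambda> n. expectation (\<lambda>\<omega>. iexp (scaled n (X i \<omega>)))) =
          (\<Prod>i\<in>\<Lambda> n. expectation (\<lambda>\<omega>. iexp (scaled n (X 0 \<omega>))))"
        by (intro prod.cong refl) (rule single_translation, measurable)
      then show ?thesis by (simp only: prod_constant)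
    qed
    ultimately have "(\<psi> n) ^ card (\<Lambda> n) = (iexp (- \<mu> n)) ^ card (\<Lambda> n) *
        (\<Prod>i\<in>\<Lambda> n. expectation (\<lambda>\<omega>. iexp (scaled n (X i \<omega>))))"
      by (simp only: power_mult_distrib)
    then show ?thesis unfolding 1 dependence_error_def by (simp only: right_diff_distrib)
  qed
  have "(\<lambda>n. norm (dependence_error n)) \<longlonglongrightarrow> 0" using dep by (rule tendsto_norm_zero)
  moreover have "\<forall>\<^sub>F n in sequentially. norm (expectation (\<lambda>\<omega>. iexp (centered_sum n \<omega>)) - (\<psi> n) ^ card (\<Lambda> n))
      \<le> norm (dependence_error n)"
    using \<Lambda>_finite
  proof eventually_elim
    case (elim n)
    have "norm (iexp (- \<mu> n)) = 1" by simp
    then show ?case unfolding diff[OF elim] norm_mult norm_power by simp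
  qed
  ultimately have near_iid: "(\<lambda>n. expectation (\<lambda>\<omega>. iexp (centered_sum n \<omega>)) - (\<psi> n) ^ card (\<Lambda> n)) \<longlonglongrightarrow> 0"
    by (rule Lim_null_comparison[rotated])
  have mean_small: "(\<lambda>n. (expectation (\<lambda>\<omega>. G n (X 0 \<omega>)))\<^sup>2 / b n) \<longlonglongrightarrow> 0"
  proof (rule Lim_null_comparison)
    show "\<forall>\<^sub>F n in sequentially. norm ((expectation (\<lambda>\<omega>. G n (X 0 \<omega>)))\<^sup>2 / b n) \<le> C\<^sup>2 * b n"
      using G_L1 b_pos
    proof eventually_elim
      case (elim n)
      have "\<bar>expectation (\<lambda>\<omega>. G n (X 0 \<omega>))\<bar> \<le> abs_moment n"
        by (rule integral_abs_bound)
      then have "(expectation (\<lambda>\<omega>. G n (X 0 \<omega>)))\<^sup>2 \<le> (abs_moment n)\<^sup>2"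
        by (simp add: abs_le_square_iff[symmetric])
      also have "\<dots> \<le> C\<^sup>2 * (b n)\<^sup>2" using elim by (intro square_L1_le) auto
      finally show ?case using elim by (simp add: divide_le_eq power2_eq_square mult.assoc)
    qed
    show "(\<lambda>n. C\<^sup>2 * b n) \<longlonglongrightarrow> 0" by (rule tendsto_mult_right_zero[OF b_lim])
  qed
  have w_lim: "w \<longlonglongrightarrow> v"
    unfolding w_def using tendsto_diff[OF G_L2 mean_small] by simp
  have "filterlim (\<lambda>n. sqrt (N n * b n)) at_top sequentially"
    unfolding N_def by (rule filterlim_compose[OF sqrt_at_top card_b_lim])
  then have "K \<longlonglongrightarrow> 0"
    unfolding K_def by (intro tendsto_mult_right_zero tendsto_divide_0[OF tendsto_const] filterlim_at_top_imp_at_infinity)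
  then have "(\<lambda>n. K n * w n) \<longlonglongrightarrow> 0 * v" using w_lim by (rule tendsto_mult)
  moreover have "(\<lambda>n. (w n)\<^sup>2 / N n) \<longlonglongrightarrow> 0"
    unfolding N_def
    by (rule tendsto_divide_0[OF tendsto_power[OF w_lim] filterlim_at_top_imp_at_infinity[OF card_lim]])
  ultimately have bound_lim: "(\<lambda>n. K n * w n + (w n)\<^sup>2 / N n) \<longlonglongrightarrow> 0"
    using tendsto_add by fastforce
  have "\<forall>\<^sub>F n in sequentially. norm ((\<psi> n) ^ card (\<Lambda> n) - of_real (exp (- w n / 2))) \<le> K n * w n + (w n)\<^sup>2 / N n"
    using b_pos card_pos G_bounded
  proof eventually_elim
    case (elim n)
    define s where "s = sqrt (N n * b n)"
    have "0 < N n" "0 < b n" using elim by (auto simp: N_def)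
    then have s: "0 < s" "s * s = N n * b n" by (simp_all add: s_def)
    have bdd: "\<bar>scaled n y\<bar> \<le> C / s" for y
      unfolding s_def N_def using elim by (intro scaled_bounded) auto
    have sc: "scaled n y = G n y / s" for y by (simp add: scaled_def s_def N_def)
    have int: "integrable M (\<lambda>\<omega>. scaled n (X 0 \<omega>))" "integrable M (\<lambda>\<omega>. (scaled n (X 0 \<omega>))\<^sup>2)"
    proof -
      show "integrable M (\<lambda>\<omega>. scaled n (X 0 \<omega>))"
        by (rule integrable_bounded[of _ "C / s"]) (use bdd in auto)
      have "\<bar>scaled n y\<bar>\<^sup>2 \<le> (C / s)\<^sup>2" for y using bdd by (intro power_mono) auto
      then show "integrable M (\<lambda>\<omega>. (scaled n (X 0 \<omega>))\<^sup>2)"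
        by (intro integrable_bounded[of _ "(C / s)\<^sup>2"]) auto
    qed
    have "expectation (\<lambda>\<omega>. (scaled n (X 0 \<omega>) - \<mu> n)\<^sup>2) = expectation (\<lambda>\<omega>. (scaled n (X 0 \<omega>))\<^sup>2) - (\<mu> n)\<^sup>2"
      unfolding \<mu>_def by (rule variance_eq[OF int])
    also have "(\<mu> n)\<^sup>2 = (expectation (\<lambda>\<omega>. G n (X 0 \<omega>)))\<^sup>2 / (s * s)"
      unfolding \<mu>_def by (simp add: sc power_divide power2_eq_square)
    also have "expectation (\<lambda>\<omega>. (scaled n (X 0 \<omega>))\<^sup>2) = square_moment n / (s * s)"
      by (simp add: sc power_divide power2_eq_square)
    finally have var: "expectation (\<lambda>\<omega>. (scaled n (X 0 \<omega>) - \<mu> n)\<^sup>2) = w n / real (card (\<Lambda> n))"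
      unfolding s(2) w_def N_def by (simp add: diff_divide_distrib mult.commute)
    have "\<bar>\<mu> n\<bar> \<le> C / s"
    proof -
      have "\<bar>\<mu> n\<bar> \<le> expectation (\<lambda>\<omega>. \<bar>scaled n (X 0 \<omega>)\<bar>)" unfolding \<mu>_def by (rule integral_abs_bound)
      also have "\<dots> \<le> expectation (\<lambda>_. C / s)" using int bdd by (intro integral_mono) auto
      finally show ?thesis by (simp add: prob_space)
    qed
    then have "\<bar>scaled n y - \<mu> n\<bar> \<le> K n" for y
      using bdd[of y] unfolding K_def s_def by linarith
    then show ?case
      unfolding \<psi>_def N_def
    proof (intro power_char_near_gaussian)
      show "expectation (\<lambda>\<omega>. scaled n (X 0 \<omega>) - \<mu> n) = 0" using int by (simp add: \<mu>_def prob_space)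
      show "0 < card (\<Lambda> n)" using elim by simp
    qed (use var in auto)
  qed
  then have "(\<lambda>n. (\<psi> n) ^ card (\<Lambda> n) - of_real (exp (- w n / 2))) \<longlonglongrightarrow> 0"
    using bound_lim by (rule Lim_null_comparison)
  moreover have "(\<lambda>n. of_real (exp (- w n / 2)) :: complex) \<longlonglongrightarrow> of_real (exp (- v / 2))"
    by (intro tendsto_intros w_lim) auto
  ultimately have "(\<lambda>n. (expectation (\<lambda>\<omega>. iexp (centered_sum n \<omega>)) - (\<psi> n) ^ card (\<Lambda> n)) +
      (((\<psi> n) ^ card (\<Lambda> n) - of_real (exp (- w n / 2))) + of_real (exp (- w n / 2)))) \<longlonglongrightarrow> 0 + (0 + of_real (exp (- v / 2)))"
    by (intro tendsto_add near_iid)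
  then show ?thesis by simp
qed

end


section \<open>The frequency polygon as a sum over the field\<close>

text \<open>
  The index \<open>k\<close> of the interval \<open>mid_bin b k\<close> that contains \<open>x\<close>.
\<close>

definition node :: "real \<Rightarrow> real \<Rightarrow> int" where
  "node b x = \<lfloor>x / b + 1 / 2\<rfloor>"

definition left_weight :: "real \<Rightarrow> real \<Rightarrow> real" where
  "left_weight b x = 1 / 2 + of_int (node b x) - x / b"

definition right_weight :: "real \<Rightarrow> real \<Rightarrow> real" where
  "right_weight b x = 1 / 2 - of_int (node b x) + x / b"

text \<open>
  The contribution of one observation \<open>y\<close> to the normalized polygon at \<open>x\<close>, up to the factor
  \<open>1 / (card L * b)\<close>.
\<close>

definition polygon_kernel :: "(real \<Rightarrow> real) \<Rightarrow> real \<Rightarrow> real \<Rightarrow> real \<Rightarrow> real" where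
  "polygon_kernel f b x y =
     (left_weight b x * indicator (bin b (node b x)) y + right_weight b x * indicator (bin b (node b x + 1)) y)
       / poly_sigma f b (node b x) x"

lemma mem_mid_bin_iff: "0 < b \<Longrightarrow> x \<in> mid_bin b k \<longleftrightarrow> k = node b x"
proof -
  assume "0 < b"
  then have "x \<in> mid_bin b k \<longleftrightarrow> of_int k \<le> x / b + 1 / 2 \<and> x / b + 1 / 2 < of_int k + 1"
    by (auto simp: mid_bin_def field_simps)
  then show ?thesis using floor_eq_iff[of "x / b + 1 / 2" k] unfolding node_def by auto
qed

lemma freq_polygon_eq_piece:
  assumes "0 < b"
  shows "freq_polygon X f L b x \<omega> = poly_piece X L b (node b x) x \<omega> / poly_sigma f b (node b x) x"
proof -
  have "freq_polygon X f L b x \<omega> =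
      (\<Sum>\<^sub>\<infinity>k\<in>{node b x}. poly_piece X L b k x \<omega> / poly_sigma f b k x * indicator (mid_bin b k) x)"
    unfolding freq_polygon_def
    by (rule infsum_cong_neutral) (auto simp: mem_mid_bin_iff[OF assms])
  also have "\<dots> = poly_piece X L b (node b x) x \<omega> / poly_sigma f b (node b x) x"
    using mem_mid_bin_iff[OF assms, of x "node b x"] by simp
  finally show ?thesis .
qed

lemma freq_polygon_eq_sum:
  assumes "0 < b" "finite L"
  shows "freq_polygon X f L b x \<omega> = (\<Sum>i\<in>L. polygon_kernel f b x (X i \<omega>)) / (real (card L) * b)"
proof -
  define u where "u k = (\<Sum>i\<in>L. indicat_real (bin b k) (X i \<omega>))" for k
  have count: "real (bin_count X L b k \<omega>) = u k" for k
    unfolding bin_count_def u_def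
    by (simp add: indicator_def of_bool_def sum.inter_filter[OF assms(2), symmetric])
  have "(\<Sum>i\<in>L. polygon_kernel f b x (X i \<omega>)) =
      (left_weight b x * u (node b x) + right_weight b x * u (node b x + 1)) / poly_sigma f b (node b x) x"
    unfolding polygon_kernel_def u_def sum_divide_distrib[symmetric] sum.distrib sum_distrib_left[symmetric] ..
  then show ?thesis
    unfolding freq_polygon_eq_piece[OF assms(1)] poly_piece_def count
      left_weight_def[symmetric] right_weight_def[symmetric]
    by (simp add: add_divide_distrib mult.commute)
qed

text \<open>
  The factor \<open>1/2 + 2 (k - x/b)\<^sup>2\<close> in the normalization is the sum of the squares of the two
  interpolation weights. As the weights add up to 1, it is at least \<open>1/2\<close>.
\<close>

lemma weights:
  assumes "0 < b"
  shows "0 \<le> left_weight b x" "0 \<le> right_weight b x" "left_weight b x + right_weight b x = 1"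
    "poly_sigma f b (node b x) x = sqrt (((left_weight b x)\<^sup>2 + (right_weight b x)\<^sup>2) * f x)"
    "1 / 2 \<le> (left_weight b x)\<^sup>2 + (right_weight b x)\<^sup>2"
proof -
  have "of_int (node b x) \<le> x / b + 1 / 2" "x / b + 1 / 2 < of_int (node b x) + 1"
    unfolding node_def by (rule of_int_floor_le, linarith)
  then show "0 \<le> left_weight b x" "0 \<le> right_weight b x"
    by (auto simp: left_weight_def right_weight_def)
  show 1: "left_weight b x + right_weight b x = 1"
    by (simp add: left_weight_def right_weight_def)
  have sq: "(left_weight b x)\<^sup>2 + (right_weight b x)\<^sup>2 = 1 / 2 + 2 * (of_int (node b x) - x / b)\<^sup>2"
    by (simp add: left_weight_def right_weight_def power2_eq_square algebra_simps)
  show "poly_sigma f b (node b x) x = sqrt (((left_weight b x)\<^sup>2 + (right_weight b x)\<^sup>2) * f x)"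
    unfolding poly_sigma_def sq ..
  show "1 / 2 \<le> (left_weight b x)\<^sup>2 + (right_weight b x)\<^sup>2" unfolding sq by simp
qed

lemma poly_sigma_ge:
  assumes "0 < b" "0 < f x"
  shows "sqrt (f x / 2) \<le> poly_sigma f b (node b x) x"
  unfolding weights(4)[OF assms(1)]
  using mult_right_mono[OF weights(5)[OF assms(1), of x], of "f x"] assms(2)
  by (intro real_sqrt_le_mono) simp

lemma polygon_kernel_le:
  assumes "0 < b" "0 < f x"
  shows "\<bar>polygon_kernel f b x y\<bar> \<le>
    1 / sqrt (f x / 2) * (\<Sum>e\<in>{0, 1}. indicator (bin b (node b x + e)) y)"
proof -
  note w = weights(1-3)[OF assms(1), of x]
  let ?u = "\<Sum>e\<in>{0, 1}. indicat_real (bin b (node b x + e)) y"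
  have "0 < sqrt (f x / 2)" using assms by simp
  have "\<bar>left_weight b x * indicator (bin b (node b x)) y + right_weight b x * indicator (bin b (node b x + 1)) y\<bar> \<le> ?u"
    using w by (auto simp: indicator_def)
  moreover have "0 \<le> ?u" by (intro sum_nonneg) auto
  ultimately have "\<bar>polygon_kernel f b x y\<bar> \<le> ?u / sqrt (f x / 2)"
    unfolding polygon_kernel_def abs_divide
    using poly_sigma_ge[OF assms(1), where f = f and x = x] assms \<open>0 < sqrt (f x / 2)\<close> by (intro frac_le) auto
  then show ?thesis by simp
qed

lemma bin_near_node:
  assumes "0 < b" "e \<in> {0, 1}" "y \<in> bin b (node b x + e)"
  shows "\<bar>y - x\<bar> < 2 * b"
proof -
  define k where "k = real_of_int (node b x)"
  have k: "k \<le> x / b + 1 / 2" "x / b + 1 / 2 < k + 1"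
    unfolding k_def node_def by (rule of_int_floor_le, linarith)
  then have x: "(k - 1 / 2) * b \<le> x" "x < (k + 1 / 2) * b"
    using assms(1) by (auto simp: field_simps)
  have "(k - 1) * b \<le> y" "y < (k + 1) * b"
  proof -
    have "(k - 1) * b \<le> (k + of_int e - 1) * b" "(k + of_int e) * b \<le> (k + 1) * b"
      using assms(1,2) by (auto intro!: mult_right_mono)
    then show "(k - 1) * b \<le> y" "y < (k + 1) * b"
      using assms(3) by (auto simp: bin_def k_def)
  qed
  with x show ?thesis using assms(1) by (auto simp: abs_less_iff algebra_simps)
qed

lemma bins_disjoint: "0 < b \<Longrightarrow> bin b k \<inter> bin b (k + 1) = {}"
  by (auto simp: bin_def)

lemma polygon_kernel_square:
  assumes "0 < b" "0 < f x"
  shows "(polygon_kernel f b x y)\<^sup>2 =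
    ((left_weight b x)\<^sup>2 * indicator (bin b (node b x)) y + (right_weight b x)\<^sup>2 * indicator (bin b (node b x + 1)) y)
      / (((left_weight b x)\<^sup>2 + (right_weight b x)\<^sup>2) * f x)"
proof -
  have "(poly_sigma f b (node b x) x)\<^sup>2 = ((left_weight b x)\<^sup>2 + (right_weight b x)\<^sup>2) * f x"
    unfolding weights(4)[OF assms(1)] using assms(2) by simp
  moreover have "(left_weight b x * indicator (bin b (node b x)) y + right_weight b x * indicator (bin b (node b x + 1)) y)\<^sup>2 =
      (left_weight b x)\<^sup>2 * indicator (bin b (node b x)) y + (right_weight b x)\<^sup>2 * indicator (bin b (node b x + 1)) y"
    using bins_disjoint[OF assms(1), of "node b x"] by (auto simp: indicator_def)
  ultimately show ?thesis by (simp add: polygon_kernel_def power_divide)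
qed

text \<open>
  Each kernel is supported within \<open>2 b\<close> of its point. Thus distinct points give asymptotically
  uncorrelated estimators, whence the identity matrix in the limit.
\<close>

lemma polygon_kernels_orthogonal:
  assumes "0 < b" "4 * b \<le> \<bar>x - x'\<bar>" "0 < f x" "0 < f x'"
  shows "polygon_kernel f b x y * polygon_kernel f b x' y = 0"
proof (rule ccontr)
  have near: "\<bar>y - z\<bar> < 2 * b" if "polygon_kernel f b z y \<noteq> 0" for z
  proof (rule ccontr)
    assume "\<not> \<bar>y - z\<bar> < 2 * b"
    then have "y \<notin> bin b (node b z)" "y \<notin> bin b (node b z + 1)"
      using bin_near_node[OF assms(1), of 0 y z] bin_near_node[OF assms(1), of 1 y z] by auto
    then show False using that by (simp add: polygon_kernel_def)
  qed
  assume "polygon_kernel f b x y * polygon_kernel f b x' y \<noteq> 0"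
  then have "\<bar>y - x\<bar> < 2 * b" "\<bar>y - x'\<bar> < 2 * b" using near by auto
  then show False using assms(2) by linarith
qed

lemma bin_borel [measurable]: "bin b k \<in> sets borel"
  by (simp add: bin_def)

lemma polygon_kernel_measurable [measurable]: "polygon_kernel f b x \<in> borel_measurable borel"
  unfolding polygon_kernel_def by measurable

lemma bin_probability_near:
  assumes "prob_space M" and dens: "distributed M lborel Y (\<lambda>u. ennreal (f u))"
    and near: "\<And>u. u \<in> bin b k \<Longrightarrow> \<bar>f u - a\<bar> \<le> \<epsilon>" and "\<And>u. 0 \<le> f u" "0 < b" "0 < \<epsilon>" "\<epsilon> < a"
  shows "\<bar>measure M (Y -` bin b k \<inter> space M) / b - a\<bar> \<le> \<epsilon>"
proof -
  interpret prob_space M by fact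
  have len: "emeasure lborel (bin b k) = ennreal b"
    using \<open>0 < b\<close> by (simp add: bin_def algebra_simps)
  have const: "(\<integral>\<^sup>+u. ennreal c * indicator (bin b k) u \<partial>lborel) = ennreal (c * b)" if "0 \<le> c" for c
    using that len \<open>0 < b\<close> by (simp add: nn_integral_cmult_indicator ennreal_mult bin_def)
  have P: "ennreal (measure M (Y -` bin b k \<inter> space M)) = (\<integral>\<^sup>+u. ennreal (f u) * indicator (bin b k) u \<partial>lborel)"
    using distributed_emeasure[OF dens, of "bin b k"] by (simp add: emeasure_eq_measure bin_def)
  have "ennreal (measure M (Y -` bin b k \<inter> space M)) \<le> (\<integral>\<^sup>+u. ennreal (a + \<epsilon>) * indicator (bin b k) u \<partial>lborel)"
    unfolding P using near by (intro nn_integral_mono) (force simp: indicator_def abs_le_iff intro!: ennreal_leI)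
  also have "\<dots> = ennreal ((a + \<epsilon>) * b)" using assms by (intro const) auto
  finally have upper: "measure M (Y -` bin b k \<inter> space M) \<le> (a + \<epsilon>) * b"
    using assms by (subst (asm) ennreal_le_iff) auto
  have "ennreal ((a - \<epsilon>) * b) = (\<integral>\<^sup>+u. ennreal (a - \<epsilon>) * indicator (bin b k) u \<partial>lborel)"
    using assms by (intro const[symmetric]) auto
  also have "(\<integral>\<^sup>+u. ennreal (a - \<epsilon>) * indicator (bin b k) u \<partial>lborel) \<le> ennreal (measure M (Y -` bin b k \<inter> space M))"
    unfolding P using near by (intro nn_integral_mono) (force simp: indicator_def abs_le_iff intro!: ennreal_leI)
  finally have "(a - \<epsilon>) * b \<le> measure M (Y -` bin b k \<inter> space M)"
    by (subst (asm) ennreal_le_iff) auto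
  with upper show ?thesis using \<open>0 < b\<close> by (auto simp: abs_le_iff field_simps)
qed

text \<open>
  Differentiation of the law along bins that shrink to a continuity point of the density. The bins
  depend on \<open>n\<close> and need not contain \<open>x\<close>, but they lie within \<open>2 * b n\<close> of it.
\<close>

lemma bin_probability_tendsto:
  assumes "prob_space M" and dens: "distributed M lborel Y (\<lambda>u. ennreal (f u))"
    and cont: "isCont f x" and nonneg: "\<And>u. 0 \<le> f u" and "0 < f x"
    and b: "\<forall>\<^sub>F n in sequentially. 0 < b n" "b \<longlonglongrightarrow> 0" and e: "e \<in> {0, 1}"
  shows "(\<lambda>n. measure M (Y -` bin (b n) (node (b n) x + e) \<inter> space M) / b n) \<longlonglongrightarrow> f x"
proof (rule tendstoI)
  fix \<epsilon> :: real assume "0 < \<epsilon>"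
  \<comment> \<open>Keeping \<open>\<eta>\<close> below \<open>f x\<close> makes the lower bound \<open>f x - \<eta>\<close> a nonnegative density.\<close>
  define \<eta> where "\<eta> = min (\<epsilon> / 2) (f x / 2)"
  have \<eta>: "0 < \<eta>" "\<eta> < \<epsilon>" "\<eta> < f x" using \<open>0 < \<epsilon>\<close> \<open>0 < f x\<close> by (auto simp: \<eta>_def)
  obtain \<delta> where "0 < \<delta>" and \<delta>: "\<And>u. \<bar>u - x\<bar> < \<delta> \<Longrightarrow> \<bar>f u - f x\<bar> < \<eta>"
    using cont \<eta>(1) unfolding continuous_at_eps_delta by (auto simp: dist_real_def)
  have "\<forall>\<^sub>F n in sequentially. b n < \<delta> / 2" using \<open>0 < \<delta>\<close> by (intro order_tendstoD(2)[OF b(2)]) auto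
  with b(1) show "\<forall>\<^sub>F n in sequentially. dist (measure M (Y -` bin (b n) (node (b n) x + e) \<inter> space M) / b n) (f x) < \<epsilon>"
  proof eventually_elim
    case (elim n)
    have "\<bar>measure M (Y -` bin (b n) (node (b n) x + e) \<inter> space M) / b n - f x\<bar> \<le> \<eta>"
    proof (rule bin_probability_near[OF assms(1) dens _ nonneg elim(1) \<eta>(1,3)])
      fix u assume "u \<in> bin (b n) (node (b n) x + e)"
      then have "\<bar>u - x\<bar> < \<delta>" using bin_near_node[OF elim(1) e] elim(2) by fastforce
      then show "\<bar>f u - f x\<bar> \<le> \<eta>" using \<delta> less_imp_le by blast
    qed
    then show ?case using \<eta>(2) by (simp add: dist_real_def)
  qed
qed

text \<open>
  After division by \<open>b n\<close>, the second moment is the average of two bin densities with the squared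
  interpolation weights, divided by \<open>f x\<close>. The weights keep oscillating with \<open>n\<close>, but both bin
  densities tend to \<open>f x\<close>, so the average converges.
\<close>

lemma polygon_kernel_variance:
  assumes "prob_space M" and dens: "distributed M lborel Y (\<lambda>u. ennreal (f u))"
    and "isCont f x" "\<And>u. 0 \<le> f u" and "0 < f x"
    and b: "\<forall>\<^sub>F n in sequentially. 0 < b n" "b \<longlonglongrightarrow> 0"
  shows "(\<lambda>n. (\<integral>\<omega>. (polygon_kernel f (b n) x (Y \<omega>))\<^sup>2 \<partial>M) / b n) \<longlonglongrightarrow> 1"
proof -
  interpret prob_space M by fact
  have [measurable]: "Y \<in> borel_measurable M" using distributed_measurable[OF dens] by simp
  define P where "P e n = measure M (Y -` bin (b n) (node (b n) x + e) \<inter> space M) / b n" for e n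
  have P: "P e \<longlonglongrightarrow> f x" if "e \<in> {0, 1}" for e
    unfolding P_def by (rule bin_probability_tendsto[OF assms that])
  have "(\<lambda>n. (\<bar>P 0 n - f x\<bar> + \<bar>P 1 n - f x\<bar>) / f x) \<longlonglongrightarrow> (\<bar>f x - f x\<bar> + \<bar>f x - f x\<bar>) / f x"
    using \<open>0 < f x\<close> by (intro tendsto_intros P) auto
  then have null: "(\<lambda>n. (\<bar>P 0 n - f x\<bar> + \<bar>P 1 n - f x\<bar>) / f x) \<longlonglongrightarrow> 0" by simp
  have "\<forall>\<^sub>F n in sequentially. norm ((\<integral>\<omega>. (polygon_kernel f (b n) x (Y \<omega>))\<^sup>2 \<partial>M) / b n - 1)
      \<le> (\<bar>P 0 n - f x\<bar> + \<bar>P 1 n - f x\<bar>) / f x"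
    using b(1)
  proof eventually_elim
    case (elim n)
    define p where "p = (left_weight (b n) x)\<^sup>2"
    define q where "q = (right_weight (b n) x)\<^sup>2"
    have pq: "0 \<le> p" "0 \<le> q" "0 < p + q" using weights(5)[OF elim, of x] by (auto simp: p_def q_def)
    have ind: "integrable M (\<lambda>\<omega>. indicat_real (bin (b n) k) (Y \<omega>))"
      "expectation (\<lambda>\<omega>. indicat_real (bin (b n) k) (Y \<omega>)) = prob (Y -` bin (b n) k \<inter> space M)" for k
    proof -
      have eq: "indicat_real (bin (b n) k) (Y \<omega>) = indicator (Y -` bin (b n) k \<inter> space M) \<omega>"
        if "\<omega> \<in> space M" for \<omega> using that by (simp add: indicator_def)
      show "integrable M (\<lambda>\<omega>. indicat_real (bin (b n) k) (Y \<omega>))"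
        by (rule integrable_bounded[of _ 1]) auto
      have "expectation (\<lambda>\<omega>. indicat_real (bin (b n) k) (Y \<omega>)) = expectation (indicator (Y -` bin (b n) k \<inter> space M))"
        by (rule Bochner_Integration.integral_cong[OF refl eq])
      then show "expectation (\<lambda>\<omega>. indicat_real (bin (b n) k) (Y \<omega>)) = prob (Y -` bin (b n) k \<inter> space M)"
        by simp
    qed
    have "(\<integral>\<omega>. (polygon_kernel f (b n) x (Y \<omega>))\<^sup>2 \<partial>M) =
        (p * prob (Y -` bin (b n) (node (b n) x) \<inter> space M) + q * prob (Y -` bin (b n) (node (b n) x + 1) \<inter> space M)) / ((p + q) * f x)"
      unfolding polygon_kernel_square[where f = f and x = x, OF elim \<open>0 < f x\<close>] p_def[symmetric] q_def[symmetric]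
      using ind by simp
    then have "(\<integral>\<omega>. (polygon_kernel f (b n) x (Y \<omega>))\<^sup>2 \<partial>M) / b n - 1 = (p * P 0 n + q * P 1 n) / ((p + q) * f x) - 1"
      by (simp add: P_def add_divide_distrib mult_ac)
    also have "\<dots> = (p * (P 0 n - f x) + q * (P 1 n - f x)) / ((p + q) * f x)"
    proof -
      define D where "D = (p + q) * f x"
      have "D \<noteq> 0" using pq \<open>0 < f x\<close> by (simp add: D_def)
      then have "(p * P 0 n + q * P 1 n) / D - 1 = (p * P 0 n + q * P 1 n - D) / D"
        by (simp add: diff_divide_distrib)
      also have "p * P 0 n + q * P 1 n - D = p * (P 0 n - f x) + q * (P 1 n - f x)"
        by (simp add: D_def algebra_simps)
      finally show ?thesis unfolding D_def .
    qed
    finally have "norm ((\<integral>\<omega>. (polygon_kernel f (b n) x (Y \<omega>))\<^sup>2 \<partial>M) / b n - 1) =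
        \<bar>p * (P 0 n - f x) + q * (P 1 n - f x)\<bar> / ((p + q) * f x)"
      using pq \<open>0 < f x\<close> by (simp add: abs_divide abs_mult)
    also have "\<dots> \<le> ((p + q) * (\<bar>P 0 n - f x\<bar> + \<bar>P 1 n - f x\<bar>)) / ((p + q) * f x)"
    proof (rule divide_right_mono)
      have "\<bar>p * (P 0 n - f x) + q * (P 1 n - f x)\<bar> \<le> p * \<bar>P 0 n - f x\<bar> + q * \<bar>P 1 n - f x\<bar>"
        using pq abs_triangle_ineq[of "p * (P 0 n - f x)" "q * (P 1 n - f x)"] by (simp add: abs_mult)
      also have "\<dots> \<le> (p + q) * \<bar>P 0 n - f x\<bar> + (p + q) * \<bar>P 1 n - f x\<bar>"
        using pq by (intro add_mono mult_right_mono) auto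
      finally show "\<bar>p * (P 0 n - f x) + q * (P 1 n - f x)\<bar> \<le> (p + q) * (\<bar>P 0 n - f x\<bar> + \<bar>P 1 n - f x\<bar>)"
        by (simp add: distrib_left)
    qed (use pq \<open>0 < f x\<close> in simp)
    also have "\<dots> = (\<bar>P 0 n - f x\<bar> + \<bar>P 1 n - f x\<bar>) / f x" using pq by simp
    finally show ?case .
  qed
  then have "(\<lambda>n. (\<integral>\<omega>. (polygon_kernel f (b n) x (Y \<omega>))\<^sup>2 \<partial>M) / b n - 1) \<longlonglongrightarrow> 0"
    using null by (rule Lim_null_comparison)
  then show ?thesis by (simp add: LIM_zero_iff)
qed


section \<open>Asymptotic normality of the frequency polygon\<close>

context stationary_random_field
begin

lemma freq_polygon_measurable:
  assumes "0 < b" "finite L"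
  shows "(\<lambda>\<omega>. freq_polygon X f L b x \<omega>) \<in> borel_measurable M"
  unfolding freq_polygon_eq_sum[OF assms] by measurable

lemma linear_form_eq_centered_kernel_sum:
  fixes t :: "real ^ 'r" and x :: "'r \<Rightarrow> real"
  assumes b: "0 < b" and "finite L" and N: "0 < real (card L)" and x_pos: "\<And>l. 0 < f (x l)"
  defines "g \<equiv> \<lambda>y. (\<Sum>l\<in>UNIV. t $ l * polygon_kernel f b (x l) y) / sqrt (real (card L) * b)"
  shows "t \<bullet> (\<chi> l. sqrt (real (card L) * b) * (freq_polygon X f L b (x l) \<omega> - expectation (freq_polygon X f L b (x l))))
     = (\<Sum>i\<in>L. g (X i \<omega>) - expectation (\<lambda>\<omega>. g (X i \<omega>)))"
proof -
  define s where "s = sqrt (real (card L) * b)"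
  have "0 < real (card L) * b" using b N by simp
  then have s: "0 < s" "real (card L) * b = s * s" by (simp_all add: s_def)
  have int: "integrable M (\<lambda>\<omega>. polygon_kernel f b (x l) (X i \<omega>))" for l i
  proof (rule integrable_bounded)
    show "norm (polygon_kernel f b (x l) (X i \<omega>)) \<le> 1 / sqrt (f (x l) / 2) * 2" for \<omega>
    proof -
      have "(\<Sum>e\<in>{0, 1}. indicat_real (bin b (node b (x l) + e)) (X i \<omega>)) \<le> (\<Sum>e\<in>{0, 1 :: int}. 1)"
        by (intro sum_mono) (simp add: indicator_def)
      then have "1 / sqrt (f (x l) / 2) * (\<Sum>e\<in>{0, 1}. indicat_real (bin b (node b (x l) + e)) (X i \<omega>))
          \<le> 1 / sqrt (f (x l) / 2) * 2"
        using x_pos[of l] by (intro mult_left_mono) auto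
      then show ?thesis
        using polygon_kernel_le[where f = f and x = "x l" and y = "X i \<omega>", OF b x_pos] by simp
    qed
  qed measurable
  have fp: "freq_polygon X f L b (x l) = (\<lambda>\<omega>. (\<Sum>i\<in>L. polygon_kernel f b (x l) (X i \<omega>)) / (s * s))" for l
    unfolding s(2)[symmetric] by (rule ext) (rule freq_polygon_eq_sum[OF b \<open>finite L\<close>])
  have "s * (freq_polygon X f L b (x l) \<omega> - expectation (freq_polygon X f L b (x l))) =
      (\<Sum>i\<in>L. polygon_kernel f b (x l) (X i \<omega>) / s - expectation (\<lambda>\<omega>. polygon_kernel f b (x l) (X i \<omega>)) / s)" for l
    unfolding fp using s(1) int
    by (simp add: sum_subtractf sum_divide_distrib[symmetric] right_diff_distrib)
  then have "t \<bullet> (\<chi> l. s * (freq_polygon X f L b (x l) \<omega> - expectation (freq_polygon X f L b (x l)))) =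
      (\<Sum>l\<in>UNIV. \<Sum>i\<in>L. t $ l * (polygon_kernel f b (x l) (X i \<omega>) / s - expectation (\<lambda>\<omega>. polygon_kernel f b (x l) (X i \<omega>)) / s))"
    by (simp add: inner_vec_def sum_distrib_left)
  also have "\<dots> = (\<Sum>i\<in>L. \<Sum>l\<in>UNIV. t $ l * (polygon_kernel f b (x l) (X i \<omega>) / s - expectation (\<lambda>\<omega>. polygon_kernel f b (x l) (X i \<omega>)) / s))"
    by (rule sum.swap)
  also have "\<dots> = (\<Sum>i\<in>L. g (X i \<omega>) - expectation (\<lambda>\<omega>. g (X i \<omega>)))"
  proof (rule sum.cong[OF refl])
    fix i
    have "expectation (\<lambda>\<omega>. g (X i \<omega>)) = (\<Sum>l\<in>UNIV. t $ l * expectation (\<lambda>\<omega>. polygon_kernel f b (x l) (X i \<omega>))) / s"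
      unfolding g_def s_def[symmetric] using int by simp
    then show "(\<Sum>l\<in>UNIV. t $ l * (polygon_kernel f b (x l) (X i \<omega>) / s - expectation (\<lambda>\<omega>. polygon_kernel f b (x l) (X i \<omega>)) / s)) =
        g (X i \<omega>) - expectation (\<lambda>\<omega>. g (X i \<omega>))"
      unfolding g_def s_def[symmetric] by (simp add: right_diff_distrib sum_subtractf sum_divide_distrib)
  qed
  finally show ?thesis unfolding s_def .
qed

text \<open>
  The linear form along \<open>t\<close> comes from the array \<open>G n = (\<Sum>l. t $ l * kernel at x l)\<close>, which is
  dominated by a fixed nonnegative combination of indicators of \<open>2 r\<close> bins. All moment and joint
  moment conditions of the array are therefore statements on bin probabilities, indexed
  by the pairs \<open>q = (l, e)\<close> of a point and one of its two bins.
\<close>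

lemma char_frequency_polygon_converges:
  fixes f :: "real \<Rightarrow> real" and x :: "'r::finite \<Rightarrow> real" and t :: "real ^ 'r"
  assumes f_nonneg: "\<And>u. 0 \<le> f u"
    and dens: "\<And>i. distributed M lborel (X i) (\<lambda>u. ennreal (f u))"
    and \<Lambda>_finite: "\<And>n. n \<ge> 1 \<Longrightarrow> finite (\<Lambda> n)"
    and \<Lambda>_lim: "filterlim (\<lambda>n. real (card (\<Lambda> n))) at_top sequentially"
    and b_pos: "\<And>n. n \<ge> 1 \<Longrightarrow> b n > 0"
    and f_cont: "\<And>u. isCont f u"
    and b_lim: "b \<longlonglongrightarrow> 0"
    and \<Lambda>b_lim: "filterlim (\<lambda>n. real (card (\<Lambda> n)) * b n) at_top sequentially"
    and mixing:
      "((\<forall>s t :: nat \<Rightarrow> int.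
           (\<lambda>n. SUP j\<in>- {0}. \<P>(\<omega> in M. X 0 \<omega> \<in> bin (b n) (s n) \<and> X j \<omega> \<in> bin (b n) (t n)))
             \<in> O(\<lambda>n. (b n)\<^sup>2)) \<and>
        summable (\<lambda>m. real (Suc m) ^ (2 * CARD('d) - 1) * alpha_1 M X \<infinity> (Suc m)))
       \<or>
       ((\<forall>(s :: nat \<Rightarrow> int) (t :: nat \<Rightarrow> int) j. j \<noteq> 0 \<longrightarrow>
           (\<lambda>n. \<P>(\<omega> in M. X 0 \<omega> \<in> bin (b n) (s n) \<and> X j \<omega> \<in> bin (b n) (t n))) \<in> o(b)) \<and>
        summable (\<lambda>m. real (Suc m) ^ (CARD('d) - 1) * rho_1 M X \<infinity> (Suc m)))"
    and x_distinct: "inj x"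
    and x_pos: "\<And>l. f (x l) > 0"
  shows "(\<lambda>n. expectation (\<lambda>\<omega>. iexp (t \<bullet> (\<chi> l. sqrt (real (card (\<Lambda> n)) * b n) *
      (freq_polygon X f (\<Lambda> n) (b n) (x l) \<omega> - expectation (freq_polygon X f (\<Lambda> n) (b n) (x l)))))))
    \<longlonglongrightarrow> of_real (exp (- (norm t)\<^sup>2 / 2))"
proof -
  have ev_b: "\<forall>\<^sub>F n in sequentially. 0 < b n" and ev_\<Lambda>: "\<forall>\<^sub>F n in sequentially. finite (\<Lambda> n)"
    using b_pos \<Lambda>_finite by (auto simp: eventually_sequentially)
  define G where "G n y = (\<Sum>l\<in>UNIV. t $ l * polygon_kernel f (b n) (x l) y)" for n y
  have G_meas [measurable]: "G n \<in> borel_measurable borel" for n unfolding G_def by measurable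
  define Q where "Q = (UNIV :: 'r set) \<times> {0, 1 :: int}"
  have "finite Q" by (simp add: Q_def)
  define a where "a q = \<bar>t $ fst q\<bar> / sqrt (f (x (fst q)) / 2)" for q :: "'r \<times> int"
  have a_nonneg: "0 \<le> a q" for q using f_nonneg by (simp add: a_def)
  define s where "s q n = node (b n) (x (fst q)) + snd q" for q :: "'r \<times> int" and n
  have G_le: "\<bar>G n y\<bar> \<le> (\<Sum>q\<in>Q. a q * indicator (bin (b n) (s q n)) y)" if "0 < b n" for n y
  proof -
    have "\<bar>G n y\<bar> \<le> (\<Sum>l\<in>UNIV. \<bar>t $ l * polygon_kernel f (b n) (x l) y\<bar>)"
      unfolding G_def by (rule sum_abs)
    also have "\<dots> \<le> (\<Sum>l\<in>UNIV. \<Sum>e\<in>{0, 1}. a (l, e) * indicator (bin (b n) (s (l, e) n)) y)"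
    proof (rule sum_mono)
      fix l
      have "\<bar>t $ l * polygon_kernel f (b n) (x l) y\<bar> \<le>
          \<bar>t $ l\<bar> * (1 / sqrt (f (x l) / 2) * (\<Sum>e\<in>{0, 1}. indicator (bin (b n) (node (b n) (x l) + e)) y))"
        unfolding abs_mult using polygon_kernel_le[where f = f, OF that x_pos] by (intro mult_left_mono) auto
      also have "\<dots> = (\<Sum>e\<in>{0, 1}. a (l, e) * indicator (bin (b n) (s (l, e) n)) y)"
        by (simp add: a_def s_def algebra_simps)
      finally show "\<bar>t $ l * polygon_kernel f (b n) (x l) y\<bar> \<le> \<dots>" .
    qed
    also have "\<dots> = (\<Sum>q\<in>Q. a q * indicator (bin (b n) (s q n)) y)"
      by (simp only: Q_def sum.cartesian_product split_def prod.collapse)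
    finally show ?thesis .
  qed
  define P where "P q n = prob (X 0 -` bin (b n) (s q n) \<inter> space M)" for q n
  have P_lim: "(\<lambda>n. P q n / b n) \<longlonglongrightarrow> f (x (fst q))" if "q \<in> Q" for q
    unfolding P_def s_def using that
    by (intro bin_probability_tendsto prob_space_axioms dens f_cont f_nonneg x_pos ev_b b_lim) (auto simp: Q_def)
  have ind_int: "integrable M (\<lambda>\<omega>. indicat_real (bin (b n) k) (X 0 \<omega>))"
    and ind_exp: "expectation (\<lambda>\<omega>. indicat_real (bin (b n) k) (X 0 \<omega>)) = prob (X 0 -` bin (b n) k \<inter> space M)" for n k
  proof -
    show "integrable M (\<lambda>\<omega>. indicat_real (bin (b n) k) (X 0 \<omega>))"
      by (rule integrable_bounded[of _ 1]) auto
    have "expectation (\<lambda>\<omega>. indicat_real (bin (b n) k) (X 0 \<omega>)) = expectation (indicator (X 0 -` bin (b n) k \<inter> space M))"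
      by (rule Bochner_Integration.integral_cong) (simp_all add: indicator_def)
    then show "expectation (\<lambda>\<omega>. indicat_real (bin (b n) k) (X 0 \<omega>)) = prob (X 0 -` bin (b n) k \<inter> space M)"
      by simp
  qed
  define J where "J q q' j n = \<P>(\<omega> in M. X 0 \<omega> \<in> bin (b n) (s q n) \<and> X j \<omega> \<in> bin (b n) (s q' n))" for q q' j n
  \<comment> \<open>One constant for two purposes: each factor \<open>f (x l) + 1\<close> is at least 1 and eventually exceeds the bin densities near \<open>x l\<close>.\<close>
  define C where "C = (\<Sum>q\<in>Q. a q * (f (x (fst q)) + 1))"
  have "(\<Sum>q\<in>Q. a q) \<le> C"
    unfolding C_def using a_nonneg f_nonneg by (intro sum_mono) (simp add: distrib_left)
  have G_bdd: "\<bar>G n y\<bar> \<le> C" if "0 < b n" for n y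
  proof -
    have "\<bar>G n y\<bar> \<le> (\<Sum>q\<in>Q. a q * indicator (bin (b n) (s q n)) y)" by (rule G_le[OF that])
    also have "\<dots> \<le> (\<Sum>q\<in>Q. a q)" using a_nonneg by (intro sum_mono) (simp add: indicator_def)
    finally show ?thesis using \<open>(\<Sum>q\<in>Q. a q) \<le> C\<close> by simp
  qed
  have G_int: "integrable M (\<lambda>\<omega>. \<bar>G n (X i \<omega>)\<bar>)" "integrable M (\<lambda>\<omega>. \<bar>G n (X k \<omega>)\<bar> * \<bar>G n (X j \<omega>)\<bar>)"
    if "0 < b n" for n i j k
  proof -
    show "integrable M (\<lambda>\<omega>. \<bar>G n (X i \<omega>)\<bar>)"
      using G_bdd[OF that] by (intro integrable_bounded[of _ C]) auto
    have "0 \<le> C" using G_bdd[OF that, of 0] by linarith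
    then show "integrable M (\<lambda>\<omega>. \<bar>G n (X k \<omega>)\<bar> * \<bar>G n (X j \<omega>)\<bar>)"
      using G_bdd[OF that] by (intro integrable_bounded[of _ "C * C"]) (auto simp: abs_mult intro!: mult_mono)
  qed
  have joint_le: "expectation (\<lambda>\<omega>. \<bar>G n (X 0 \<omega>)\<bar> * \<bar>G n (X j \<omega>)\<bar>) \<le> (\<Sum>q\<in>Q. \<Sum>q'\<in>Q. a q * a q' * J q q' j n)"
    if "0 < b n" for n j
  proof -
    define E where "E q q' = {\<omega> \<in> space M. X 0 \<omega> \<in> bin (b n) (s q n) \<and> X j \<omega> \<in> bin (b n) (s q' n)}" for q q'
    have E: "E q q' \<in> sets M" for q q' unfolding E_def by measurable
    have "expectation (\<lambda>\<omega>. \<bar>G n (X 0 \<omega>)\<bar> * \<bar>G n (X j \<omega>)\<bar>) \<le>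
        expectation (\<lambda>\<omega>. \<Sum>q\<in>Q. \<Sum>q'\<in>Q. a q * a q' * indicator (E q q') \<omega>)"
    proof (rule integral_mono)
      show "integrable M (\<lambda>\<omega>. \<Sum>q\<in>Q. \<Sum>q'\<in>Q. a q * a q' * indicator (E q q') \<omega>)"
        using E by (intro Bochner_Integration.integrable_sum integrable_mult_right integrable_real_indicator)
          (auto simp: emeasure_eq_measure)
      fix \<omega> assume "\<omega> \<in> space M"
      have "\<bar>G n (X 0 \<omega>)\<bar> * \<bar>G n (X j \<omega>)\<bar> \<le>
          (\<Sum>q\<in>Q. a q * indicator (bin (b n) (s q n)) (X 0 \<omega>)) * (\<Sum>q'\<in>Q. a q' * indicator (bin (b n) (s q' n)) (X j \<omega>))"
        using G_le[OF that] a_nonneg by (intro mult_mono sum_nonneg) auto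
      also have "\<dots> = (\<Sum>q\<in>Q. \<Sum>q'\<in>Q. a q * a q' * indicator (E q q') \<omega>)"
        unfolding sum_product using \<open>\<omega> \<in> space M\<close>
        by (intro sum.cong refl) (auto simp: E_def indicator_def)
      finally show "\<bar>G n (X 0 \<omega>)\<bar> * \<bar>G n (X j \<omega>)\<bar> \<le> \<dots>" .
    qed (rule G_int[OF that])
    also have "\<dots> = (\<Sum>q\<in>Q. \<Sum>q'\<in>Q. a q * a q' * J q q' j n)"
      using E by (simp add: J_def E_def emeasure_eq_measure)
    finally show ?thesis .
  qed
  have G_L2: "(\<lambda>n. expectation (\<lambda>\<omega>. (G n (X 0 \<omega>))\<^sup>2) / b n) \<longlonglongrightarrow> (norm t)\<^sup>2"
  proof -
    have "(\<lambda>n. \<Sum>l\<in>UNIV. (t $ l)\<^sup>2 * (expectation (\<lambda>\<omega>. (polygon_kernel f (b n) (x l) (X 0 \<omega>))\<^sup>2) / b n)) \<longlonglongrightarrow>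
        (\<Sum>l\<in>UNIV. (t $ l)\<^sup>2 * 1)"
      by (intro tendsto_sum tendsto_mult tendsto_const
          polygon_kernel_variance prob_space_axioms dens f_cont f_nonneg x_pos ev_b b_lim)
    moreover have "(\<Sum>l\<in>UNIV. (t $ l)\<^sup>2 * 1) = (norm t)\<^sup>2"
      by (simp add: norm_vec_def L2_set_def sum_nonneg)
    moreover have "\<forall>\<^sub>F n in sequentially. (\<Sum>l\<in>UNIV. (t $ l)\<^sup>2 * (expectation (\<lambda>\<omega>. (polygon_kernel f (b n) (x l) (X 0 \<omega>))\<^sup>2) / b n)) =
        expectation (\<lambda>\<omega>. (G n (X 0 \<omega>))\<^sup>2) / b n"
    proof -
      have "\<forall>\<^sub>F n in sequentially. \<forall>l\<in>UNIV. \<forall>l'\<in>UNIV. l \<noteq> l' \<longrightarrow> 4 * b n \<le> \<bar>x l - x l'\<bar>"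
      proof (intro eventually_ball_finite finite ballI)
        fix l l' :: 'r
        show "\<forall>\<^sub>F n in sequentially. l \<noteq> l' \<longrightarrow> 4 * b n \<le> \<bar>x l - x l'\<bar>"
        proof (cases "l = l'")
          case False
          then have "0 < \<bar>x l - x l'\<bar> / 4" using injD[OF x_distinct, of l l'] by auto
          then have "\<forall>\<^sub>F n in sequentially. b n < \<bar>x l - x l'\<bar> / 4" by (rule order_tendstoD(2)[OF b_lim])
          then show ?thesis by eventually_elim simp
        qed simp
      qed
      with ev_b show ?thesis
      proof eventually_elim
        case (elim n)
        let ?k = "\<lambda>l y. polygon_kernel f (b n) (x l) y"
        have orth: "?k l y * ?k l' y = 0" if "l \<noteq> l'" for l l' y
          using elim that x_pos by (intro polygon_kernels_orthogonal) auto
        have sq: "(G n y)\<^sup>2 = (\<Sum>l\<in>UNIV. (t $ l)\<^sup>2 * (?k l y)\<^sup>2)" for y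
        proof -
          have "(G n y)\<^sup>2 = (\<Sum>l\<in>UNIV. \<Sum>l'\<in>UNIV. (t $ l * ?k l y) * (t $ l' * ?k l' y))"
            unfolding G_def power2_eq_square by (rule sum_product)
          also have "\<dots> = (\<Sum>l\<in>UNIV. \<Sum>l'\<in>UNIV. if l' = l then (t $ l)\<^sup>2 * (?k l y)\<^sup>2 else 0)"
          proof (intro sum.cong refl)
            fix l l' :: 'r
            have "(t $ l * ?k l y) * (t $ l' * ?k l' y) = (t $ l * t $ l') * (?k l y * ?k l' y)"
              by (simp only: mult_ac)
            then show "(t $ l * ?k l y) * (t $ l' * ?k l' y) = (if l' = l then (t $ l)\<^sup>2 * (?k l y)\<^sup>2 else 0)"
              using orth[of l l' y] by (auto simp: power2_eq_square)
          qed
          finally show ?thesis by simp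
        qed
        have "integrable M (\<lambda>\<omega>. (?k l (X 0 \<omega>))\<^sup>2)" for l
          unfolding polygon_kernel_square[where f = f and x = "x l", OF elim(1) x_pos] using ind_int by simp
        then show ?case unfolding sq by (simp add: sum_divide_distrib)
      qed
    qed
    ultimately show ?thesis using tendsto_cong[THEN iffD1] by fastforce
  qed
  have G_L1: "\<forall>\<^sub>F n in sequentially. expectation (\<lambda>\<omega>. \<bar>G n (X 0 \<omega>)\<bar>) \<le> C * b n"
  proof -
    have "\<forall>\<^sub>F n in sequentially. \<forall>q\<in>Q. P q n / b n < f (x (fst q)) + 1"
    proof (intro eventually_ball_finite[OF \<open>finite Q\<close>] ballI)
      fix q assume "q \<in> Q"
      show "\<forall>\<^sub>F n in sequentially. P q n / b n < f (x (fst q)) + 1"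
        by (rule order_tendstoD(2)[OF P_lim[OF \<open>q \<in> Q\<close>]]) simp
    qed
    with ev_b show ?thesis
    proof eventually_elim
      case (elim n)
      have "expectation (\<lambda>\<omega>. \<bar>G n (X 0 \<omega>)\<bar>) \<le> expectation (\<lambda>\<omega>. \<Sum>q\<in>Q. a q * indicator (bin (b n) (s q n)) (X 0 \<omega>))"
      proof (rule integral_mono)
        show "integrable M (\<lambda>\<omega>. \<bar>G n (X 0 \<omega>)\<bar>)" by (rule G_int(1)[OF elim(1)])
      qed (use G_le[OF elim(1)] ind_int in auto)
      also have "\<dots> = (\<Sum>q\<in>Q. a q * P q n)"
        using ind_int ind_exp by (simp add: P_def)
      also have "\<dots> \<le> (\<Sum>q\<in>Q. a q * ((f (x (fst q)) + 1) * b n))"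
        using elim a_nonneg by (intro sum_mono mult_left_mono) (auto simp: divide_less_eq intro: less_imp_le)
      also have "\<dots> = C * b n" by (simp add: C_def sum_distrib_right mult.assoc)
      finally show ?case .
    qed
  qed
  have "0 \<le> C"
    unfolding C_def using a_nonneg f_nonneg by (intro sum_nonneg mult_nonneg_nonneg add_nonneg_nonneg) auto
  interpret R: rescaled_array M X G \<Lambda> b C "(norm t)\<^sup>2"
  proof unfold_locales
    show "\<forall>\<^sub>F n in sequentially. \<forall>y. \<bar>G n y\<bar> \<le> C"
      using ev_b by eventually_elim (use G_bdd in blast)
  qed (fact G_meas \<open>0 \<le> C\<close> ev_\<Lambda> ev_b \<Lambda>_lim b_lim \<Lambda>b_lim G_L1 G_L2)+
  have "R.dependence_error \<longlonglongrightarrow> 0"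
    using mixing
  proof (elim disjE conjE)
    assume joint: "\<forall>s t :: nat \<Rightarrow> int.
           (\<lambda>n. SUP j\<in>- {0}. \<P>(\<omega> in M. X 0 \<omega> \<in> bin (b n) (s n) \<and> X j \<omega> \<in> bin (b n) (t n)))
             \<in> O(\<lambda>n. (b n)\<^sup>2)"
      and summable: "summable (\<lambda>m. real (Suc m) ^ (2 * CARD('d) - 1) * alpha_1 M X \<infinity> (Suc m))"
    define bounds where "bounds q q' c \<longleftrightarrow> 0 < c \<and> (\<forall>\<^sub>F n in sequentially. \<forall>j. j \<noteq> 0 \<longrightarrow> J q q' j n \<le> c * (b n)\<^sup>2)" for q q' c
    have "\<exists>c. bounds q q' c" for q q'
    proof -
      obtain c where "0 < c" and c: "\<forall>\<^sub>F n in sequentially. norm (SUP j\<in>- {0}. J q q' j n) \<le> c * norm ((b n)\<^sup>2)"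
        using joint landau_o.bigE unfolding J_def by blast
      have "\<forall>\<^sub>F n in sequentially. \<forall>j. j \<noteq> 0 \<longrightarrow> J q q' j n \<le> c * (b n)\<^sup>2"
        using c
      proof eventually_elim
        case (elim n)
        have "J q q' j n \<le> (SUP j\<in>- {0}. J q q' j n)" if "j \<noteq> 0" for j
          using that by (intro cSUP_upper bdd_aboveI[of _ 1]) (auto simp: J_def)
        with elim show ?case by fastforce
      qed
      with \<open>0 < c\<close> show ?thesis unfolding bounds_def by blast
    qed
    then obtain c where "\<And>q q'. bounds q q' (c q q')" by metis
    then have c: "\<And>q q'. 0 < c q q'"
      "\<And>q q'. \<forall>\<^sub>F n in sequentially. \<forall>j. j \<noteq> 0 \<longrightarrow> J q q' j n \<le> c q q' * (b n)\<^sup>2"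
      unfolding bounds_def by blast+
    define B where "B = (\<Sum>q\<in>Q. \<Sum>q'\<in>Q. a q * a q' * c q q')"
    show ?thesis
    proof (rule R.dependence_error_strong_mixing[OF _ _ summable])
      show "0 \<le> B" unfolding B_def using a_nonneg c(1) by (intro sum_nonneg mult_nonneg_nonneg less_imp_le[OF c(1)])
      have "\<forall>\<^sub>F n in sequentially. \<forall>q\<in>Q. \<forall>q'\<in>Q. \<forall>j. j \<noteq> 0 \<longrightarrow> J q q' j n \<le> c q q' * (b n)\<^sup>2"
        using c(2) by (intro eventually_ball_finite \<open>finite Q\<close> ballI)
      with ev_b show "\<forall>\<^sub>F n in sequentially. \<forall>j. j \<noteq> 0 \<longrightarrow>
          expectation (\<lambda>\<omega>. \<bar>G n (X 0 \<omega>)\<bar> * \<bar>G n (X j \<omega>)\<bar>) \<le> B * (b n)\<^sup>2"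
      proof eventually_elim
        case (elim n)
        show ?case
        proof (intro allI impI)
          fix j :: "int ^ 'd" assume "j \<noteq> 0"
          have "expectation (\<lambda>\<omega>. \<bar>G n (X 0 \<omega>)\<bar> * \<bar>G n (X j \<omega>)\<bar>) \<le> (\<Sum>q\<in>Q. \<Sum>q'\<in>Q. a q * a q' * J q q' j n)"
            by (rule joint_le[OF elim(1)])
          also have "\<dots> \<le> (\<Sum>q\<in>Q. \<Sum>q'\<in>Q. a q * a q' * (c q q' * (b n)\<^sup>2))"
            using elim(2) \<open>j \<noteq> 0\<close> a_nonneg by (intro sum_mono mult_left_mono) auto
          also have "\<dots> = B * (b n)\<^sup>2" by (simp add: B_def sum_distrib_right mult.assoc)
          finally show "expectation (\<lambda>\<omega>. \<bar>G n (X 0 \<omega>)\<bar> * \<bar>G n (X j \<omega>)\<bar>) \<le> B * (b n)\<^sup>2" .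
        qed
      qed
    qed
  next
    assume joint: "\<forall>(s :: nat \<Rightarrow> int) (t :: nat \<Rightarrow> int) j. j \<noteq> 0 \<longrightarrow>
           (\<lambda>n. \<P>(\<omega> in M. X 0 \<omega> \<in> bin (b n) (s n) \<and> X j \<omega> \<in> bin (b n) (t n))) \<in> o(b)"
      and summable: "summable (\<lambda>m. real (Suc m) ^ (CARD('d) - 1) * rho_1 M X \<infinity> (Suc m))"
    show ?thesis
    proof (rule R.dependence_error_correlation_mixing[OF _ summable])
      fix j :: "int ^ 'd" assume "j \<noteq> 0"
      have J_lim: "(\<lambda>n. J q q' j n / b n) \<longlonglongrightarrow> 0" for q q'
        unfolding J_def using joint \<open>j \<noteq> 0\<close> by (intro smalloD_tendsto) blast
      show "(\<lambda>n. expectation (\<lambda>\<omega>. \<bar>G n (X 0 \<omega>)\<bar> * \<bar>G n (X j \<omega>)\<bar>) / b n) \<longlonglongrightarrow> 0"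
      proof (rule Lim_null_comparison)
        show "(\<lambda>n. \<Sum>q\<in>Q. \<Sum>q'\<in>Q. a q * a q' * (J q q' j n / b n)) \<longlonglongrightarrow> 0"
          by (intro tendsto_null_sum tendsto_mult_right_zero J_lim)
        show "\<forall>\<^sub>F n in sequentially. norm (expectation (\<lambda>\<omega>. \<bar>G n (X 0 \<omega>)\<bar> * \<bar>G n (X j \<omega>)\<bar>) / b n) \<le>
            (\<Sum>q\<in>Q. \<Sum>q'\<in>Q. a q * a q' * (J q q' j n / b n))"
          using ev_b
        proof eventually_elim
          case (elim n)
          have "0 \<le> expectation (\<lambda>\<omega>. \<bar>G n (X 0 \<omega>)\<bar> * \<bar>G n (X j \<omega>)\<bar>)" by simp
          moreover have "expectation (\<lambda>\<omega>. \<bar>G n (X 0 \<omega>)\<bar> * \<bar>G n (X j \<omega>)\<bar>) / b n \<le> (\<Sum>q\<in>Q. \<Sum>q'\<in>Q. a q * a q' * J q q' j n) / b n"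
            using joint_le[OF elim] elim by (intro divide_right_mono) auto
          ultimately show ?case using elim by (simp add: sum_divide_distrib)
        qed
      qed
    qed
  qed
  then have "(\<lambda>n. expectation (\<lambda>\<omega>. iexp (R.centered_sum n \<omega>))) \<longlonglongrightarrow> of_real (exp (- (norm t)\<^sup>2 / 2))"
    by (rule R.char_centered_sum_converges)
  moreover have "\<forall>\<^sub>F n in sequentially. expectation (\<lambda>\<omega>. iexp (R.centered_sum n \<omega>)) =
      expectation (\<lambda>\<omega>. iexp (t \<bullet> (\<chi> l. sqrt (real (card (\<Lambda> n)) * b n) *
      (freq_polygon X f (\<Lambda> n) (b n) (x l) \<omega> - expectation (freq_polygon X f (\<Lambda> n) (b n) (x l))))))"
    using ev_b ev_\<Lambda> R.card_pos
  proof eventually_elim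
    case (elim n)
    have "R.centered_sum n \<omega> = t \<bullet> (\<chi> l. sqrt (real (card (\<Lambda> n)) * b n) *
      (freq_polygon X f (\<Lambda> n) (b n) (x l) \<omega> - expectation (freq_polygon X f (\<Lambda> n) (b n) (x l))))" for \<omega>
      unfolding linear_form_eq_centered_kernel_sum[where f = f and x = x, OF elim x_pos]
        R.centered_sum_def R.scaled_def G_def ..
    then show ?case by (simp only:)
  qed
  ultimately show ?thesis by (rule Lim_transform_eventually)
qed

end

theorem theorem1:
  fixes M :: "'a measure"
    and X :: "int ^ 'd \<Rightarrow> 'a \<Rightarrow> real"
    and f f' :: "real \<Rightarrow> real"
    and \<Lambda> :: "nat \<Rightarrow> (int ^ 'd) set"
    and b :: "nat \<Rightarrow> real"
    and x :: "'r::finite \<Rightarrow> real"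
  assumes prob: "prob_space M"
    and stat: "stationary_field M X"
    and f_nonneg: "\<And>u. 0 \<le> f u"
    and dens: "\<And>i. distributed M lborel (X i) (\<lambda>u. ennreal (f u))"
    and \<Lambda>_finite: "\<And>n. n \<ge> 1 \<Longrightarrow> finite (\<Lambda> n)"
    and \<Lambda>_lim: "filterlim (\<lambda>n. real (card (\<Lambda> n))) at_top sequentially"
    and b_pos: "\<And>n. n \<ge> 1 \<Longrightarrow> b n > 0"
    and f_deriv: "\<And>u. (f has_real_derivative f' u) (at u)"
    and f'_bdd: "\<And>K. compact K \<Longrightarrow> bounded (f' ` K)"
    and b_lim: "b \<longlonglongrightarrow> 0"
    and \<Lambda>b_lim: "filterlim (\<lambda>n. real (card (\<Lambda> n)) * b n) at_top sequentially"
    and mixing: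
      "((\<forall>s t :: nat \<Rightarrow> int.
           (\<lambda>n. SUP j\<in>- {0}. \<P>(\<omega> in M. X 0 \<omega> \<in> bin (b n) (s n) \<and> X j \<omega> \<in> bin (b n) (t n)))
             \<in> O(\<lambda>n. (b n)\<^sup>2)) \<and>
        summable (\<lambda>m. real (Suc m) ^ (2 * CARD('d) - 1) * alpha_1 M X \<infinity> (Suc m)))
       \<or>
       ((\<forall>(s :: nat \<Rightarrow> int) (t :: nat \<Rightarrow> int) j. j \<noteq> 0 \<longrightarrow>
           (\<lambda>n. \<P>(\<omega> in M. X 0 \<omega> \<in> bin (b n) (s n) \<and> X j \<omega> \<in> bin (b n) (t n))) \<in> o(b)) \<and>
        summable (\<lambda>m. real (Suc m) ^ (CARD('d) - 1) * rho_1 M X \<infinity> (Suc m)))"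
    and x_distinct: "inj x"
    and x_pos: "\<And>l. f (x l) > 0"
  shows "conv_in_law M
           (\<lambda>n \<omega>. \<chi> l. sqrt (real (card (\<Lambda> n)) * b n) *
              (freq_polygon X f (\<Lambda> n) (b n) (x l) \<omega>
                - prob_space.expectation M (freq_polygon X f (\<Lambda> n) (b n) (x l))))
           (std_gaussian :: (real ^ 'r) measure)"
proof -
  interpret stationary_random_field M X
    using prob stat by (simp add: stationary_random_field_def stationary_random_field_axioms_def)
  define Z where "Z n \<omega> = (\<chi> l. sqrt (real (card (\<Lambda> n)) * b n) *
      (freq_polygon X f (\<Lambda> n) (b n) (x l) \<omega> - expectation (freq_polygon X f (\<Lambda> n) (b n) (x l))))" for n \<omega>
  have Z_meas: "Z (Suc n) \<in> borel_measurable M" for n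
  proof -
    have "(\<lambda>\<omega>. Z (Suc n) \<omega> \<bullet> axis l 1) \<in> borel_measurable M" for l
      using freq_polygon_measurable[OF b_pos \<Lambda>_finite, of "Suc n" "Suc n" f "x l"]
      by (simp add: Z_def inner_axis)
    then show ?thesis
      by (subst borel_measurable_euclidean_space) (auto simp: Basis_vec_def)
  qed
  have char: "(\<lambda>n. expectation (\<lambda>\<omega>. iexp (t \<bullet> Z n \<omega>))) \<longlonglongrightarrow> of_real (exp (- (norm t)\<^sup>2 / 2))" for t
    unfolding Z_def
    by (rule char_frequency_polygon_converges[OF f_nonneg dens \<Lambda>_finite \<Lambda>_lim b_pos DERIV_isCont[OF f_deriv]
        b_lim \<Lambda>b_lim mixing x_distinct x_pos])
  have "(\<lambda>n. \<integral>z. \<phi> z \<partial>distr M borel (Z n)) \<longlonglongrightarrow> (\<integral>z. \<phi> z \<partial>std_gaussian)"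
    if "continuous_on UNIV \<phi>" "bounded (range \<phi>)" for \<phi> :: "real ^ 'r \<Rightarrow> real"
  \<comment> \<open>The shift of the index avoids \<open>Z 0\<close>, whose region and bin width are arbitrary.\<close>
  proof (rule LIMSEQ_imp_Suc, rule levy_continuity_euclidean[OF _ _ _ _ _ that])
    show "prob_space (distr M borel (Z (Suc n)))" for n by (rule prob_space_distr[OF Z_meas])
    show "(\<lambda>n. \<integral>z. iexp (t \<bullet> z) \<partial>distr M borel (Z (Suc n))) \<longlonglongrightarrow> (\<integral>z. iexp (t \<bullet> z) \<partial>std_gaussian)" for t
    proof -
      have "(\<integral>z. iexp (t \<bullet> z) \<partial>distr M borel (Z (Suc n))) = expectation (\<lambda>\<omega>. iexp (t \<bullet> Z (Suc n) \<omega>))" for n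
        by (rule integral_distr[OF Z_meas]) measurable
      then show ?thesis
        unfolding char_std_gaussian using LIMSEQ_Suc[OF char[of t]] by simp
    qed
  qed (simp_all add: std_gaussian_prob_space sets_std_gaussian)
  then show ?thesis unfolding conv_in_law_def Z_def by blast
qed

end
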